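(* Let $d>0$, let $1\le\lambda_1\le\lambda_2\le\cdots$ with $\lambda_k\to\infty$ and $\lambda_k\asymp k^{2/d}$, and let $r,\alpha\in\mathbb R$ with $\alpha+r>d/2$. For $s\in\mathbb R$ with $s+r\ge0$ let $X_s=(H^{-r},\tau_{H^{-r}},d_s,\mathfrak m)$ be the emm-space described in the context (law of the Gaussian field $\sum_k\lambda_k^{-\alpha/2}\xi_ke_k$ with the $H^s$ extended distance). Then: \begin{enumerate} \item $X_s\in\mathfrak X_{\rm conc}$ if and only if $s<\alpha$; \item $X_s\in\partial\mathfrak X_{\rm conc}$ if and only if $\alpha-\frac d2\le s<\alpha$; \item if $s_n\to s\in(-\infty,\alpha)$ with $s_n+r\ge0$ for all sufficiently large $n$, then $X_{s_n}\to X_s$ in $d_{\rm conc}$. \end{enumerate}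
   Context: Let $H$ be a separable real Hilbert space with orthonormal basis $(e_k)_{k\in\mathbb N}$. For $t\in\mathbb R$, $H^t=\{x=\sum_kx_ke_k:\sum_k\lambda_k^tx_k^2<\infty\}$ with norm $\|x\|_{H^t}^2=\sum_k\lambda_k^tx_k^2$ (for $t<0$, the completion of $H$ for this norm). Let $\xi_k$ be independent real centred Gaussian random variables with variance 1. Since $\alpha+r>d/2$, $\sum_k\lambda_k^{-r-\alpha}<\infty$ and the series $\Phi=\sum_k\lambda_k^{-\alpha/2}\xi_ke_k$ converges almost surely in $H^{-r}$; $\mathfrak m$ is its law on $H^{-r}$. $\tau_{H^{-r}}$ is the norm topology of $H^{-r}$, and $d_s(x,y)=\|x-y\|_{H^s}$ if $x-y\in H^s$ and $+\infty$ otherwise. $\lambda_k\asymp k^{2/d}$ means that $c\,k^{2/d}\le\lambda_k\le C\,k^{2/d}$ for constants $0<c\le C<\infty$. An emm-space is $(X,\tau,d,m)$ with $(X,\tau)$ Polish, $d:X\times X\to[0,+\infty]$ a complete, $\tau\times\tau$-lower semicontinuous extended distance (symmetric, triangle inequality, $d(x,y)=0$ iff $x=y$) whose induced topology is finer than or equal to $\tau$, and $m$ a $\tau$-Borel probability measure. An mm-space is a complete separable metric space with a Borel probability measure, regarded as an emm-space with its metric topology. Two emm-spaces $X,Y$ are emm-isomorphic if there are an $m_X$-measurable $F:X\to Y$ with $F_\#m_X=m_Y$ and $A\subset X$ with $m_X(A)=1$ such that $d_Y(F(x),F(y))=d_X(x,y)$ for $x,y\in A$. $L^0(X)$ is the space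 of $m_X$-classes of real measurable functions with $d_{L^0}(f,g)=\inf\{\varepsilon>0:m_X(|f-g|>\varepsilon)\le\varepsilon\}$; $\mathrm{Lip}_1(X,m_X)\subset L^0(X)$ is the set of classes of $f$ with $|f(x)-f(y)|\le d_X(x,y)$ on $E\times E$ for some $E$ with $m_X(E)=1$; $\mathcal L_1(X)=\mathrm{Lip}_1(X,m_X)/\mathbb R$ is the quotient by constants with the quotient distance. $X$ is concentrated if $\mathcal L_1(X)$ is compact; $\mathfrak X_{\rm conc}$ is the set of emm-isomorphism classes of concentrated emm-spaces; $\partial\mathfrak X_{\rm conc}$ is the subset of those not emm-isomorphic to any mm-space. A parameter of $X$ is a Borel map $\iota_X$ from the unit interval $I$ to $(X,\tau)$ with $(\iota_X)_\#\mathrm{Leb}=m_X$. For concentrated $X,Y$, $d_{\rm conc}(X,Y)=\inf_{\iota_X,\iota_Y}d_H^{L^0}(\iota_X^*\mathrm{Lip}_1(X,m_X),\iota_Y^*\mathrm{Lip}_1(Y,m_Y))$ over all parameters, with $\iota^*f=f\circ\iota$ and $d_H^{L^0}$ the Hausdorff distance in $(L^0(I,\mathrm{Leb}),d_{L^0})$. *)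

theory Defs
  imports "HOL-Probability.Probability"
begin

section \<open>Extended metric measure spaces\<close>

record 'a emm =
  topo :: "'a topology"
  edist :: "'a \<Rightarrow> 'a \<Rightarrow> ennreal"
  meas :: "'a measure"

definition borel_of :: "'a topology \<Rightarrow> 'a measure" where
  "borel_of T = sigma (topspace T) {U. openin T U}"

lemma space_borel_of [simp]: "space (borel_of T) = topspace T"
proof -
  have "{U. openin T U} \<subseteq> Pow (topspace T)"
    using openin_subset by blast
  then show ?thesis unfolding borel_of_def by (rule space_measure_of)
qed

lemma sets_borel_of: "sets (borel_of T) = sigma_sets (topspace T) {U. openin T U}"
proof -
  have "{U. openin T U} \<subseteq> Pow (topspace T)"
    using openin_subset by blast
  then show ?thesis unfolding borel_of_def by (rule sets_measure_of)
qed

definition borel_prob :: "'a topology \<Rightarrow> 'a measure \<Rightarrow> bool" where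
  "borel_prob T M \<longleftrightarrow> prob_space M \<and> space M = topspace T \<and> sets M = sets (borel_of T)"

definition polish_topology :: "'a topology \<Rightarrow> bool" where
  "polish_topology T \<longleftrightarrow> completely_metrizable_space T \<and> separable_space T"

definition ext_distance_on :: "'a set \<Rightarrow> ('a \<Rightarrow> 'a \<Rightarrow> ennreal) \<Rightarrow> bool" where
  "ext_distance_on S d \<longleftrightarrow>
     (\<forall>x\<in>S. \<forall>y\<in>S. d x y = d y x) \<and>
     (\<forall>x\<in>S. \<forall>y\<in>S. d x y = 0 \<longleftrightarrow> x = y) \<and>
     (\<forall>x\<in>S. \<forall>y\<in>S. \<forall>z\<in>S. d x z \<le> d x y + d y z)"

definition ext_complete_on :: "'a set \<Rightarrow> ('a \<Rightarrow> 'a \<Rightarrow> ennreal) \<Rightarrow> bool" where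
  "ext_complete_on S d \<longleftrightarrow>
     (\<forall>x. (\<forall>n::nat. x n \<in> S) \<and> (\<forall>\<epsilon>>0. \<exists>N. \<forall>m\<ge>N. \<forall>n\<ge>N. d (x m) (x n) < \<epsilon>)
        \<longrightarrow> (\<exists>y\<in>S. (\<lambda>n. d (x n) y) \<longlonglongrightarrow> 0))"

definition ext_open :: "'a set \<Rightarrow> ('a \<Rightarrow> 'a \<Rightarrow> ennreal) \<Rightarrow> 'a set \<Rightarrow> bool" where
  "ext_open S d U \<longleftrightarrow> U \<subseteq> S \<and> (\<forall>x\<in>U. \<exists>\<epsilon>>0. \<forall>y\<in>S. d x y < \<epsilon> \<longrightarrow> y \<in> U)"

definition lsc_on_square :: "'a topology \<Rightarrow> ('a \<Rightarrow> 'a \<Rightarrow> ennreal) \<Rightarrow> bool" where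
  "lsc_on_square T d \<longleftrightarrow>
     (\<forall>a. closedin (prod_topology T T) {(x, y). x \<in> topspace T \<and> y \<in> topspace T \<and> d x y \<le> a})"

definition emm_space :: "'a emm \<Rightarrow> bool" where
  "emm_space X \<longleftrightarrow>
     polish_topology (topo X) \<and>
     ext_distance_on (topspace (topo X)) (edist X) \<and>
     ext_complete_on (topspace (topo X)) (edist X) \<and>
     lsc_on_square (topo X) (edist X) \<and>
     (\<forall>U. openin (topo X) U \<longrightarrow> ext_open (topspace (topo X)) (edist X) U) \<and>
     borel_prob (topo X) (meas X)"

definition mm_space :: "'a emm \<Rightarrow> bool" where
  "mm_space X \<longleftrightarrow>
     (\<exists>S \<rho>. Metric_space S \<rho> \<and> Metric_space.mcomplete S \<rho> \<and>
        topo X = Metric_space.mtopology S \<rho> \<and>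
        separable_space (topo X) \<and>
        (\<forall>x\<in>S. \<forall>y\<in>S. edist X x y = ennreal (\<rho> x y)) \<and>
        borel_prob (topo X) (meas X))"

definition emm_iso :: "'a emm \<Rightarrow> 'b emm \<Rightarrow> bool" where
  "emm_iso X Y \<longleftrightarrow>
     (\<exists>F A. F \<in> measurable (completion (meas X)) (meas Y) \<and>
        distr (completion (meas X)) (meas Y) F = meas Y \<and>
        A \<in> sets (completion (meas X)) \<and> emeasure (completion (meas X)) A = 1 \<and>
        (\<forall>x\<in>A. \<forall>y\<in>A. edist Y (F x) (F y) = edist X x y))"

text \<open>Every mm-space is isomorphic to one carried by a set of real sequences (the distances to a
  dense sequence), so quantifying over mm-spaces of that type loses nothing.\<close>

lemma mm_space_carrier:
  fixes Z :: "'b emm"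
  assumes Z: "mm_space Z" and iso: "emm_iso X Z"
  shows "\<exists>Y :: (nat \<Rightarrow> real) emm. mm_space Y \<and> emm_iso X Y"
proof -
  obtain S \<rho> where MS: "Metric_space S \<rho>" and mc: "Metric_space.mcomplete S \<rho>"
    and top: "topo Z = Metric_space.mtopology S \<rho>" and sep: "separable_space (topo Z)"
    and ed: "\<And>x y. x \<in> S \<Longrightarrow> y \<in> S \<Longrightarrow> edist Z x y = ennreal (\<rho> x y)"
    and bp: "borel_prob (topo Z) (meas Z)"
    using Z unfolding mm_space_def by blast
  interpret Z: Metric_space S \<rho> by (rule MS)
  have pZ: "prob_space (meas Z)" and spZ: "space (meas Z) = S"
    and setsZ: "sets (meas Z) = sets (borel_of (topo Z))"
    using bp by (auto simp: borel_prob_def top)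
  have Sne: "S \<noteq> {}" using prob_space.not_empty[OF pZ] spZ by simp
  obtain C where C: "countable C" "C \<subseteq> S" "Z.mtopology closure_of C = S"
    using sep by (auto simp: separable_space_def top)
  have Cne: "C \<noteq> {}" using C Sne by auto
  define a where "a = from_nat_into C"
  have aC: "range a = C" unfolding a_def by (rule range_from_nat_into[OF Cne C(1)])
  have aS: "a n \<in> S" for n using aC C(2) by blast
  define \<Phi> where "\<Phi> = (\<lambda>x n. \<rho> x (a n))"
  have inj: "inj_on \<Phi> S"
  proof (rule inj_onI, rule ccontr)
    fix x y assume x: "x \<in> S" and y: "y \<in> S" and eq: "\<Phi> x = \<Phi> y" and ne: "x \<noteq> y"
    have pos: "\<rho> x y / 2 > 0" using x y ne by simp
    have "x \<in> Z.mtopology closure_of C" using x C(3) by simp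
    then have "\<forall>\<epsilon>>0. \<exists>c\<in>C. c \<in> Z.mball x \<epsilon>"
      unfolding Z.metric_closure_of by blast
    then obtain c where c: "c \<in> C" "\<rho> x c < \<rho> x y / 2"
      using pos by (metis Z.in_mball)
    then obtain n where n: "c = a n" using aC by blast
    have "\<rho> y c = \<rho> x c" using fun_cong[OF eq, of n] by (simp add: \<Phi>_def n)
    moreover have "\<rho> x y \<le> \<rho> x c + \<rho> y c"
      using Z.triangle'[of x c y] x y aS n by simp
    ultimately show False using c(2) by linarith
  qed
  define \<Psi> where "\<Psi> = inv_into S \<Phi>"
  have inv[simp]: "\<Psi> (\<Phi> x) = x" if "x \<in> S" for x
    unfolding \<Psi>_def by (rule inv_into_f_f[OF inj that])
  define T where "T = \<Phi> ` S"
  define \<rho>' where "\<rho>' = (\<lambda>p q. \<rho> (\<Psi> p) (\<Psi> q))"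
  have dist[simp]: "\<rho>' (\<Phi> x) (\<Phi> y) = \<rho> x y" if "x \<in> S" "y \<in> S" for x y
    using that by (simp add: \<rho>'_def)
  have MT: "Metric_space T \<rho>'"
  proof
    show "0 \<le> \<rho>' x y" for x y by (simp add: \<rho>'_def)
    show "\<rho>' x y = \<rho>' y x" for x y by (simp add: \<rho>'_def Z.commute)
    show "(\<rho>' x y = 0) = (x = y)" if "x \<in> T" "y \<in> T" for x y
      using that inj by (auto simp: T_def inj_on_def)
    show "\<rho>' x z \<le> \<rho>' x y + \<rho>' y z" if "x \<in> T" "y \<in> T" "z \<in> T" for x y z
      using that by (auto simp: T_def Z.triangle)
  qed
  interpret T: Metric_space T \<rho>' by (rule MT)
  have cont: "continuous_map Z.mtopology T.mtopology \<Phi>"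
    unfolding Metric_space.metric_continuous_map[OF MS MT]
    by (auto simp: T_def intro!: exI)
  have comp: "T.mcomplete"
    unfolding T.mcomplete_def
  proof (intro allI impI)
    fix \<sigma> assume \<sigma>: "T.MCauchy \<sigma>"
    have \<sigma>T: "\<sigma> n \<in> T" for n using \<sigma> by (auto simp: T.MCauchy_def)
    have \<Psi>S: "\<Psi> (\<sigma> n) \<in> S" "\<Phi> (\<Psi> (\<sigma> n)) = \<sigma> n" for n using \<sigma>T[of n] by (auto simp: T_def)
    have "Z.MCauchy (\<lambda>n. \<Psi> (\<sigma> n))"
      using \<sigma> \<Psi>S unfolding T.MCauchy_def Z.MCauchy_def by (auto simp: \<rho>'_def)
    then obtain x where "limitin Z.mtopology (\<lambda>n. \<Psi> (\<sigma> n)) x sequentially"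
      using mc by (auto simp: Z.mcomplete_def)
    then have "limitin T.mtopology (\<Phi> \<circ> (\<lambda>n. \<Psi> (\<sigma> n))) (\<Phi> x) sequentially"
      by (rule continuous_map_limit[OF cont])
    then show "\<exists>x. limitin T.mtopology \<sigma> x sequentially" using \<Psi>S by (auto simp: o_def)
  qed
  have sepT: "separable_space T.mtopology"
    by (rule separable_space_continuous_map_image[OF sep[unfolded top] cont])
       (simp only: Z.topspace_mtopology T.topspace_mtopology, simp only: T_def)
  have meas\<Phi>: "\<Phi> \<in> measurable (meas Z) (borel_of T.mtopology)"
  proof (rule measurable_sigma_sets[OF sets_borel_of])
    show "{U. openin T.mtopology U} \<subseteq> Pow (topspace T.mtopology)"
      using openin_subset by blast
    show "\<Phi> \<in> space (meas Z) \<rightarrow> topspace T.mtopology"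
      by (simp only: T.topspace_mtopology spZ) (simp add: T_def)
    fix V assume "V \<in> {U. openin T.mtopology U}"
    then have "openin Z.mtopology {x \<in> topspace Z.mtopology. \<Phi> x \<in> V}"
      using cont by (auto simp: continuous_map_def)
    moreover have "\<Phi> -` V \<inter> space (meas Z) = {x \<in> topspace Z.mtopology. \<Phi> x \<in> V}"
      by (auto simp: spZ)
    ultimately show "\<Phi> -` V \<inter> space (meas Z) \<in> sets (meas Z)"
      unfolding setsZ sets_borel_of top by (auto intro: sigma_sets.Basic)
  qed
  define Y where "Y = \<lparr>topo = T.mtopology, edist = (\<lambda>p q. ennreal (\<rho>' p q)),
    meas = distr (meas Z) (borel_of T.mtopology) \<Phi>\<rparr>"
  have "mm_space Y"
    unfolding mm_space_def
  proof (intro exI conjI)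
    show "Metric_space T \<rho>'" by (rule MT)
    show "Metric_space.mcomplete T \<rho>'" by (rule comp)
    show "borel_prob (topo Y) (meas Y)"
      using prob_space.prob_space_distr[OF pZ meas\<Phi>]
      by (simp add: Y_def borel_prob_def)
  qed (use sepT in \<open>auto simp: Y_def\<close>)
  moreover have "emm_iso X Y"
  proof -
    obtain F A where F: "F \<in> measurable (completion (meas X)) (meas Z)"
      and dF: "distr (completion (meas X)) (meas Z) F = meas Z"
      and A: "A \<in> sets (completion (meas X))" "emeasure (completion (meas X)) A = 1"
      and isom: "\<And>x y. x \<in> A \<Longrightarrow> y \<in> A \<Longrightarrow> edist Z (F x) (F y) = edist X x y"
      using iso unfolding emm_iso_def by blast
    have FA: "F x \<in> S" if "x \<in> A" for x
      using measurable_space[OF F] sets.sets_into_space[OF A(1)] that spZ by auto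
    have mY: "meas Y = distr (meas Z) (borel_of T.mtopology) \<Phi>" by (simp add: Y_def)
    have m1: "\<Phi> \<circ> F \<in> measurable (completion (meas X)) (borel_of T.mtopology)"
      by (rule measurable_comp[OF F meas\<Phi>])
    have "distr (completion (meas X)) (borel_of T.mtopology) (\<Phi> \<circ> F) = meas Y"
      unfolding mY using distr_distr[OF meas\<Phi> F] dF by simp
    moreover have "distr (completion (meas X)) (meas Y) (\<Phi> \<circ> F) =
        distr (completion (meas X)) (borel_of T.mtopology) (\<Phi> \<circ> F)"
      by (rule distr_cong) (simp_all add: mY)
    moreover have "\<Phi> \<circ> F \<in> measurable (completion (meas X)) (meas Y)"
      using m1 by (simp add: mY)
    moreover have "\<forall>x\<in>A. \<forall>y\<in>A. edist Y ((\<Phi> \<circ> F) x) ((\<Phi> \<circ> F) y) = edist X x y"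
      using FA isom ed by (simp add: Y_def) 
    ultimately show ?thesis
      unfolding emm_iso_def using A by (intro exI[of _ "\<Phi> \<circ> F"] exI[of _ A] conjI) simp_all
  qed
  ultimately show ?thesis by blast
qed


section \<open>The space L0 and its 1-Lipschitz elements\<close>

text \<open>Elements of \<open>L\<^sup>0\<close> are genuine almost-everywhere classes. All functions are total on the
  ambient type; values outside \<^term>\<open>space M\<close> are irrelevant.\<close>

definition L0_class :: "'a measure \<Rightarrow> ('a \<Rightarrow> real) \<Rightarrow> ('a \<Rightarrow> real) set" where
  "L0_class M f = {g \<in> borel_measurable M. AE x in M. g x = f x}"

definition L0 :: "'a measure \<Rightarrow> ('a \<Rightarrow> real) set set" where
  "L0 M = L0_class M ` borel_measurable M"

definition L0_dist :: "'a measure \<Rightarrow> ('a \<Rightarrow> real) set \<Rightarrow> ('a \<Rightarrow> real) set \<Rightarrow> ennreal" where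
  "L0_dist M u v =
     (INF \<epsilon>\<in>{\<epsilon>::real. \<epsilon> > 0 \<and>
         (\<exists>f\<in>u. \<exists>g\<in>v. measure M {x \<in> space M. \<bar>f x - g x\<bar> > \<epsilon>} \<le> \<epsilon>)}. ennreal \<epsilon>)"

definition Lip1 :: "'a emm \<Rightarrow> ('a \<Rightarrow> real) set set" where
  "Lip1 X = {u \<in> L0 (meas X). \<exists>f\<in>u. \<exists>E\<in>sets (meas X). measure (meas X) E = 1 \<and>
       (\<forall>x\<in>E. \<forall>y\<in>E. ennreal \<bar>f x - f y\<bar> \<le> edist X x y)}"

definition const_orbit :: "('a \<Rightarrow> real) set \<Rightarrow> ('a \<Rightarrow> real) set set" where
  "const_orbit u = range (\<lambda>c::real. (\<lambda>f x. f x + c) ` u)"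

definition Lip1_mod_const :: "'a emm \<Rightarrow> ('a \<Rightarrow> real) set set set" where
  "Lip1_mod_const X = const_orbit ` Lip1 X"

text \<open>The infimum is taken in \<^typ>\<open>ennreal\<close>, where it has no unspecified values, and is at most 1 for
  nonempty classes over a probability space; \<^const>\<open>enn2real\<close> only changes the type.\<close>

definition quotient_dist ::
  "'a measure \<Rightarrow> ('a \<Rightarrow> real) set set \<Rightarrow> ('a \<Rightarrow> real) set set \<Rightarrow> real" where
  "quotient_dist M p q = enn2real (INF u\<in>p. INF v\<in>q. L0_dist M u v)"

definition concentrated :: "'a emm \<Rightarrow> bool" where
  "concentrated X \<longleftrightarrow>
     compact_space (Metric_space.mtopology (Lip1_mod_const X) (quotient_dist (meas X)))"

text \<open>The sets of isomorphism classes are represented by the collections of all their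
  representatives.\<close>

definition X_conc :: "'a emm set" where
  "X_conc = {X. emm_space X \<and> concentrated X}"

text \<open>By \<open>mm_space_carrier\<close>, the type \<^typ>\<open>nat \<Rightarrow> real\<close> suffices for the carrier of \<open>Y\<close>.\<close>

definition boundary_X_conc :: "'a emm set" where
  "boundary_X_conc = {X \<in> X_conc. \<not> (\<exists>Y :: (nat \<Rightarrow> real) emm. mm_space Y \<and> emm_iso X Y)}"


section \<open>The concentration distance\<close>

definition unit_Leb :: "real measure" where
  "unit_Leb = restrict_space lborel {0..1}"

definition parameters :: "'a emm \<Rightarrow> (real \<Rightarrow> 'a) set" where
  "parameters X = {\<iota> \<in> measurable unit_Leb (borel_of (topo X)).
     distr unit_Leb (borel_of (topo X)) \<iota> = meas X}"

definition L0_pullback :: "(real \<Rightarrow> 'a) \<Rightarrow> ('a \<Rightarrow> real) set \<Rightarrow> (real \<Rightarrow> real) set" where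
  "L0_pullback \<iota> u = (\<Union>f\<in>u. L0_class unit_Leb (f \<circ> \<iota>))"

definition hausdorff_dist :: "('a \<Rightarrow> 'a \<Rightarrow> ennreal) \<Rightarrow> 'a set \<Rightarrow> 'a set \<Rightarrow> ennreal" where
  "hausdorff_dist d A B = max (SUP a\<in>A. INF b\<in>B. d a b) (SUP b\<in>B. INF a\<in>A. d a b)"

definition d_conc :: "'a emm \<Rightarrow> 'b emm \<Rightarrow> ennreal" where
  "d_conc X Y = (INF \<iota>\<in>parameters X. INF \<kappa>\<in>parameters Y.
     hausdorff_dist (L0_dist unit_Leb) (L0_pullback \<iota> ` Lip1 X) (L0_pullback \<kappa> ` Lip1 Y))"


section \<open>The Hilbert scale and the Gaussian field\<close>

text \<open>A vector \<open>\<Sum>\<^sub>k x\<^sub>k e\<^sub>k\<close> is represented by its coordinate sequence. This also covers negative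
  exponents: the weighted sequence space is complete and contains the coordinate sequences of \<open>H\<close>
  (\<open>t = 0\<close>) densely, so it is the completion of \<open>H\<close>. Indices start at 0, so that \<open>lam k\<close>
  is \<open>\<lambda>\<^sub>k\<^sub>+\<^sub>1\<close> and \<open>\<xi> k\<close> is \<open>\<xi>\<^sub>k\<^sub>+\<^sub>1\<close>.\<close>

definition H_space :: "(nat \<Rightarrow> real) \<Rightarrow> real \<Rightarrow> (nat \<Rightarrow> real) set" where
  "H_space lam t = {x. (\<lambda>k. lam k powr t * (x k)\<^sup>2) summable_on UNIV}"

definition H_norm :: "(nat \<Rightarrow> real) \<Rightarrow> real \<Rightarrow> (nat \<Rightarrow> real) \<Rightarrow> real" where
  "H_norm lam t x = sqrt (\<Sum>\<^sub>\<infinity>k. lam k powr t * (x k)\<^sup>2)"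

definition H_topology :: "(nat \<Rightarrow> real) \<Rightarrow> real \<Rightarrow> (nat \<Rightarrow> real) topology" where
  "H_topology lam t =
     Metric_space.mtopology (H_space lam t) (\<lambda>x y. H_norm lam t (\<lambda>k. x k - y k))"

definition H_ext_dist :: "(nat \<Rightarrow> real) \<Rightarrow> real \<Rightarrow> (nat \<Rightarrow> real) \<Rightarrow> (nat \<Rightarrow> real) \<Rightarrow> ennreal" where
  "H_ext_dist lam s x y =
     (if (\<lambda>k. x k - y k) \<in> H_space lam s then ennreal (H_norm lam s (\<lambda>k. x k - y k)) else \<infinity>)"

definition basis_vec :: "nat \<Rightarrow> nat \<Rightarrow> real" where
  "basis_vec k = (\<lambda>i. if i = k then 1 else 0)"

definition field_partial_sum ::
  "(nat \<Rightarrow> real) \<Rightarrow> real \<Rightarrow> (nat \<Rightarrow> 'w \<Rightarrow> real) \<Rightarrow> 'w \<Rightarrow> nat \<Rightarrow> nat \<Rightarrow> real" where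
  "field_partial_sum lam \<alpha> \<xi> \<omega> n =
     (\<lambda>i. \<Sum>k<n. lam k powr (- \<alpha> / 2) * \<xi> k \<omega> * basis_vec k i)"

text \<open>The value 0 on the null set where the series diverges is arbitrary.\<close>

definition gaussian_field ::
  "(nat \<Rightarrow> real) \<Rightarrow> real \<Rightarrow> real \<Rightarrow> (nat \<Rightarrow> 'w \<Rightarrow> real) \<Rightarrow> 'w \<Rightarrow> nat \<Rightarrow> real" where
  "gaussian_field lam r \<alpha> \<xi> \<omega> =
     (if \<exists>x. limitin (H_topology lam (- r)) (field_partial_sum lam \<alpha> \<xi> \<omega>) x sequentially
      then THE x. limitin (H_topology lam (- r)) (field_partial_sum lam \<alpha> \<xi> \<omega>) x sequentially
      else (\<lambda>_. 0))"

definition gaussian_emm ::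
  "(nat \<Rightarrow> real) \<Rightarrow> real \<Rightarrow> real \<Rightarrow> 'w measure \<Rightarrow> (nat \<Rightarrow> 'w \<Rightarrow> real) \<Rightarrow> real \<Rightarrow> (nat \<Rightarrow> real) emm" where
  "gaussian_emm lam r \<alpha> P \<xi> s =
     \<lparr>topo = H_topology lam (- r),
      edist = H_ext_dist lam s,
      meas = distr P (borel_of (H_topology lam (- r))) (gaussian_field lam r \<alpha> \<xi>)\<rparr>"

end

theory Submission
  imports Defs "HOL-Real_Asymp.Real_Asymp"
begin

text \<open>
  In the coordinates \<open>\<xi> k = lam k powr (\<alpha> / 2) * y k\<close> the field is an i.i.d. standard Gaussian sequence and the
  distance of \<open>H\<^sup>s\<close> becomes the weighted \<open>\<ell>\<^sup>2\<close> distance with weights \<open>w k = lam k powr (s - \<alpha>)\<close>. If \<open>s < \<alpha>\<close> the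
  weights decrease to 0, and Gaussian concentration, in the dimension-free form given by the
  Prekopa--Leindler inequality, shows that replacing the coordinates of index at least \<open>n\<close> changes a
  1-Lipschitz function by more than \<open>e\<close> only with probability of order \<open>exp (- e\<^sup>2 / (16 * w n))\<close>. Hence all
  1-Lipschitz functions are uniformly close in probability to 1-Lipschitz functions of \<open>n\<close> coordinates.
  Modulo constants the latter are totally bounded, which gives compactness, since the space of
  Lipschitz classes is always complete. Contracting such a function towards a constant by the factor
  \<open>lam n powr (- (b - a) / 2)\<close> turns a Lipschitz function for \<open>H\<^sup>b\<close> into one for \<open>H\<^sup>a\<close>, which gives the convergence
  in \<open>d_conc\<close>. If \<open>s \<ge> \<alpha>\<close> the coordinates \<open>\<xi> k\<close> are themselves 1-Lipschitz and pairwise far apart modulo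
  constants. Finally, if \<open>s < \<alpha> - d / 2\<close> the field lies almost surely in \<open>H\<^sup>s\<close>, which is then an isomorphic
  mm-space, whereas for \<open>\<alpha> - d / 2 \<le> s\<close> its \<open>H\<^sup>s\<close> distance from any given point is almost surely infinite,
  which cannot happen for the finite metric of an mm-space.
\<close>

section \<open>The one-dimensional Gaussian Prekopa--Leindler inequality\<close>

text \<open>The obstacle is that the Lipschitz condition compares almost no points: for
  \<open>\<alpha> - d / 2 \<le> s\<close> two independent samples are almost surely at infinite
  distance, so there is no modulus of continuity on typical pairs. What helps is measurability:
  replacing a sufficiently remote tail by an independent copy barely changes any measurable
  function, in probability. Once that tail is frozen at one generic point, the function is compared
  only at points with equal tails, whose distance is finite, and McShane's extension makes it
  Lipschitz everywhere in finitely many coordinates. Their number is uncontrolled, so the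
  concentration bound has to be dimension-free in order to cut it down to a number determined by the
  weights alone. Prekopa--Leindler suits this: it tensorises by integrating out one coordinate at a
  time, and its cost \<open>(x - y)\<^sup>2 / 4\<close> is exactly the gain of the Gaussian exponent
  at a midpoint. As topology and law do not depend on \<open>s\<close>, one parameter serves both
  spaces in \<open>d_conc\<close>.\<close>

lemma antiderivative_of_density:
  fixes p :: "real \<Rightarrow> real"
  assumes cont: "continuous_on UNIV p" and pos: "\<And>x. 0 < p x" and int: "integrable lborel p"
  obtains G where "\<And>x. (G has_real_derivative p x) (at x)"
    "(G \<longlongrightarrow> 0) at_bot" "(G \<longlongrightarrow> integral\<^sup>L lborel p) at_top"
proof -
  define M where "M = density lborel (\<lambda>x. ennreal (p x))"
  have pm [measurable]: "p \<in> borel_measurable borel"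
    using cont by (rule borel_measurable_continuous_onI)
  have total: "emeasure M UNIV = ennreal (integral\<^sup>L lborel p)"
    unfolding M_def using int pos by (subst emeasure_density) (auto simp: less_imp_le nn_integral_eq_integral)
  have M [simp]: "sets M = sets borel" "space M = UNIV" by (simp_all add: M_def)
  have "finite_measure M" by (rule finite_measureI) (simp add: total)
  then interpret finite_borel_measure M
    by (simp add: finite_borel_measure_def finite_borel_measure_axioms_def)
  have meas: "measure M {a<..b} = integral {a..b} p" if "a \<le> b" for a b
  proof -
    have cs: "continuous_on {a..b} p" by (rule continuous_on_subset[OF cont]) simp
    have si: "set_integrable lborel {a..b} p"
      by (rule borel_integrable_atLeastAtMost') (rule cs)
    have "emeasure M {a<..b} = (\<integral>\<^sup>+x. ennreal (p x) * indicator {a<..b} x \<partial>lborel)"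
      unfolding M_def by (subst emeasure_density) auto
    also have "\<dots> = (\<integral>\<^sup>+x. ennreal (indicator {a..b} x * p x) \<partial>lborel)"
    proof (rule nn_integral_cong_AE)
      show "AE x in lborel. ennreal (p x) * indicator {a<..b} x = ennreal (indicator {a..b} x * p x)"
        using AE_lborel_singleton[of a] by eventually_elim (auto simp: indicator_def)
    qed
    also have "\<dots> = ennreal (LINT x:{a..b}|lborel. p x)"
      using si unfolding set_integrable_def set_lebesgue_integral_def
      by (subst nn_integral_eq_integral) (auto simp: less_imp_le pos)
    also have "(LINT x:{a..b}|lborel. p x) = integral {a..b} p"
      by (rule set_borel_integral_eq_integral(2)[OF si])
    finally show ?thesis
      by (simp add: measure_def integral_nonneg integrable_continuous_real cs less_imp_le pos)
  qed
  have deriv: "(cdf M has_real_derivative p x) (at x)" for x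
  proof -
    have cs: "continuous_on {x-1..x+1} p" by (rule continuous_on_subset[OF cont]) simp
    have "((\<lambda>y. cdf M (x-1) + integral {x-1..y} p) has_real_derivative 0 + p x) (at x within {x-1..x+1})"
      by (intro derivative_intros integral_has_real_derivative[OF cs]) auto
    then have "((\<lambda>y. cdf M (x-1) + integral {x-1..y} p) has_real_derivative p x) (at x within {x-1<..<x+1})"
      by (simp) (rule DERIV_subset, auto)
    then have "(cdf M has_real_derivative p x) (at x within {x-1<..<x+1})"
    proof (rule has_field_derivative_transform_within[where d=1])
      fix y assume "y \<in> {x-1<..<x+1}"
      then show "cdf M (x-1) + integral {x-1..y} p = cdf M y"
        using meas[of "x-1" y] cdf_diff_eq[of "x-1" y] by simp
    qed auto
    moreover have "at x within {x-1<..<x+1} = at x" by (rule at_within_open) auto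
    ultimately show ?thesis by metis
  qed
  have "measure M UNIV = integral\<^sup>L lborel p"
    using total pos by (simp add: measure_def Bochner_Integration.integral_nonneg less_imp_le)
  then have "(cdf M \<longlongrightarrow> integral\<^sup>L lborel p) at_top"
    using cdf_lim_at_top by simp
  then show ?thesis using that deriv cdf_lim_at_bot by blast
qed

text \<open>Strict positivity of \<open>p\<close> makes the normalised antiderivative
  \<open>H\<close> strictly increasing with range containing the open unit interval;
  \<open>g\<close> is its inverse, so its derivative is the reciprocal of that of
  \<open>H\<close>.\<close>

lemma quantile_function:
  fixes p :: "real \<Rightarrow> real"
  assumes cont: "continuous_on UNIV p" and pos: "\<And>x. 0 < p x" and int: "integrable lborel p"
  obtains g where "\<And>t. t \<in> {0<..<1} \<Longrightarrow> (g has_real_derivative integral\<^sup>L lborel p / p (g t)) (at t)"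
    "integral\<^sup>L lborel p > 0"
proof -
  obtain G where dG: "\<And>x. (G has_real_derivative p x) (at x)"
    and bot: "(G \<longlongrightarrow> 0) at_bot" and top: "(G \<longlongrightarrow> integral\<^sup>L lborel p) at_top"
    using antiderivative_of_density[OF assms] by blast
  define A where "A = integral\<^sup>L lborel p"
  have smono: "G x < G y" if "x < y" for x y
    using that by (rule DERIV_pos_imp_increasing) (use dG pos in blast)
  have mono: "G x \<le> G y" if "x \<le> y" for x y
    using that smono[of x y] by (cases "x = y") auto
  have G0: "0 \<le> G x" for x
    by (rule tendsto_upperbound[OF bot]) (auto intro!: mono eventually_at_bot_linorderI[of x])
  have GA: "G x \<le> A" for x
    unfolding A_def
    by (rule tendsto_lowerbound[OF top]) (auto intro!: mono eventually_at_top_linorderI[of x])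
  have A: "A > 0" using G0[of 0] smono[of 0 1] GA[of 1] by linarith
  define H where "H = (\<lambda>x. G x / A)"
  have dH: "(H has_real_derivative p x / A) (at x)" for x
    unfolding H_def using A by (auto intro!: derivative_eq_intros dG)
  have cH: "isCont H x" for x by (rule DERIV_isCont[OF dH])
  have injH: "H x = H y \<Longrightarrow> x = y" for x y
    using smono[of x y] smono[of y x] A by (simp add: H_def) (metis linorder_neqE_linordered_idom order_less_irrefl)
  have ex: "\<exists>x. H x = t" if "t \<in> {0<..<1}" for t
  proof -
    have "\<forall>\<^sub>F x in at_bot. G x < t * A"
      using that A by (intro order_tendstoD[OF bot]) auto
    then obtain a where a: "G a < t * A" by (auto simp: eventually_at_bot_linorder)
    have "\<forall>\<^sub>F x in at_top. t * A < G x"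
      using that A by (intro order_tendstoD[OF top]) (auto simp: A_def[symmetric])
    then obtain b where b: "t * A < G b" by (auto simp: eventually_at_top_linorder)
    have "a \<le> b" using a b mono[of b a] by linarith
    moreover have "H a \<le> t" "t \<le> H b" using a b A by (auto simp: H_def field_simps)
    ultimately obtain x where "H x = t"
      using IVT[of H a t b] cH by auto
    then show ?thesis by blast
  qed
  define g where "g = (\<lambda>t. SOME x. H x = t)"
  have Hg: "H (g t) = t" if "t \<in> {0<..<1}" for t
    using someI_ex[OF ex[OF that]] by (simp add: g_def)
  have gH: "g (H x) = x" for x
    unfolding g_def by (rule some_equality) (use injH in auto)
  have "(g has_real_derivative A / p (g t)) (at t)" if t: "t \<in> {0<..<1}" for t
  proof -
    have "isCont g (H (g t))"
      by (rule isCont_inverse_function2[of "g t - 1" _ "g t + 1"]) (use gH cH in auto)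
    then have "isCont g t" using Hg[OF t] by simp
    then have "(g has_real_derivative inverse (p (g t) / A)) (at t)"
      using t pos[of "g t"] A by (intro DERIV_inverse_function[where f=H and a=0 and b=1]) (auto intro: Hg dH)
    then show ?thesis by simp
  qed
  then show ?thesis using that A by (auto simp: A_def)
qed

abbreviation gauss :: "real measure" where
  "gauss \<equiv> density lborel (\<lambda>x. ennreal (std_normal_density x))"

text \<open>Parallelogram law in the exponent: \<open>x\<^sup>2 / 2 + y\<^sup>2 / 2\<close> equals
  \<open>((x + y) / 2)\<^sup>2 + (x - y)\<^sup>2 / 4\<close>. This is the origin of the constant 4
  in the cost of the inequality below.\<close>

lemma std_normal_density_midpoint:
  "exp ((x - y)\<^sup>2 / 4) * (std_normal_density x * std_normal_density y) =
   (std_normal_density ((x + y) / 2))\<^sup>2"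
proof -
  define c :: real where "c = 1 / sqrt (2 * pi)"
  have n: "std_normal_density t = c * exp (- t\<^sup>2 / 2)" for t
    by (simp add: normal_density_def c_def)
  have "exp ((x - y)\<^sup>2 / 4) * (exp (- x\<^sup>2 / 2) * exp (- y\<^sup>2 / 2)) =
      exp (- ((x + y) / 2)\<^sup>2 / 2) * exp (- ((x + y) / 2)\<^sup>2 / 2)"
    unfolding exp_add[symmetric] by (rule arg_cong[where f=exp]) (simp add: power2_eq_square field_simps)
  moreover have "a * (b1 * b2) = e * e \<Longrightarrow> a * ((c * b1) * (c * b2)) = (c * e)\<^sup>2" for a b1 b2 e :: real
    by (simp add: power2_eq_square)
  ultimately show ?thesis unfolding n by blast
qed

text \<open>The normalised densities of \<open>u\<close> and \<open>v\<close> are the images of Lebesgue measure on the unit interval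
  under their quantile functions; the proof follows the midpoint of the two quantiles.\<close>

lemma gauss_prekopa_leindler:
  fixes u v :: "real \<Rightarrow> real"
  assumes cu: "continuous_on UNIV u" and cv: "continuous_on UNIV v"
    and u: "\<And>x. 0 < u x" "\<And>x. u x \<le> B" and v: "\<And>x. 0 < v x" "\<And>x. v x \<le> B"
    and uv: "\<And>x y. u x * v y \<le> exp ((x - y)\<^sup>2 / 4)"
  shows "integral\<^sup>L gauss u * integral\<^sup>L gauss v \<le> 1"
proof -
  let ?n = "std_normal_density"
  have cn: "continuous_on UNIV ?n" unfolding normal_density_def by (intro continuous_intros) auto
  have np: "0 < ?n x" for x by (simp add: normal_density_pos)
  have im: "continuous_on UNIV f \<Longrightarrow> f \<in> borel_measurable borel" for f :: "real \<Rightarrow> real"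
    by (rule borel_measurable_continuous_onI)
  note [measurable] = im[OF cu] im[OF cv]
  have int: "integrable lborel (\<lambda>x. f x * ?n x)" if "f \<in> borel_measurable borel"
    "\<And>x. 0 < f x" "\<And>x. f x \<le> B" for f
  proof (rule Bochner_Integration.integrable_bound)
    show "integrable lborel (\<lambda>x. B * ?n x)" by auto
    show "AE x in lborel. norm (f x * ?n x) \<le> norm (B * ?n x)"
      using that np by (auto intro!: AE_I2 mult_right_mono simp: abs_mult)
         (smt (verit, best) that)
  qed (use that in measurable)
  have pc: "continuous_on UNIV (\<lambda>x. f x * ?n x)" if "continuous_on UNIV f" for f
    by (intro continuous_intros that cn)
  have pp: "0 < f x * ?n x" if "\<And>x. 0 < f x" for f x
    using that np by simp
  have pi: "integrable lborel (\<lambda>x. f x * ?n x)" if "continuous_on UNIV f"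
    "\<And>x. 0 < f x" "\<And>x. f x \<le> B" for f
    by (rule int[OF im]) (use that in auto)
  obtain g1 where g1: "\<And>t. t \<in> {0<..<1} \<Longrightarrow>
        (g1 has_real_derivative integral\<^sup>L lborel (\<lambda>x. u x * ?n x) / (u (g1 t) * ?n (g1 t))) (at t)"
      and A: "integral\<^sup>L lborel (\<lambda>x. u x * ?n x) > 0"
    using quantile_function[OF pc[OF cu] pp[of u] pi[OF cu]] u by blast
  obtain g2 where g2: "\<And>t. t \<in> {0<..<1} \<Longrightarrow>
        (g2 has_real_derivative integral\<^sup>L lborel (\<lambda>x. v x * ?n x) / (v (g2 t) * ?n (g2 t))) (at t)"
      and B: "integral\<^sup>L lborel (\<lambda>x. v x * ?n x) > 0"
    using quantile_function[OF pc[OF cv] pp[of v] pi[OF cv]] v by blast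
  obtain \<Phi> where d\<Phi>: "\<And>x. (\<Phi> has_real_derivative ?n x) (at x)"
    and bot: "(\<Phi> \<longlongrightarrow> 0) at_bot" and top: "(\<Phi> \<longlongrightarrow> integral\<^sup>L lborel ?n) at_top"
    using antiderivative_of_density[OF cn np integrable_normal_density[OF zero_less_one]] by blast
  have mono: "\<Phi> x \<le> \<Phi> y" if "x \<le> y" for x y
    using that by (rule DERIV_nonneg_imp_nondecreasing) (use d\<Phi> np in \<open>blast intro: less_imp_le\<close>)
  have \<Phi>0: "0 \<le> \<Phi> x" for x
    by (rule tendsto_upperbound[OF bot]) (auto intro!: mono eventually_at_bot_linorderI[of x])
  have \<Phi>1: "\<Phi> x \<le> 1" for x
    by (rule tendsto_lowerbound[of \<Phi> 1 at_top])
       (use top in \<open>auto intro!: mono eventually_at_top_linorderI[of x]\<close>)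
  define a b where "a = integral\<^sup>L lborel (\<lambda>x. u x * ?n x)" and "b = integral\<^sup>L lborel (\<lambda>x. v x * ?n x)"
  have ab: "a > 0" "b > 0" using A B by (auto simp: a_def b_def)
  define z where "z = (\<lambda>t. (g1 t + g2 t) / 2)"
  define D where "D = (\<lambda>t. ?n (z t) * ((a / (u (g1 t) * ?n (g1 t)) + b / (v (g2 t) * ?n (g2 t))) / 2))"
  have dz: "((\<lambda>t. \<Phi> (z t)) has_real_derivative D t) (at t)" if "t \<in> {0<..<1}" for t
  proof -
    have "(z has_real_derivative (a / (u (g1 t) * ?n (g1 t)) + b / (v (g2 t) * ?n (g2 t))) / 2) (at t)"
      unfolding z_def a_def b_def by (rule DERIV_cdivide DERIV_add g1 g2 that)+
    then show ?thesis unfolding D_def by (rule DERIV_chain2[OF d\<Phi>])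
  qed
  \<comment> \<open>The arithmetic-geometric mean inequality bounds the averaged quantile
    derivatives below by \<open>sqrt (a * b) / sqrt (P * Q)\<close>. The hypothesis
    \<open>uv\<close> and the midpoint identity bound the density at the midpoint below by
    \<open>sqrt (P * Q)\<close>, so the dependence on \<open>t\<close> cancels.\<close>
  have D: "sqrt (a * b) \<le> D t" for t
  proof -
    define x y where "x = g1 t" and "y = g2 t"
    define P Q where "P = u x * ?n x" and "Q = v y * ?n y"
    have PQ: "P > 0" "Q > 0" using u v np by (auto simp: P_def Q_def)
    have "P * Q = (u x * v y) * (?n x * ?n y)" by (simp add: P_def Q_def)
    also have "\<dots> \<le> exp ((x - y)\<^sup>2 / 4) * (?n x * ?n y)"
      by (intro mult_right_mono uv) (simp add: less_imp_le np)
    also have "\<dots> = (?n ((x + y) / 2))\<^sup>2" by (rule std_normal_density_midpoint)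
    finally have "sqrt (P * Q) \<le> ?n ((x + y) / 2)"
      by (intro real_le_lsqrt) (simp_all add: less_imp_le np)
    moreover have "sqrt (a * b) / sqrt (P * Q) \<le> (a / P + b / Q) / 2"
      using arith_geo_mean_sqrt[of "a / P" "b / Q"] ab PQ
      by (simp add: real_sqrt_divide[symmetric])
    ultimately have "sqrt (P * Q) * (sqrt (a * b) / sqrt (P * Q)) \<le> ?n ((x + y) / 2) * ((a / P + b / Q) / 2)"
      using ab PQ by (intro mult_mono) auto
    moreover have "sqrt (P * Q) * (sqrt (a * b) / sqrt (P * Q)) = sqrt (a * b)" using PQ by simp
    ultimately have "sqrt (a * b) \<le> ?n ((x + y) / 2) * ((a / P + b / Q) / 2)" by linarith
    then show ?thesis unfolding D_def z_def x_def y_def P_def Q_def .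
  qed
  \<comment> \<open>The quantiles are differentiable only inside the unit interval, so the mean
    value theorem is applied away from the endpoints. The total increase of \<open>\<Phi>\<close>,
    the normal distribution function, is at most 1.\<close>
  have step: "sqrt (a * b) * (1 - 2 * \<epsilon>) \<le> 1" if e: "\<epsilon> > 0" "\<epsilon> < 1/2" for \<epsilon>
  proof -
    have "\<exists>z'. z' > \<epsilon> \<and> z' < 1 - \<epsilon> \<and> \<Phi> (z (1 - \<epsilon>)) - \<Phi> (z \<epsilon>) = (1 - \<epsilon> - \<epsilon>) * D z'"
      by (rule MVT2) (use e in \<open>auto intro!: dz\<close>)
    then obtain z' where "\<Phi> (z (1 - \<epsilon>)) - \<Phi> (z \<epsilon>) = (1 - \<epsilon> - \<epsilon>) * D z'" by blast
    moreover have "(1 - \<epsilon> - \<epsilon>) * sqrt (a * b) \<le> (1 - \<epsilon> - \<epsilon>) * D z'"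
      using e by (intro mult_left_mono D) auto
    moreover have "\<Phi> (z (1 - \<epsilon>)) - \<Phi> (z \<epsilon>) \<le> 1"
      using \<Phi>0[of "z \<epsilon>"] \<Phi>1[of "z (1 - \<epsilon>)"] by linarith
    ultimately show ?thesis by (simp add: algebra_simps)
  qed
  have "((\<lambda>\<epsilon>. sqrt (a * b) * (1 - 2 * \<epsilon>)) \<longlongrightarrow> sqrt (a * b) * (1 - 2 * 0)) (at_right 0)"
    by (intro tendsto_intros)
  moreover have "\<forall>\<^sub>F \<epsilon> in at_right (0::real). sqrt (a * b) * (1 - 2 * \<epsilon>) \<le> 1"
    unfolding eventually_at_right_field by (intro exI[of _ "1/2"]) (auto intro!: step)
  ultimately have "sqrt (a * b) * (1 - 2 * 0) \<le> 1"
    by (intro tendsto_upperbound) auto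
  then have "a * b \<le> 1" by simp
  moreover have "integral\<^sup>L gauss u = a" "integral\<^sup>L gauss v = b"
    unfolding a_def b_def by (subst integral_density; simp add: mult.commute)+
  ultimately show ?thesis by simp
qed

section \<open>Gaussian concentration on sequences\<close>

lemma prob_space_gauss: "prob_space gauss"
  by (rule prob_space_normal_density) simp

definition GN :: "(nat \<Rightarrow> real) measure" where
  "GN = PiM UNIV (\<lambda>_. gauss)"

lemma sets_GN [simp, measurable_cong]: "sets GN = sets borel"
proof -
  have "sets GN = sets (PiM UNIV (\<lambda>_::nat. borel :: real measure))"
    unfolding GN_def by (rule sets_PiM_cong) auto
  then show ?thesis by (simp add: sets_PiM_equal_borel)
qed

lemma space_GN [simp]: "space GN = UNIV"
  by (simp add: GN_def space_PiM)

interpretation GN: prob_space GN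
  unfolding GN_def by (intro prob_space_PiM prob_space_gauss)

interpretation gauss: prob_space gauss
  by (rule prob_space_gauss)

interpretation GG: pair_prob_space GN GN ..

abbreviation GN2 :: "((nat \<Rightarrow> real) \<times> (nat \<Rightarrow> real)) measure" where
  "GN2 \<equiv> GN \<Otimes>\<^sub>M GN"

section \<open>Resampling a single coordinate\<close>

lemma GN_measurable_coord [measurable]: "(\<lambda>x. x i) \<in> borel_measurable GN"
  by measurable

lemma continuous_on_fun_upd:
  "continuous_on UNIV (\<lambda>x::nat \<Rightarrow> real. x(k := t))" "continuous_on UNIV (\<lambda>t::real. x(k := t))"
proof -
  show "continuous_on UNIV (\<lambda>x::nat \<Rightarrow> real. x(k := t))"
  proof (rule continuous_on_coordinatewise_then_product)
    fix i show "continuous_on UNIV (\<lambda>x::nat \<Rightarrow> real. (x(k := t)) i)"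
      by (cases "i = k") (auto intro: continuous_intros continuous_on_product_coordinates)
  qed
  show "continuous_on UNIV (\<lambda>t::real. x(k := t))"
  proof (rule continuous_on_coordinatewise_then_product)
    fix i show "continuous_on UNIV (\<lambda>t. (x(k := t)) i)"
      by (cases "i = k") (auto intro: continuous_intros)
  qed
qed

lemma measurable_fun_upd_pair [measurable]:
  "(\<lambda>(t, x). x(k := t)) \<in> borel_measurable (gauss \<Otimes>\<^sub>M GN)"
  unfolding case_prod_beta
proof (rule measurable_coordinatewise_then_product)
  fix i show "(\<lambda>p. ((snd p)(k := fst p)) i) \<in> borel_measurable (gauss \<Otimes>\<^sub>M GN)"
    by (cases "i = k") auto
qed

text \<open>The tool for all inductions over coordinates: one coordinate can be integrated out while
  the index set stays \<open>UNIV\<close>, with no splitting of the product space.\<close>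

lemma GN_resample: "distr (gauss \<Otimes>\<^sub>M GN) GN (\<lambda>(t, x). x(k := t)) = GN"
  using distr_pair_PiM_eq_PiM[of UNIV "\<lambda>_. gauss" k] prob_space_gauss
  by (simp add: GN_def[symmetric])

lemma nn_integral_GN_resample:
  assumes [measurable]: "f \<in> borel_measurable borel"
  shows "(\<integral>\<^sup>+x. f x \<partial>GN) = (\<integral>\<^sup>+x. \<integral>\<^sup>+t. f (x(k := t)) \<partial>gauss \<partial>GN)"
proof -
  interpret P: pair_sigma_finite gauss GN ..
  have "(\<integral>\<^sup>+x. f x \<partial>GN) = (\<integral>\<^sup>+x. f x \<partial>distr (gauss \<Otimes>\<^sub>M GN) GN (\<lambda>(t, x). x(k := t)))"
    by (simp add: GN_resample)
  also have "\<dots> = (\<integral>\<^sup>+p. f (case p of (t, x) \<Rightarrow> x(k := t)) \<partial>(gauss \<Otimes>\<^sub>M GN))"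
    by (rule nn_integral_distr) auto
  also have "\<dots> = (\<integral>\<^sup>+x. \<integral>\<^sup>+t. f (x(k := t)) \<partial>gauss \<partial>GN)"
    using P.nn_integral_snd[of "\<lambda>p. f (case p of (t, x) \<Rightarrow> x(k := t))"] by simp
  finally show ?thesis .
qed

lemma integral_GN_resample:
  fixes f :: "(nat \<Rightarrow> real) \<Rightarrow> real"
  assumes [measurable]: "f \<in> borel_measurable borel" and f: "\<And>x. \<bar>f x\<bar> \<le> B"
  shows "(\<integral>x. f x \<partial>GN) = (\<integral>x. \<integral>t. f (x(k := t)) \<partial>gauss \<partial>GN)"
proof -
  interpret P: pair_prob_space gauss GN ..
  have m: "(\<lambda>p. f (case p of (t, x) \<Rightarrow> x(k := t))) \<in> borel_measurable (gauss \<Otimes>\<^sub>M GN)" by simp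
  have "(\<integral>x. f x \<partial>GN) = (\<integral>x. f x \<partial>distr (gauss \<Otimes>\<^sub>M GN) GN (\<lambda>(t, x). x(k := t)))"
    by (simp add: GN_resample)
  also have "\<dots> = (\<integral>p. f (case p of (t, x) \<Rightarrow> x(k := t)) \<partial>(gauss \<Otimes>\<^sub>M GN))"
    by (rule integral_distr) auto
  also have "\<dots> = (\<integral>x. \<integral>t. f (x(k := t)) \<partial>gauss \<partial>GN)"
  proof -
    have "integrable (gauss \<Otimes>\<^sub>M GN) (\<lambda>p. f (case p of (t, x) \<Rightarrow> x(k := t)))"
      by (rule P.integrable_const_bound[where B=B]) (use f m in auto)
    then show ?thesis
      using P.integral_snd[of "\<lambda>t x. f (x(k := t))"] by (simp add: split_def)
  qed
  finally show ?thesis .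
qed

text \<open>Keeps partially averaged functions within the hypotheses of the Prekopa--Leindler
  induction. Continuity is checked along sequences, where dominated convergence with the constant
  bound \<open>B\<close> applies.\<close>

lemma continuous_gauss_average:
  fixes u :: "(nat \<Rightarrow> real) \<Rightarrow> real"
  assumes c: "continuous_on UNIV u" and B: "\<And>x. \<bar>u x\<bar> \<le> B"
  shows "continuous_on UNIV (\<lambda>x. \<integral>t. u (x(k := t)) \<partial>gauss)"
proof -
  have cu: "continuous_on UNIV (\<lambda>t. u (x(k := t)))" "continuous_on UNIV (\<lambda>x. u (x(k := t)))" for x t
    by (rule continuous_on_compose2[OF c], rule continuous_on_fun_upd, simp)+
  have [measurable]: "(\<lambda>t. u (x(k := t))) \<in> borel_measurable borel" for x
    by (rule borel_measurable_continuous_onI[OF cu(1)])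
  have "((\<lambda>x. \<integral>t. u (x(k := t)) \<partial>gauss) \<longlongrightarrow> (\<integral>t. u (x(k := t)) \<partial>gauss)) (at x)" for x
  unfolding tendsto_at_iff_sequentially
    proof (intro allI impI)
      fix X assume X: "X \<longlonglongrightarrow> x"
      have "(\<lambda>n. \<integral>t. u ((X n)(k := t)) \<partial>gauss) \<longlonglongrightarrow> (\<integral>t. u (x(k := t)) \<partial>gauss)"
      proof (rule integral_dominated_convergence[where w="\<lambda>_. B"])
        show "AE t in gauss. (\<lambda>i. u ((X i)(k := t))) \<longlonglongrightarrow> u (x(k := t))"
          using X cu(2) by (auto intro!: AE_I2 isCont_tendsto_compose[of x "\<lambda>x. u (x(k := t))" for t] simp: continuous_on_eq_continuous_at)
      qed (use B in auto)
      then show "((\<lambda>x. \<integral>t. u (x(k := t)) \<partial>gauss) \<circ> X) \<longlonglongrightarrow> (\<integral>t. u (x(k := t)) \<partial>gauss)"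
        by (simp add: o_def)
    qed
  then show ?thesis by (simp add: continuous_on_def)
qed

lemma gauss_integral_bounds:
  assumes [measurable]: "f \<in> borel_measurable borel" and f: "\<And>t. 0 < f t" "\<And>t. f t \<le> B"
  shows "0 < (\<integral>t. f t \<partial>gauss)" "(\<integral>t. f t \<partial>gauss) \<le> (B::real)"
proof -
  have int: "integrable gauss f"
    by (rule gauss.integrable_const_bound[where B=B]) (use f in \<open>auto simp: abs_of_pos\<close>)
  show "0 < (\<integral>t. f t \<partial>gauss)"
  proof (rule ccontr)
    assume "\<not> ?thesis"
    moreover have "0 \<le> (\<integral>t. f t \<partial>gauss)" by (simp add: less_imp_le f)
    ultimately have "(\<integral>t. f t \<partial>gauss) = 0" by simp
    then have "AE t in gauss. f t = 0"
      using int f by (subst (asm) integral_nonneg_eq_0_iff_AE) (auto simp: less_imp_le)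
    then have "AE t in gauss. False"
      by eventually_elim (use f(1) in \<open>metis less_irrefl\<close>)
    then show False by simp
  qed
  have "(\<integral>t. f t \<partial>gauss) \<le> (\<integral>t. B \<partial>gauss)"
    by (rule integral_mono[OF int]) (use f in auto)
  also have "(\<integral>t. B \<partial>gauss) = B" using gauss.prob_space by simp
  finally show "(\<integral>t. f t \<partial>gauss) \<le> B" .
qed

text \<open>The inequality tensorises by integrating out one coordinate at a time; only the coordinates in
  \<open>K\<close> enter the transport cost.\<close>

lemma GN_prekopa_leindler:
  fixes u v :: "(nat \<Rightarrow> real) \<Rightarrow> real"
  assumes "finite K"
    and "continuous_on UNIV u" "continuous_on UNIV v"
    and "\<And>x. 0 < u x" "\<And>x. u x \<le> B" "\<And>x. 0 < v x" "\<And>x. v x \<le> B"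
    and "\<And>x y. u x * v y \<le> exp (\<Sum>k\<in>K. (x k - y k)\<^sup>2 / 4)"
  shows "(\<integral>x. u x \<partial>GN) * (\<integral>x. v x \<partial>GN) \<le> 1"
  using assms
proof (induction K arbitrary: u v)
  case empty
  have "u x * v y \<le> 1" for x y using empty(7)[of x y] by simp
  have um [measurable]: "u \<in> borel_measurable borel" "v \<in> borel_measurable borel"
    using empty by (auto intro: borel_measurable_continuous_onI)
  have iu: "integrable GN u" "integrable GN v"
    by (rule GN.integrable_const_bound[where B=B]; use empty in \<open>auto simp: abs_of_pos\<close>)+
  have "(\<integral>x. u x \<partial>GN) * v y \<le> 1" for y
  proof -
    have "(\<integral>x. u x * v y \<partial>GN) \<le> (\<integral>x. 1 \<partial>GN)"
      by (rule integral_mono) (use iu \<open>\<And>x y. u x * v y \<le> 1\<close> in auto)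
    then show ?thesis using iu GN.prob_space by simp
  qed
  then have "(\<integral>y. (\<integral>x. u x \<partial>GN) * v y \<partial>GN) \<le> (\<integral>x. 1 \<partial>GN)"
    by (intro integral_mono) (use iu in auto)
  then show ?case using iu GN.prob_space by simp
next
  case (insert k K)
  have um [measurable]: "u \<in> borel_measurable borel" "v \<in> borel_measurable borel"
    using insert.prems by (auto intro: borel_measurable_continuous_onI)
  define u' where "u' = (\<lambda>x. \<integral>t. u (x(k := t)) \<partial>gauss)"
  define v' where "v' = (\<lambda>x. \<integral>t. v (x(k := t)) \<partial>gauss)"
  have abs: "\<bar>u x\<bar> \<le> B" "\<bar>v x\<bar> \<le> B" for x
    using insert.prems(3-6)[of x] by auto
  have cc: "continuous_on UNIV (\<lambda>t. u (x(k := t)))" "continuous_on UNIV (\<lambda>t. v (x(k := t)))" for x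
    by (rule continuous_on_compose2[OF insert.prems(1)] continuous_on_compose2[OF insert.prems(2)],
        rule continuous_on_fun_upd, simp)+
  note mm = borel_measurable_continuous_onI[OF cc(1)] borel_measurable_continuous_onI[OF cc(2)]
  have "(\<integral>x. u' x \<partial>GN) * (\<integral>x. v' x \<partial>GN) \<le> 1"
  proof (rule insert.IH)
    show "continuous_on UNIV u'" "continuous_on UNIV v'"
      unfolding u'_def v'_def using insert.prems abs by (auto intro!: continuous_gauss_average)
    show "0 < u' x" "u' x \<le> B" "0 < v' x" "v' x \<le> B" for x
      unfolding u'_def v'_def using insert.prems by (auto intro!: gauss_integral_bounds mm)
    fix x y :: "nat \<Rightarrow> real"
    \<comment> \<open>The cost of the coordinates in \<open>K\<close> is fixed along the slices in
      coordinate \<open>k\<close>. Multiplying one of the two functions by \<open>exp (- c)\<close>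
      absorbs it, so that the one-dimensional inequality applies to the slices.\<close>
    define c where "c = (\<Sum>i\<in>K. (x i - y i)\<^sup>2 / 4)"
    have c0: "0 \<le> c" unfolding c_def by (intro sum_nonneg) auto
    have "(\<integral>t. exp (- c) * u (x(k := t)) \<partial>gauss) * (\<integral>t. v (y(k := t)) \<partial>gauss) \<le> 1"
    proof (rule gauss_prekopa_leindler[where B=B])
      show "exp (- c) * u (x(k := s)) * v (y(k := t)) \<le> exp ((s - t)\<^sup>2 / 4)" for s t
      proof -
        have "(\<Sum>i\<in>insert k K. ((x(k := s)) i - (y(k := t)) i)\<^sup>2 / 4) = (s - t)\<^sup>2 / 4 + c"
          unfolding c_def using insert.hyps by (simp, intro sum.cong) auto
        then have "u (x(k := s)) * v (y(k := t)) \<le> exp ((s - t)\<^sup>2 / 4 + c)"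
          using insert.prems(7)[of "x(k := s)" "y(k := t)"] by (simp only:)
        then have "exp (- c) * (u (x(k := s)) * v (y(k := t))) \<le> exp (- c) * exp ((s - t)\<^sup>2 / 4 + c)"
          by (intro mult_left_mono) auto
        then show ?thesis by (simp add: exp_add[symmetric] mult.assoc)
      qed
      show "exp (- c) * u (x(k := s)) \<le> B" for s
        using mult_mono[of "exp (- c)" 1 "u (x(k := s))" B] c0 insert.prems(3-6)[of "x(k := s)"] by simp
    qed (use insert.prems cc in \<open>auto intro!: continuous_intros\<close>)
    then have "exp (- c) * (u' x * v' y) \<le> 1" by (simp add: u'_def v'_def mult.assoc)
    then have "exp c * (exp (- c) * (u' x * v' y)) \<le> exp c * 1" by (intro mult_left_mono) auto
    then have "u' x * v' y \<le> exp c" by (simp add: mult.assoc[symmetric] exp_minus_inverse)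
    then show "u' x * v' y \<le> exp (\<Sum>k\<in>K. (x k - y k)\<^sup>2 / 4)" unfolding c_def .
  qed
  then show ?case
    unfolding u'_def v'_def using integral_GN_resample[OF um(1) abs(1)] integral_GN_resample[OF um(2) abs(2)] by simp
qed

text \<open>Maurey's argument: the Lipschitz bound and \<open>2ab \<le> a\<^sup>2 + b\<^sup>2\<close> make \<open>u = exp (t h - t\<^sup>2 L)\<close> and
  \<open>v = exp (- t h)\<close> admissible in the Prekopa--Leindler inequality.\<close>

lemma GN_concentration_upper:
  fixes h :: "(nat \<Rightarrow> real) \<Rightarrow> real"
  assumes K: "finite K" and c: "continuous_on UNIV h" and b: "\<And>x. \<bar>h x\<bar> \<le> M"
    and lip: "\<And>x y. \<bar>h x - h y\<bar> \<le> sqrt (L * (\<Sum>k\<in>K. (x k - y k)\<^sup>2))" and L: "L > 0" and e: "\<epsilon> > 0"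
  shows "measure GN2 {p \<in> space GN2. h (fst p) - h (snd p) \<ge> \<epsilon>} \<le> exp (- (\<epsilon>\<^sup>2 / (4 * L)))"
proof -
  \<comment> \<open>This value minimises the exponent \<open>t\<^sup>2 * L - t * \<epsilon>\<close>,
    with minimum \<open>- \<epsilon>\<^sup>2 / (4 * L)\<close>.\<close>
  define t where "t = \<epsilon> / (2 * L)"
  have t: "t > 0" using e L by (simp add: t_def)
  have hm [measurable]: "h \<in> borel_measurable borel"
    using c by (rule borel_measurable_continuous_onI)
  have bd: "\<bar>t * h x\<bar> \<le> t * M" for x using b[of x] t by (simp add: abs_mult)
  have PL: "(\<integral>x. exp (t * h x - t\<^sup>2 * L) \<partial>GN) * (\<integral>x. exp (- (t * h x)) \<partial>GN) \<le> 1"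
  proof (rule GN_prekopa_leindler[OF K, where B="exp (t * M)"])
    show "exp (t * h x - t\<^sup>2 * L) \<le> exp (t * M)" "exp (- (t * h x)) \<le> exp (t * M)" for x
      using bd[of x] L by (auto simp: abs_le_iff intro: order_trans[of _ "t * h x"])
    fix x y :: "nat \<Rightarrow> real"
    define S where "S = (\<Sum>k\<in>K. (x k - y k)\<^sup>2)"
    have S: "S \<ge> 0" unfolding S_def by (intro sum_nonneg) auto
    have "t * (h x - h y) \<le> t * sqrt (L * S)"
      using lip[of x y] t by (intro mult_left_mono) (auto simp: S_def)
    also have "\<dots> = 2 * (t * sqrt L) * (sqrt S / 2)" using L S by (simp add: real_sqrt_mult)
    also have "\<dots> \<le> (t * sqrt L)\<^sup>2 + (sqrt S / 2)\<^sup>2"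
      using sum_squares_bound[of "t * sqrt L" "sqrt S / 2"] by simp
    also have "\<dots> = t\<^sup>2 * L + S / 4" using L S by (simp add: power_mult_distrib power_divide)
    finally have "t * h x - t\<^sup>2 * L + - (t * h y) \<le> S / 4" by (simp add: algebra_simps)
    then show "exp (t * h x - t\<^sup>2 * L) * exp (- (t * h y)) \<le> exp (\<Sum>k\<in>K. (x k - y k)\<^sup>2 / 4)"
      by (simp add: exp_add[symmetric] S_def sum_divide_distrib[symmetric])
  qed (intro continuous_intros c | simp)+
  have i1: "integrable GN (\<lambda>x. exp (t * h x))" "integrable GN (\<lambda>x. exp (- (t * h x)))"
    by (rule GN.integrable_const_bound[where B="exp (t * M)"]; use bd in \<open>auto simp: abs_le_iff\<close>)+
  \<comment> \<open>\<open>q\<close> is the exponential of \<open>t\<close> times the difference of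
    two independent copies. Its expectation factorises into exactly the product controlled by
    \<open>PL\<close>, up to \<open>exp (t\<^sup>2 * L)\<close>; comparing two copies avoids
    centring at a mean or a median.\<close>
  define q where "q = (\<lambda>p. exp (t * h (fst p)) * exp (- (t * h (snd p))))"
  have qm [measurable]: "q \<in> borel_measurable GN2" unfolding q_def by measurable
  have "(\<integral>\<^sup>+p. ennreal (q p) \<partial>GN2) = (\<integral>\<^sup>+x. \<integral>\<^sup>+y. ennreal (q (x, y)) \<partial>GN \<partial>GN)"
    by (rule GN.nn_integral_fst[symmetric]) simp
  also have "\<dots> = (\<integral>\<^sup>+x. ennreal (exp (t * h x)) * ennreal (\<integral>y. exp (- (t * h y)) \<partial>GN) \<partial>GN)"
    unfolding q_def fst_conv snd_conv
    by (simp add: ennreal_mult nn_integral_cmult nn_integral_eq_integral i1)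
  also have "\<dots> = ennreal ((\<integral>x. exp (t * h x) \<partial>GN) * (\<integral>y. exp (- (t * h y)) \<partial>GN))"
    by (simp add: nn_integral_multc nn_integral_eq_integral i1 ennreal_mult)
  also have "\<dots> \<le> ennreal (exp (t\<^sup>2 * L))"
  proof (rule ennreal_leI)
    have "exp (- (t\<^sup>2 * L)) * ((\<integral>x. exp (t * h x) \<partial>GN) * (\<integral>y. exp (- (t * h y)) \<partial>GN)) \<le> 1"
      using PL by (simp add: exp_diff exp_minus field_simps)
    then have "exp (t\<^sup>2 * L) * (exp (- (t\<^sup>2 * L)) * ((\<integral>x. exp (t * h x) \<partial>GN) * (\<integral>y. exp (- (t * h y)) \<partial>GN))) \<le> exp (t\<^sup>2 * L) * 1"
      by (intro mult_left_mono) auto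
    then show "(\<integral>x. exp (t * h x) \<partial>GN) * (\<integral>y. exp (- (t * h y)) \<partial>GN) \<le> exp (t\<^sup>2 * L)"
      by (simp add: mult.assoc[symmetric] exp_minus_inverse)
  qed
  finally have I: "(\<integral>\<^sup>+p. ennreal (q p) \<partial>GN2) \<le> ennreal (exp (t\<^sup>2 * L))" .
  have "emeasure GN2 {p \<in> space GN2. h (fst p) - h (snd p) \<ge> \<epsilon>}
      \<le> emeasure GN2 {p \<in> space GN2. 1 \<le> ennreal (exp (- (t * \<epsilon>))) * ennreal (q p)}"
  proof (rule emeasure_mono)
    show "{p \<in> space GN2. h (fst p) - h (snd p) \<ge> \<epsilon>} \<subseteq>
      {p \<in> space GN2. 1 \<le> ennreal (exp (- (t * \<epsilon>))) * ennreal (q p)}"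
    proof safe
      fix x y assume "h (fst (x, y)) - h (snd (x, y)) \<ge> \<epsilon>"
      then have "t * \<epsilon> \<le> t * (h x - h y)" using t by simp
      then have "0 \<le> - (t * \<epsilon>) + t * h x - t * h y" by (simp add: algebra_simps)
      then show "1 \<le> ennreal (exp (- (t * \<epsilon>))) * ennreal (q (x, y))"
        unfolding q_def by (simp add: ennreal_mult[symmetric] exp_add[symmetric])
    qed
  qed measurable
  also have "\<dots> \<le> ennreal (exp (- (t * \<epsilon>))) * (\<integral>\<^sup>+p. ennreal (q p) * indicator (space GN2) p \<partial>GN2)"
    by (rule nn_integral_Markov_inequality)
       (intro borel_measurable_times_ennreal borel_measurable_indicator sets.top; measurable)+
  also have "\<dots> \<le> ennreal (exp (- (t * \<epsilon>))) * ennreal (exp (t\<^sup>2 * L))"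
    using I by (intro mult_left_mono) (auto cong: nn_integral_cong simp: indicator_def)
  also have "\<dots> = ennreal (exp (- (\<epsilon>\<^sup>2 / (4 * L))))"
    using L by (simp add: ennreal_mult[symmetric] exp_add[symmetric] t_def power2_eq_square field_simps)
  finally show ?thesis by (simp add: GG.P.emeasure_eq_measure)
qed

section \<open>Approximation by finitely many coordinates\<close>

definition wdn :: "(nat \<Rightarrow> real) \<Rightarrow> nat \<Rightarrow> (nat \<Rightarrow> real) \<Rightarrow> (nat \<Rightarrow> real) \<Rightarrow> real" where
  "wdn v m x y = sqrt (\<Sum>k<m. v k * (x k - y k)\<^sup>2)"

text \<open>The weighted distance as a supremum of truncations: it is \<infinity> exactly when the
  series diverges, and measurability and lower semicontinuity follow from those of the finite
  sums.\<close>

definition wd :: "(nat \<Rightarrow> real) \<Rightarrow> (nat \<Rightarrow> real) \<Rightarrow> (nat \<Rightarrow> real) \<Rightarrow> ennreal" where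
  "wd v x y = (SUP m. ennreal (wdn v m x y))"

text \<open>One operation for three purposes: with random \<open>y\<close> it resamples the tail of
  \<open>x\<close>, with fixed \<open>y\<close> it freezes the tail, and with \<open>y = 0\<close>
  it truncates.\<close>

definition mix :: "nat \<Rightarrow> (nat \<Rightarrow> real) \<Rightarrow> (nat \<Rightarrow> real) \<Rightarrow> nat \<Rightarrow> real" where
  "mix n x y = (\<lambda>k. if k < n then x k else y k)"

lemma measurable_mix [measurable (raw)]:
  assumes [measurable]: "f \<in> borel_measurable M" "g \<in> borel_measurable M"
  shows "(\<lambda>p. mix n (f p) (g p)) \<in> borel_measurable M"
proof (rule measurable_coordinatewise_then_product)
  fix i
  have [measurable]: "(\<lambda>p. f p i) \<in> borel_measurable M" "(\<lambda>p. g p i) \<in> borel_measurable M"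
    by (rule measurable_product_then_coordinatewise, simp)+
  show "(\<lambda>p. mix n (f p) (g p) i) \<in> borel_measurable M"
    by (cases "i < n") (auto simp: mix_def)
qed

lemma continuous_on_mix: "continuous_on UNIV (\<lambda>x. mix n a x)"
proof (rule continuous_on_coordinatewise_then_product)
  fix i show "continuous_on UNIV (\<lambda>x. mix n a x i)"
    by (cases "i < n") (auto simp: mix_def intro: continuous_intros continuous_on_product_coordinates)
qed

section \<open>Resampling a tail of coordinates\<close>

lemma GN_measurable_borel [simp]: "f \<in> measurable GN N \<longleftrightarrow> f \<in> measurable borel N"
  by (rule arg_cong2[where f="(\<in>)"]) (auto intro!: measurable_cong_sets)

lemma emeasure_GN_Collect:
  assumes "finite J" "\<And>i. i \<in> J \<Longrightarrow> F i \<in> sets borel"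
  shows "emeasure GN {x. \<forall>i\<in>J. x i \<in> F i} = (\<Prod>i\<in>J. emeasure gauss (F i))"
proof -
  interpret product_prob_space "\<lambda>_::nat. gauss" UNIV
    by (simp add: product_prob_space_def product_prob_space_axioms_def product_sigma_finite_def
        prob_space_gauss gauss.sigma_finite_measure_axioms)
  show ?thesis
    using emeasure_PiM_Collect[of J F] assms by (simp add: GN_def[symmetric])
qed

lemma GN_eqI:
  assumes s: "sets M = sets borel"
    and eq: "\<And>J F. finite J \<Longrightarrow> (\<And>i. i \<in> J \<Longrightarrow> F i \<in> sets (borel :: real measure)) \<Longrightarrow>
      emeasure M {x. \<forall>i\<in>J. x i \<in> F i} = (\<Prod>i\<in>J. emeasure gauss (F i))"
  shows "M = GN"
proof -
  interpret product_prob_space "\<lambda>_::nat. gauss" UNIV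
    by (simp add: product_prob_space_def product_prob_space_axioms_def product_sigma_finite_def
        prob_space_gauss gauss.sigma_finite_measure_axioms)
  have emb: "prod_emb UNIV (\<lambda>_. gauss) J (Pi\<^sub>E J F) = {x. \<forall>i\<in>J. x i \<in> F i}" for J and F :: "nat \<Rightarrow> real set"
    by (auto simp: prod_emb_def PiE_iff)
  show ?thesis
    unfolding GN_def
  proof (rule PiM_eq)
    show "sets M = sets (Pi\<^sub>M UNIV (\<lambda>_. gauss))"
      using s sets_GN unfolding GN_def by simp
  qed (use eq in \<open>auto simp: emb\<close>)
qed

text \<open>On a cylinder set the constraints with index below \<open>n\<close> concern only the
  first copy and the remaining ones only the second, so the probability factorises as it does under
  \<open>GN\<close>.\<close>

lemma distr_mix: "distr GN2 GN (\<lambda>(x, y). mix n x y) = GN"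
proof (rule GN_eqI)
  fix J and F :: "nat \<Rightarrow> real set"
  assume J: "finite J" and F: "\<And>i. i \<in> J \<Longrightarrow> F i \<in> sets borel"
  let ?A = "\<lambda>J. {x :: nat \<Rightarrow> real. \<forall>i\<in>J. x i \<in> F i}"
  have A: "?A I \<in> sets borel" if "I \<subseteq> J" for I
  proof -
    have "finite I" using J that by (rule finite_subset[rotated])
    have "?A I = {x \<in> space borel. \<forall>i\<in>I. x i \<in> F i}" by simp
    also have "\<dots> \<in> sets borel"
    proof (rule sets.sets_Collect_finite_All[OF _ \<open>finite I\<close>])
      fix i assume "i \<in> I"
      then have [measurable]: "F i \<in> sets borel" using F that by blast
      show "{x \<in> space borel. x i \<in> F i} \<in> sets (borel :: (nat \<Rightarrow> real) measure)" by measurable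
    qed
    finally show ?thesis .
  qed
  have "emeasure (distr GN2 GN (\<lambda>(x, y). mix n x y)) (?A J) =
      emeasure GN2 (?A {i\<in>J. i < n} \<times> ?A {i\<in>J. \<not> i < n})"
  proof (subst emeasure_distr)
    show "emeasure GN2 ((\<lambda>(x, y). mix n x y) -` ?A J \<inter> space GN2) =
        emeasure GN2 (?A {i\<in>J. i < n} \<times> ?A {i\<in>J. \<not> i < n})"
      by (rule arg_cong2[where f=emeasure]) (auto simp: mix_def space_pair_measure)
    show "(\<lambda>(x, y). mix n x y) \<in> measurable GN2 GN" by measurable
    show "?A J \<in> sets GN" using A[of J] by simp
  qed
  also have "\<dots> = emeasure GN (?A {i\<in>J. i < n}) * emeasure GN (?A {i\<in>J. \<not> i < n})"
  proof (rule GN.emeasure_pair_measure_Times)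
    show "?A {i\<in>J. i < n} \<in> sets GN" unfolding sets_GN by (rule A) blast
    show "?A {i\<in>J. \<not> i < n} \<in> sets GN" unfolding sets_GN by (rule A) blast
  qed
  also have "\<dots> = (\<Prod>i\<in>{i\<in>J. i < n}. emeasure gauss (F i)) * (\<Prod>i\<in>{i\<in>J. \<not> i < n}. emeasure gauss (F i))"
    using J F by (intro arg_cong2[where f="(*)"] emeasure_GN_Collect) auto
  also have "\<dots> = (\<Prod>i\<in>J. emeasure gauss (F i))"
    using J by (subst prod.union_disjoint[symmetric]) (auto intro!: prod.cong)
  finally show "emeasure (distr GN2 GN (\<lambda>(x, y). mix n x y)) (?A J) = (\<Prod>i\<in>J. emeasure gauss (F i))" .
qed simp

lemma measure_mix:
  assumes "{x. P x} \<in> sets borel"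
  shows "measure GN2 {p \<in> space GN2. P (mix n (fst p) (snd p))} = measure GN {x. P x}"
proof -
  have [measurable]: "Measurable.pred borel P" using assms by (simp add: pred_def)
  have "measure GN {x. P x} = measure (distr GN2 GN (\<lambda>(x, y). mix n x y)) {x. P x}"
    by (simp add: distr_mix)
  also have "\<dots> = measure GN2 ((\<lambda>(x, y). mix n x y) -` {x. P x} \<inter> space GN2)"
    using assms by (intro measure_distr) auto
  also have "(\<lambda>(x, y). mix n x y) -` {x. P x} \<inter> space GN2 = {p \<in> space GN2. P (mix n (fst p) (snd p))}"
    by auto
  finally show ?thesis by simp
qed

lemma measure_fst:
  assumes "{x. P x} \<in> sets borel"
  shows "measure GN2 {p \<in> space GN2. P (fst p)} = measure GN {x. P x}"
proof -
  have "measure GN {x. P x} = measure (distr GN2 GN fst) {x. P x}"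
    by (simp add: GN.distr_pair_fst GN.prob_space_axioms)
  also have "\<dots> = measure GN2 (fst -` {x. P x} \<inter> space GN2)"
    using assms by (intro measure_distr) auto
  also have "fst -` {x. P x} \<inter> space GN2 = {p \<in> space GN2. P (fst p)}"
    by auto
  finally show ?thesis by simp
qed

text \<open>If almost all sections had measure at least \<open>c\<close>, so would \<open>A\<close>,
  by Fubini. The property \<open>Q\<close> allows the chosen section to satisfy a further almost
  sure requirement; the lemma is how generic frozen tails are selected.\<close>

lemma prob_space_exists_section:
  assumes "prob_space M" "prob_space N" and A: "A \<in> sets (M \<Otimes>\<^sub>M N)"
    and c: "measure (M \<Otimes>\<^sub>M N) A < c" and Q: "AE y in N. Q y"
  shows "\<exists>y\<in>space N. Q y \<and> measure M {x \<in> space M. (x, y) \<in> A} < c"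
proof (rule ccontr)
  assume neg: "\<not> ?thesis"
  interpret M: prob_space M by fact
  interpret N: prob_space N by fact
  interpret P: pair_prob_space M N ..
  have sec: "(\<lambda>x. (x, y)) -` A = {x \<in> space M. (x, y) \<in> A}" for y
    using sets.sets_into_space[OF A] by (auto simp: space_pair_measure)
  have "AE y in N. ennreal c \<le> emeasure M {x \<in> space M. (x, y) \<in> A}"
    using Q AE_space by eventually_elim (use neg in \<open>auto simp: M.emeasure_eq_measure intro!: ennreal_leI\<close>)
  then have "(\<integral>\<^sup>+y. ennreal c \<partial>N) \<le> (\<integral>\<^sup>+y. emeasure M {x \<in> space M. (x, y) \<in> A} \<partial>N)"
    by (rule nn_integral_mono_AE)
  also have "\<dots> = emeasure (M \<Otimes>\<^sub>M N) A"
    using P.emeasure_pair_measure_alt2[OF A] by (simp add: sec)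
  finally have "ennreal c \<le> emeasure (M \<Otimes>\<^sub>M N) A" by (simp add: N.emeasure_space_1)
  then show False using c by (simp add: P.P.emeasure_eq_measure)
qed

text \<open>Induction over the generated sigma-algebra. An event about coordinate \<open>i\<close>
  is undisturbed once \<open>m > i\<close>. A countable union is replaced by a finite one; the
  remainder \<open>b k\<close> has small probability before the resampling, and the same one after
  it because the law is invariant.\<close>

lemma mix_set_approx:
  assumes "A \<in> sets (borel :: (nat \<Rightarrow> real) measure)"
  shows "(\<lambda>m. measure GN2 {p \<in> space GN2. (fst p \<in> A) \<noteq> (mix m (fst p) (snd p) \<in> A)}) \<longlonglongrightarrow> 0"
proof -
  let ?D = "\<lambda>m A. {p \<in> space GN2. (fst p \<in> A) \<noteq> (mix m (fst p) (snd p) \<in> A)}"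
  let ?\<mu> = "measure GN2"
  have Dm: "?D m A \<in> sets GN2" if [measurable]: "A \<in> sets borel" for A m
    by measurable
  have gen: "sets (borel :: (nat \<Rightarrow> real) measure) = sigma_sets UNIV {{f. f i \<in> A} |i A. A \<in> sets (borel :: real measure)}"
    using sets_PiM_single[of UNIV "\<lambda>_::nat. borel :: real measure"] by (simp add: sets_PiM_equal_borel)
  show ?thesis
    using assms[unfolded gen]
  proof (induction rule: sigma_sets.induct)
    case (Basic a)
    then obtain i B where a: "a = {f. f i \<in> B}" by auto
    have "\<forall>\<^sub>F m in sequentially. ?\<mu> (?D m a) = 0"
      using eventually_gt_at_top[of i] by eventually_elim (auto simp: a mix_def)
    then show ?case by (rule tendsto_eventually)
  next
    case Empty
    show ?case by simp
  next
    case (Compl a)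
    have "?D m (UNIV - a) = ?D m a" for m by auto
    then show ?case using Compl by simp
  next
    case (Union a)
    have am: "a i \<in> sets borel" for i using Union(1) by (simp add: gen)
    define b where "b = (\<lambda>k. (\<Union>i. a i) - (\<Union>i<k. a i))"
    have bm: "b k \<in> sets borel" for k unfolding b_def using am by auto
    have "(\<lambda>k. measure GN (b k)) \<longlonglongrightarrow> measure GN (\<Inter>k. b k)"
    proof (rule GN.finite_Lim_measure_decseq)
      show "decseq b" unfolding b_def decseq_def by force
    qed (use bm in auto)
    moreover have "(\<Inter>k. b k) = {}" unfolding b_def by auto
    ultimately have b0: "(\<lambda>k. measure GN (b k)) \<longlonglongrightarrow> 0" by simp
    show ?case
    proof (rule LIMSEQ_I)
      fix r :: real assume r: "0 < r"
      obtain k where k: "measure GN (b k) < r / 3"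
        using order_tendstoD(2)[OF b0, of "r/3"] r by (auto simp: eventually_sequentially)
      have "(\<lambda>m. \<Sum>i<k. ?\<mu> (?D m (a i))) \<longlonglongrightarrow> (\<Sum>i<k. 0)"
        by (intro tendsto_sum Union.IH)
      then have "\<forall>\<^sub>F m in sequentially. (\<Sum>i<k. ?\<mu> (?D m (a i))) < r / 3"
        using r by (intro order_tendstoD(2)) auto
      then obtain N where N: "\<And>m. m \<ge> N \<Longrightarrow> (\<Sum>i<k. ?\<mu> (?D m (a i))) < r / 3"
        by (auto simp: eventually_sequentially)
      have "?\<mu> (?D m (\<Union>i. a i)) < r" if m: "m \<ge> N" for m
      proof -
        have bm': "{p \<in> space GN2. fst p \<in> b k} \<in> sets GN2"
          "{p \<in> space GN2. mix m (fst p) (snd p) \<in> b k} \<in> sets GN2"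
          using bm[of k] by measurable
        have "?\<mu> (?D m (\<Union>i. a i)) \<le> ?\<mu> (({p \<in> space GN2. fst p \<in> b k} \<union>
            {p \<in> space GN2. mix m (fst p) (snd p) \<in> b k}) \<union> (\<Union>i<k. ?D m (a i)))"
          by (rule GG.P.finite_measure_mono) (use bm' Dm am in \<open>auto simp: b_def\<close>)
        also have "\<dots> \<le> ?\<mu> {p \<in> space GN2. fst p \<in> b k} +
            ?\<mu> {p \<in> space GN2. mix m (fst p) (snd p) \<in> b k} + (\<Sum>i<k. ?\<mu> (?D m (a i)))"
        proof -
          have Z: "?\<mu> (\<Union>i<k. ?D m (a i)) \<le> (\<Sum>i<k. ?\<mu> (?D m (a i)))"
            by (rule measure_UNION_le) (use Dm am in auto)
          have "(\<Union>i<k. ?D m (a i)) \<in> sets GN2"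
            using Dm am by blast
          then show ?thesis
            using Z bm' measure_Un_le[OF bm'] measure_Un_le[OF sets.Un[OF bm'], of "\<Union>i<k. ?D m (a i)"] by linarith
        qed
        also have "?\<mu> {p \<in> space GN2. fst p \<in> b k} = measure GN (b k)"
          using measure_fst[of "\<lambda>x. x \<in> b k"] bm by simp
        also have "?\<mu> {p \<in> space GN2. mix m (fst p) (snd p) \<in> b k} = measure GN (b k)"
          using measure_mix[of "\<lambda>x. x \<in> b k"] bm by simp
        finally show ?thesis using k N[OF m] by linarith
      qed
      then show "\<exists>N. \<forall>m\<ge>N. norm (?\<mu> (?D m (\<Union>i. a i)) - 0) < r" by (intro exI[of _ N]) auto
    qed
  qed
qed

lemma measurable_tail_tendsto_0:
  fixes f :: "'a \<Rightarrow> real"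
  assumes "prob_space M" and [measurable]: "f \<in> borel_measurable M"
  shows "(\<lambda>n. measure M {x \<in> space M. \<bar>f x\<bar> > real n}) \<longlonglongrightarrow> 0"
proof -
  interpret prob_space M by fact
  have "(\<lambda>n. measure M {x \<in> space M. \<bar>f x\<bar> > real n}) \<longlonglongrightarrow> measure M (\<Inter>n. {x \<in> space M. \<bar>f x\<bar> > real n})"
  proof (rule finite_Lim_measure_decseq)
    show "decseq (\<lambda>n. {x \<in> space M. \<bar>f x\<bar> > real n})"
      unfolding decseq_def by force
  qed auto
  moreover have "(\<Inter>n. {x \<in> space M. \<bar>f x\<bar> > real n}) = {}"
    using reals_Archimedean2 by (auto, metis less_le_not_le nle_le)
  ultimately show ?thesis by simp
qed

text \<open>The level sets of \<open>\<lfloor>f / \<delta>\<rfloor>\<close> reduce this to \<open>mix_set_approx\<close>.\<close>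

lemma mix_fun_approx:
  fixes f :: "(nat \<Rightarrow> real) \<Rightarrow> real"
  assumes f [measurable]: "f \<in> borel_measurable borel" and d: "\<delta> > 0"
  shows "\<forall>\<^sub>F m in sequentially.
    measure GN2 {p \<in> space GN2. \<bar>f (fst p) - f (mix m (fst p) (snd p))\<bar> > \<delta>} < \<delta>"
proof -
  define F where "F = (\<lambda>x. \<lfloor>f x / \<delta>\<rfloor>)"
  have Fm [measurable]: "F \<in> measurable borel (count_space UNIV)" unfolding F_def by measurable
  let ?D = "\<lambda>m A. {p \<in> space GN2. (fst p \<in> A) \<noteq> (mix m (fst p) (snd p) \<in> A)}"
  let ?\<mu> = "measure GN2"
  have Dm: "?D m A \<in> sets GN2" if [measurable]: "A \<in> sets borel" for A m
    by measurable
  \<comment> \<open>As \<open>F\<close> has finite values, up to probability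
    \<open>\<delta> / 2\<close> it takes only finitely many of them, and finitely many applications
    of \<open>mix_set_approx\<close> suffice.\<close>
  have "(\<lambda>x. real_of_int (F x)) \<in> borel_measurable GN" by simp
  from measurable_tail_tendsto_0[OF GN.prob_space_axioms this]
  have "\<forall>\<^sub>F n in sequentially. measure GN {x. \<bar>real_of_int (F x)\<bar> > real n} < \<delta> / 2"
    using d by (intro order_tendstoD(2)) auto
  then obtain n where n: "measure GN {x. \<bar>real_of_int (F x)\<bar> > real n} < \<delta> / 2"
    by (auto simp: eventually_sequentially)
  define A where "A = (\<lambda>j. {x. F x = j})"
  have Am: "A j \<in> sets borel" for j unfolding A_def by measurable
  have "(\<lambda>m. \<Sum>j\<in>{-int n..int n}. ?\<mu> (?D m (A j))) \<longlonglongrightarrow> (\<Sum>j\<in>{-int n..int n}. 0)"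
    by (intro tendsto_sum mix_set_approx Am)
  then have "\<forall>\<^sub>F m in sequentially. (\<Sum>j\<in>{-int n..int n}. ?\<mu> (?D m (A j))) < \<delta> / 2"
    using d by (intro order_tendstoD(2)) auto
  then show ?thesis
  proof eventually_elim
    case (elim m)
    let ?T = "{p \<in> space GN2. \<bar>real_of_int (F (fst p))\<bar> > real n}"
    have Tm: "?T \<in> sets GN2" by measurable
    have "?\<mu> {p \<in> space GN2. \<bar>f (fst p) - f (mix m (fst p) (snd p))\<bar> > \<delta>}
        \<le> ?\<mu> (?T \<union> (\<Union>j\<in>{-int n..int n}. ?D m (A j)))"
    proof (rule GG.P.finite_measure_mono)
      show "{p \<in> space GN2. \<bar>f (fst p) - f (mix m (fst p) (snd p))\<bar> > \<delta>}
          \<subseteq> ?T \<union> (\<Union>j\<in>{-int n..int n}. ?D m (A j))"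
      proof (rule subsetI, rule ccontr)
        fix p assume p: "p \<in> {p \<in> space GN2. \<bar>f (fst p) - f (mix m (fst p) (snd p))\<bar> > \<delta>}"
          and "p \<notin> ?T \<union> (\<Union>j\<in>{-int n..int n}. ?D m (A j))"
        then have "\<bar>real_of_int (F (fst p))\<bar> \<le> real n" and *: "\<And>j. j \<in> {-int n..int n} \<Longrightarrow> p \<notin> ?D m (A j)"
          by auto
        then have "F (fst p) \<in> {-int n..int n}" by auto
        from *[OF this] have eq: "F (mix m (fst p) (snd p)) = F (fst p)"
          using p by (auto simp: A_def)
        define s t where "s = f (fst p) / \<delta>" and "t = f (mix m (fst p) (snd p)) / \<delta>"
        have "\<bar>s - t\<bar> < 1" using eq unfolding F_def s_def[symmetric] t_def[symmetric] by linarith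
        then have "\<bar>s - t\<bar> * \<delta> < 1 * \<delta>" using d by (intro mult_strict_right_mono) auto
        moreover have "\<bar>s - t\<bar> * \<delta> = \<bar>(s - t) * \<delta>\<bar>" using d by (simp add: abs_mult)
        moreover have "(s - t) * \<delta> = f (fst p) - f (mix m (fst p) (snd p))"
          using d by (simp add: s_def t_def algebra_simps)
        ultimately show False using p by auto
      qed
    qed (use Tm Dm Am in auto)
    also have "\<dots> \<le> ?\<mu> ?T + (\<Sum>j\<in>{-int n..int n}. ?\<mu> (?D m (A j)))"
    proof -
      have Z: "?\<mu> (\<Union>j\<in>{-int n..int n}. ?D m (A j)) \<le> (\<Sum>j\<in>{-int n..int n}. ?\<mu> (?D m (A j)))"
        by (rule measure_UNION_le) (use Dm Am in auto)
      have "(\<Union>j\<in>{-int n..int n}. ?D m (A j)) \<in> sets GN2"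
        using Dm Am by blast
      then show ?thesis
        using Z measure_Un_le[OF Tm, of "\<Union>j\<in>{-int n..int n}. ?D m (A j)"] by linarith
    qed
    also have "?\<mu> ?T = measure GN {x. \<bar>real_of_int (F x)\<bar> > real n}"
      by (rule measure_fst) measurable
    finally show ?case using n elim by linarith
  qed
qed

section \<open>Lipschitz functions for a weighted distance\<close>

lemma wdn_nonneg [simp]: "(\<And>k. 0 \<le> v k) \<Longrightarrow> 0 \<le> wdn v m x y"
  unfolding wdn_def by (simp add: sum_nonneg)

lemma wdn_L2: "(\<And>k. 0 \<le> v k) \<Longrightarrow> wdn v m x y = L2_set (\<lambda>k. sqrt (v k) * (x k - y k)) {..<m}"
  by (simp add: wdn_def L2_set_def power_mult_distrib)

lemma wdn_triangle: "(\<And>k. 0 \<le> v k) \<Longrightarrow> wdn v m x z \<le> wdn v m x y + wdn v m y z"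
proof -
  assume v: "\<And>k. 0 \<le> v k"
  have "wdn v m x z = L2_set (\<lambda>k. sqrt (v k) * (x k - y k) + sqrt (v k) * (y k - z k)) {..<m}"
    unfolding wdn_L2[OF v] by (simp add: algebra_simps)
  also have "\<dots> \<le> wdn v m x y + wdn v m y z"
    unfolding wdn_L2[OF v] by (rule L2_set_triangle_ineq)
  finally show ?thesis .
qed

lemma wdn_commute: "wdn v m x y = wdn v m y x"
  by (simp add: wdn_def power2_commute)

lemma wdn_same [simp]: "wdn v m x x = 0"
  by (simp add: wdn_def)

lemma wdn_mono: "(\<And>k. 0 \<le> v k) \<Longrightarrow> m \<le> n \<Longrightarrow> wdn v m x y \<le> wdn v n x y"
  unfolding wdn_def by (intro real_sqrt_le_mono sum_mono2) auto

lemma wdn_le_wd: "ennreal (wdn v m x y) \<le> wd v x y"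
  unfolding wd_def by (rule SUP_upper) simp

lemma wd_finite_support:
  assumes v: "\<And>k. 0 \<le> v k" and xy: "\<And>k. m \<le> k \<Longrightarrow> x k = y k"
  shows "wd v x y = ennreal (wdn v m x y)"
  unfolding wd_def
proof (rule antisym)
  show "(SUP n. ennreal (wdn v n x y)) \<le> ennreal (wdn v m x y)"
  proof (rule SUP_least, rule ennreal_leI)
    fix n
    have "wdn v n x y \<le> wdn v (max m n) x y" by (rule wdn_mono[OF v]) simp
    also have "wdn v (max m n) x y = wdn v m x y"
      unfolding wdn_def by (rule arg_cong[where f=sqrt], rule sum.mono_neutral_right) (auto simp: xy)
    finally show "wdn v n x y \<le> wdn v m x y" .
  qed
qed (rule SUP_upper, simp)

text \<open>The 1-Lipschitz functions in Gaussian coordinates, as functions rather than classes.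
  Where \<open>wd w x y\<close> is infinite the condition on the pair is void.\<close>

definition lipN :: "(nat \<Rightarrow> real) \<Rightarrow> ((nat \<Rightarrow> real) \<Rightarrow> real) set" where
  "lipN w = {f \<in> borel_measurable borel. \<exists>E\<in>sets borel. (AE x in GN. x \<in> E) \<and>
     (\<forall>x\<in>E. \<forall>y\<in>E. ennreal \<bar>f x - f y\<bar> \<le> wd w x y)}"

text \<open>The truncated distance vanishes between points with the same first \<open>n\<close>
  coordinates, so these functions depend on those coordinates only. The bound holds everywhere,
  whence continuity and measurability need not be required.\<close>

definition cyl :: "nat \<Rightarrow> (nat \<Rightarrow> real) \<Rightarrow> ((nat \<Rightarrow> real) \<Rightarrow> real) set" where
  "cyl n w = {g. \<forall>x y. \<bar>g x - g y\<bar> \<le> wdn w n x y}"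

lemma cyl_continuous:
  assumes "g \<in> cyl n w" shows "continuous_on UNIV g"
proof -
  have "(g \<longlongrightarrow> g x) (at x)" for x
  proof (rule Lim_transform2)
    have "continuous_on UNIV (\<lambda>y. wdn w n y x)"
      unfolding wdn_def by (intro continuous_intros continuous_on_product_coordinates)
    then have "((\<lambda>y. wdn w n y x) \<longlongrightarrow> wdn w n x x) (at x)"
      unfolding continuous_on_def by blast
    then have "((\<lambda>y. wdn w n y x) \<longlongrightarrow> 0) (at x)" by simp
    then show "((\<lambda>y. g x - g y) \<longlongrightarrow> 0) (at x)"
      by (rule Lim_null_comparison[rotated])
         (use assms in \<open>auto simp: cyl_def abs_minus_commute wdn_commute intro!: always_eventually\<close>)
  qed simp
  then show ?thesis by (simp add: continuous_on_def)
qed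

lemma cyl_measurable: "g \<in> cyl n w \<Longrightarrow> g \<in> borel_measurable borel"
  by (intro borel_measurable_continuous_onI cyl_continuous)

lemma cyl_lipN: "g \<in> cyl n w \<Longrightarrow> g \<in> lipN w"
  unfolding lipN_def
  by (auto intro!: cyl_measurable bexI[of _ UNIV] order_trans[OF ennreal_leI wdn_le_wd[of w n]] simp: cyl_def)

lemma wdn_mix:
  assumes "\<And>k. 0 \<le> w k"
  shows "wdn w m (mix n x c) (mix n y c) \<le> wdn w n x y"
proof -
  have "(\<Sum>k<m. w k * (mix n x c k - mix n y c k)\<^sup>2) = (\<Sum>k\<in>{..<m} \<inter> {..<n}. w k * (x k - y k)\<^sup>2)"
    by (rule sum.mono_neutral_cong_right) (auto simp: mix_def)
  also have "\<dots> \<le> (\<Sum>k<n. w k * (x k - y k)\<^sup>2)"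
    by (rule sum_mono2) (use assms in auto)
  finally show ?thesis unfolding wdn_def by simp
qed

lemma cyl_mix: "(\<And>k. 0 \<le> w k) \<Longrightarrow> g \<in> cyl m w \<Longrightarrow> (\<lambda>x. g (mix n x c)) \<in> cyl n w"
  unfolding cyl_def by (auto intro: order_trans[OF _ wdn_mix])

lemma cyl_clamp: "g \<in> cyl m w \<Longrightarrow> (\<lambda>x. max (- M) (min M (g x))) \<in> cyl m w"
proof -
  have "\<bar>max (- M) (min M a) - max (- M) (min M b)\<bar> \<le> \<bar>a - b\<bar>" for a b :: real
    by (simp add: max_def min_def)
  then show "g \<in> cyl m w \<Longrightarrow> ?thesis" unfolding cyl_def by (blast intro: order_trans)
qed

text \<open>McShane's infimum of cones works for a pseudodistance. Since \<open>wdn w m\<close>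
  ignores the coordinates from \<open>m\<close> on, the extension depends on the first
  \<open>m\<close> alone, whatever the set \<open>Z\<close>.\<close>

lemma cyl_mcshane_extension:
  assumes w: "\<And>k. 0 \<le> w k" and Z: "Z \<noteq> {}"
    and f: "\<And>x y. x \<in> Z \<Longrightarrow> y \<in> Z \<Longrightarrow> \<bar>f x - f y\<bar> \<le> wdn w m x y"
  obtains g where "g \<in> cyl m w" "\<And>x. x \<in> Z \<Longrightarrow> g x = f x"
proof -
  define g where "g = (\<lambda>x. INF z\<in>Z. f z + wdn w m x z)"
  have bd: "bdd_below ((\<lambda>z. f z + wdn w m x z) ` Z)" for x
  proof -
    obtain z0 where z0: "z0 \<in> Z" using Z by blast
    have "f z0 - wdn w m x z0 \<le> f z + wdn w m x z" if "z \<in> Z" for z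
      using f[OF z0 that] wdn_triangle[where v=w and m=m and x=z0 and y=x and z=z, OF w] by (simp add: wdn_commute)
    then show ?thesis by (intro bdd_belowI2)
  qed
  have le: "g x \<le> g y + wdn w m x y" for x y
  proof -
    have "g x - wdn w m x y \<le> g y"
      unfolding g_def
    proof (rule cINF_greatest[OF Z])
      fix z assume z: "z \<in> Z"
      have "(INF z\<in>Z. f z + wdn w m x z) \<le> f z + wdn w m x z" by (rule cINF_lower[OF bd z])
      then show "(INF z\<in>Z. f z + wdn w m x z) - wdn w m x y \<le> f z + wdn w m y z"
        using wdn_triangle[where v=w and m=m and x=x and y=y and z=z, OF w] by linarith
    qed
    then show ?thesis by linarith
  qed
  have "g \<in> cyl m w"
    unfolding cyl_def using le wdn_commute[of w m] by (auto simp: abs_le_iff) (smt (verit) le wdn_commute)+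
  moreover have "g x = f x" if x: "x \<in> Z" for x
  proof (rule antisym)
    show "g x \<le> f x" unfolding g_def using cINF_lower[OF bd x, of x] by simp
    show "f x \<le> g x" unfolding g_def
      by (rule cINF_greatest[OF Z]) (use f[OF x] in \<open>simp add: abs_le_iff algebra_simps\<close>)
  qed
  ultimately show ?thesis using that by blast
qed

text \<open>Invariance under resampling and Fubini. It provides frozen tails \<open>y\<close> for
  which almost every \<open>x\<close> is still moved into the set where the Lipschitz bound is
  available.\<close>

lemma AE_mix_section:
  assumes E: "E \<in> sets borel" and AE: "AE x in GN. x \<in> E"
  shows "AE y in GN. AE x in GN. mix m x y \<in> E"
proof -
  have "AE p in distr GN2 GN (\<lambda>(x, y). mix m x y). p \<in> E" using AE by (subst distr_mix)
  then have "AE p in GN2. (case p of (x, y) \<Rightarrow> mix m x y) \<in> E"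
    by (rule AE_distrD[rotated]) measurable
  then have "AE x in GN. AE y in GN. mix m x y \<in> E"
    by (auto dest: GG.AE_pair)
  moreover have "{p \<in> space GN2. mix m (fst p) (snd p) \<in> E} \<in> sets GN2"
    using E by measurable
  ultimately show ?thesis
    using GG.AE_commute[of "\<lambda>x y. mix m x y \<in> E"] by blast
qed

text \<open>The tail coordinates are frozen at a generic point \<open>y\<close> rather than averaged out,
  as \<open>f\<close> is not known to be integrable.\<close>

lemma lipN_bounded_cyl_approx:
  assumes w: "\<And>k. 0 \<le> w k" and f: "f \<in> lipN w" and d: "\<delta> > 0"
  shows "\<exists>m. \<exists>g\<in>cyl m w. (\<exists>M. \<forall>x. \<bar>g x\<bar> \<le> M) \<and> measure GN {x. \<bar>f x - g x\<bar> > \<delta>} \<le> \<delta>"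
proof -
  have fm [measurable]: "f \<in> borel_measurable borel" using f by (simp add: lipN_def)
  obtain E where E [measurable]: "E \<in> sets borel" and AE: "AE x in GN. x \<in> E"
    and lip: "\<And>x y. x \<in> E \<Longrightarrow> y \<in> E \<Longrightarrow> ennreal \<bar>f x - f y\<bar> \<le> wd w x y"
    using f by (auto simp: lipN_def)
  let ?A = "\<lambda>m. {p \<in> space GN2. \<bar>f (fst p) - f (mix m (fst p) (snd p))\<bar> > \<delta> / 2}"
  have "\<forall>\<^sub>F m in sequentially. measure GN2 (?A m) < \<delta> / 2"
    by (rule mix_fun_approx[OF fm]) (use d in simp)
  then obtain m where m: "measure GN2 (?A m) < \<delta> / 2"
    by (auto simp: eventually_sequentially)
  have "\<exists>y\<in>space GN. (AE x in GN. mix m x y \<in> E) \<and> measure GN {x \<in> space GN. (x, y) \<in> ?A m} < \<delta> / 2"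
    by (rule prob_space_exists_section[OF GN.prob_space_axioms GN.prob_space_axioms _ m AE_mix_section[OF E AE]]) measurable
  then obtain y where y: "AE x in GN. mix m x y \<in> E"
    and my: "measure GN {x. \<bar>f x - f (mix m x y)\<bar> > \<delta> / 2} < \<delta> / 2"
    by (auto simp: space_pair_measure)
  define Z where "Z = {x. mix m x y \<in> E}"
  have Zne: "Z \<noteq> {}"
  proof
    assume "Z = {}"
    then have "AE x in GN. False" using y by (auto simp: Z_def)
    then show False by simp
  qed
  \<comment> \<open>Here the Lipschitz condition becomes usable: two points frozen at the same tail
    differ in the first \<open>m\<close> coordinates only, so their distance is finite and given by
    \<open>wdn\<close>.\<close>
  have lipZ: "\<bar>f (mix m x y) - f (mix m x' y)\<bar> \<le> wdn w m x x'" if "x \<in> Z" "x' \<in> Z" for x x'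
  proof -
    have "ennreal \<bar>f (mix m x y) - f (mix m x' y)\<bar> \<le> wd w (mix m x y) (mix m x' y)"
      by (rule lip) (use that in \<open>auto simp: Z_def\<close>)
    also have "\<dots> = ennreal (wdn w m (mix m x y) (mix m x' y))"
      by (rule wd_finite_support[OF w]) (simp add: mix_def)
    also have "\<dots> \<le> ennreal (wdn w m x x')"
      by (intro ennreal_leI wdn_mix w)
    finally show ?thesis using w by (simp add: ennreal_le_iff)
  qed
  obtain g0 where g0: "g0 \<in> cyl m w" "\<And>x. x \<in> Z \<Longrightarrow> g0 x = f (mix m x y)"
    using cyl_mcshane_extension[of w Z "\<lambda>x. f (mix m x y)" m] w Zne lipZ by metis
  have [measurable]: "g0 \<in> borel_measurable borel" by (rule cyl_measurable[OF g0(1)])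
  have "(\<lambda>n. measure GN {x \<in> space GN. \<bar>g0 x\<bar> > real n}) \<longlonglongrightarrow> 0"
    by (rule measurable_tail_tendsto_0[OF GN.prob_space_axioms]) simp
  then have "\<forall>\<^sub>F n in sequentially. measure GN {x \<in> space GN. \<bar>g0 x\<bar> > real n} < \<delta> / 2"
    using d by (intro order_tendstoD(2)) auto
  then obtain M where M: "measure GN {x. \<bar>g0 x\<bar> > real M} < \<delta> / 2"
    by (auto simp: eventually_sequentially)
  \<comment> \<open>The clamp costs probability less than \<open>\<delta> / 2\<close> by the choice
    of \<open>M\<close> and supplies the bound needed for exponential moments.\<close>
  define g where "g = (\<lambda>x. max (- real M) (min (real M) (g0 x)))"
  have gc: "g \<in> cyl m w" unfolding g_def by (rule cyl_clamp[OF g0(1)])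
  have [measurable]: "g \<in> borel_measurable borel" by (rule cyl_measurable[OF gc])
  have "measure GN {x. \<bar>f x - g x\<bar> > \<delta>} \<le>
      measure GN ({x. \<bar>f x - f (mix m x y)\<bar> > \<delta> / 2} \<union> {x. \<bar>g0 x\<bar> > real M})"
  proof (rule GN.finite_measure_mono_AE)
    show "AE x in GN. x \<in> {x. \<bar>f x - g x\<bar> > \<delta>} \<longrightarrow>
        x \<in> {x. \<bar>f x - f (mix m x y)\<bar> > \<delta> / 2} \<union> {x. \<bar>g0 x\<bar> > real M}"
      using y
    proof eventually_elim
      case (elim x)
      then have "g0 x = f (mix m x y)" using g0(2)[of x] by (simp add: Z_def)
      then show ?case using d by (auto simp: g_def)
    qed
  qed measurable
  also have "\<dots> \<le> measure GN {x. \<bar>f x - f (mix m x y)\<bar> > \<delta> / 2} + measure GN {x. \<bar>g0 x\<bar> > real M}"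
    by (rule measure_Un_le) measurable
  finally have "measure GN {x. \<bar>f x - g x\<bar> > \<delta>} \<le> \<delta>" using my M by linarith
  moreover have "\<bar>g x\<bar> \<le> real M" for x unfolding g_def by auto
  ultimately show ?thesis using gc by blast
qed

lemma GN_concentration:
  fixes h :: "(nat \<Rightarrow> real) \<Rightarrow> real"
  assumes K: "finite K" and c: "continuous_on UNIV h" and b: "\<And>x. \<bar>h x\<bar> \<le> M"
    and lip: "\<And>x y. \<bar>h x - h y\<bar> \<le> sqrt (L * (\<Sum>k\<in>K. (x k - y k)\<^sup>2))" and L: "L > 0" and e: "\<epsilon> > 0"
  shows "measure GN2 {p \<in> space GN2. \<bar>h (fst p) - h (snd p)\<bar> \<ge> \<epsilon>} \<le> 2 * exp (- (\<epsilon>\<^sup>2 / (4 * L)))"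
proof -
  have [measurable]: "h \<in> borel_measurable borel" using c by (rule borel_measurable_continuous_onI)
  let ?P = "{p \<in> space GN2. h (fst p) - h (snd p) \<ge> \<epsilon>}"
  let ?N = "{p \<in> space GN2. - h (fst p) - - h (snd p) \<ge> \<epsilon>}"
  have PN: "?P \<in> sets GN2" "?N \<in> sets GN2" by measurable
  have "{p \<in> space GN2. \<bar>h (fst p) - h (snd p)\<bar> \<ge> \<epsilon>} = ?P \<union> ?N"
    by (auto simp: abs_if split: if_splits)
  moreover have "measure GN2 ?P \<le> exp (- (\<epsilon>\<^sup>2 / (4 * L)))"
    by (rule GN_concentration_upper[OF K c b lip L e])
  moreover have "measure GN2 ?N \<le> exp (- (\<epsilon>\<^sup>2 / (4 * L)))"
    by (rule GN_concentration_upper[where h="\<lambda>x. - h x", OF K _ _ _ L e])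
       (use c b lip in \<open>auto intro!: continuous_intros simp: abs_minus_commute\<close>)
  ultimately show ?thesis using measure_Un_le[OF PN] by simp
qed

text \<open>For a fixed head, \<open>g\<close> is a function of the tail that is Lipschitz with
  constant \<open>sqrt L\<close> for the Euclidean distance, so two independent tails give close
  values. Neither \<open>m\<close> nor \<open>M\<close> enters the bound; it can therefore be
  combined with an approximation in which both are uncontrolled.\<close>

lemma cyl_tail_concentration:
  assumes w: "\<And>k. 0 \<le> w k" "\<And>k. n \<le> k \<Longrightarrow> w k \<le> L" and L: "L > 0" and e: "\<epsilon> > 0"
    and g: "g \<in> cyl m w" "\<And>x. \<bar>g x\<bar> \<le> M"
  shows "measure GN2 {p \<in> space GN2. \<bar>g (fst p) - g (mix n (fst p) (snd p))\<bar> \<ge> \<epsilon>}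
    \<le> 2 * exp (- (\<epsilon>\<^sup>2 / (4 * L)))"
proof -
  let ?A = "{p \<in> space GN2. \<bar>g (fst p) - g (mix n (fst p) (snd p))\<bar> \<ge> \<epsilon>}"
  have [measurable]: "g \<in> borel_measurable borel" by (rule cyl_measurable[OF g(1)])
  define \<phi> where "\<phi> = (\<lambda>x. emeasure GN {c. \<bar>g x - g (mix n x c)\<bar> \<ge> \<epsilon>})"
  have Am: "?A \<in> sets GN2" by measurable
  have sec: "Pair x -` ?A = {c. \<bar>g x - g (mix n x c)\<bar> \<ge> \<epsilon>}" for x
    by (auto simp: space_pair_measure)
  have \<phi>m [measurable]: "\<phi> \<in> borel_measurable borel"
    using GN.measurable_emeasure_Pair[OF Am] by (simp add: sec \<phi>_def)
  have "emeasure GN2 ?A = (\<integral>\<^sup>+x. \<phi> x \<partial>GN)"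
    unfolding \<phi>_def sec[symmetric] by (rule GN.emeasure_pair_measure_alt[OF Am])
  \<comment> \<open>Writing the sample as \<open>mix n a b\<close> exhibits the two values of
    \<open>g\<close> as values at independent tails \<open>b\<close> and \<open>c\<close> over the
    same head \<open>a\<close>.\<close>
  also have "\<dots> = (\<integral>\<^sup>+x. \<phi> x \<partial>distr GN2 GN (\<lambda>(x, y). mix n x y))"
    by (simp add: distr_mix)
  also have "\<dots> = (\<integral>\<^sup>+p. \<phi> (case p of (x, y) \<Rightarrow> mix n x y) \<partial>GN2)"
    by (rule nn_integral_distr) auto
  also have "\<dots> = (\<integral>\<^sup>+a. \<integral>\<^sup>+b. \<phi> (mix n a b) \<partial>GN \<partial>GN)"
    using GN.nn_integral_fst[of "\<lambda>p. \<phi> (case p of (x, y) \<Rightarrow> mix n x y)" GN] by simp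
  also have "\<dots> \<le> (\<integral>\<^sup>+a. ennreal (2 * exp (- (\<epsilon>\<^sup>2 / (4 * L)))) \<partial>GN)"
  proof (rule nn_integral_mono)
    fix a
    define h where "h = (\<lambda>b. g (mix n a b))"
    have hc: "continuous_on UNIV h"
      unfolding h_def by (rule continuous_on_compose2[OF cyl_continuous[OF g(1)] continuous_on_mix]) simp
    have [measurable]: "h \<in> borel_measurable borel" using hc by (rule borel_measurable_continuous_onI)
    let ?B = "{p \<in> space GN2. \<bar>h (fst p) - h (snd p)\<bar> \<ge> \<epsilon>}"
    have Bm: "?B \<in> sets GN2" by measurable
    have "mix n (mix n a b) c = mix n a c" for b c by (auto simp: mix_def)
    then have "\<phi> (mix n a b) = emeasure GN (Pair b -` ?B)" for b
      by (auto simp: \<phi>_def h_def space_pair_measure intro!: arg_cong2[where f=emeasure])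
    then have "(\<integral>\<^sup>+b. \<phi> (mix n a b) \<partial>GN) = emeasure GN2 ?B"
      using GN.emeasure_pair_measure_alt[OF Bm] by simp
    also have "\<dots> = ennreal (measure GN2 ?B)" by (rule GG.P.emeasure_eq_measure)
    also have "measure GN2 ?B \<le> 2 * exp (- (\<epsilon>\<^sup>2 / (4 * L)))"
    proof (rule GN_concentration[where K="{n..<m}" and M=M, OF _ hc _ _ L e])
      fix x y
      have "\<bar>h x - h y\<bar> \<le> wdn w m (mix n a x) (mix n a y)"
        using g(1) by (simp add: h_def cyl_def)
      also have "\<dots> \<le> sqrt (L * (\<Sum>k\<in>{n..<m}. (x k - y k)\<^sup>2))"
      proof -
        have "(\<Sum>k<m. w k * (mix n a x k - mix n a y k)\<^sup>2) = (\<Sum>k\<in>{n..<m}. w k * (x k - y k)\<^sup>2)"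
          by (rule sum.mono_neutral_cong_right) (auto simp: mix_def)
        also have "\<dots> \<le> (\<Sum>k\<in>{n..<m}. L * (x k - y k)\<^sup>2)"
          by (intro sum_mono mult_right_mono w) auto
        finally show ?thesis unfolding wdn_def by (simp add: sum_distrib_left)
      qed
      finally show "\<bar>h x - h y\<bar> \<le> sqrt (L * (\<Sum>k\<in>{n..<m}. (x k - y k)\<^sup>2))" .
    qed (use g(2) in \<open>auto simp: h_def\<close>)
    finally show "(\<integral>\<^sup>+b. \<phi> (mix n a b) \<partial>GN) \<le> ennreal (2 * exp (- (\<epsilon>\<^sup>2 / (4 * L))))"
      by (simp add: ennreal_leI)
  qed
  also have "\<dots> = ennreal (2 * exp (- (\<epsilon>\<^sup>2 / (4 * L))))" by (simp add: GN.emeasure_space_1[simplified])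
  finally show ?thesis by (simp add: GG.P.emeasure_eq_measure)
qed

text \<open>The number \<open>n\<close> of coordinates is now prescribed, and the quality depends on
  the weights beyond \<open>n\<close> only. The uncontrolled cylinder approximation
  \<open>g0\<close> is followed by freezing its coordinates from \<open>n\<close> on at a suitable
  \<open>c\<close>.\<close>

lemma lipN_cyl_approx:
  assumes w: "\<And>k. 0 \<le> w k" "\<And>k. n \<le> k \<Longrightarrow> w k \<le> L" and L: "L > 0" and e: "\<epsilon> > 0"
    and f: "f \<in> lipN w"
  shows "\<exists>g\<in>cyl n w. measure GN {x. \<bar>f x - g x\<bar> > \<epsilon>} \<le> 3 * exp (- (\<epsilon>\<^sup>2 / (16 * L)))"
proof -
  define b where "b = exp (- (\<epsilon>\<^sup>2 / (16 * L)))"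
  have b: "b > 0" by (simp add: b_def)
  have fm [measurable]: "f \<in> borel_measurable borel" using f by (simp add: lipN_def)
  have mpos: "min (\<epsilon> / 2) (b / 2) > 0" using e b by simp
  obtain m g0 M where g0: "g0 \<in> cyl m w" "\<And>x. \<bar>g0 x\<bar> \<le> M"
    and fg: "measure GN {x. \<bar>f x - g0 x\<bar> > min (\<epsilon> / 2) (b / 2)} \<le> min (\<epsilon> / 2) (b / 2)"
    using lipN_bounded_cyl_approx[where w=w and \<delta>="min (\<epsilon> / 2) (b / 2)", OF w(1) f mpos] by blast
  have [measurable]: "g0 \<in> borel_measurable borel" by (rule cyl_measurable[OF g0(1)])
  let ?A = "{p \<in> space GN2. \<bar>g0 (fst p) - g0 (mix n (fst p) (snd p))\<bar> \<ge> \<epsilon> / 2}"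
  have "measure GN2 ?A \<le> 2 * exp (- ((\<epsilon> / 2)\<^sup>2 / (4 * L)))"
    by (rule cyl_tail_concentration[OF w L _ g0]) (use e in auto)
  also have "2 * exp (- ((\<epsilon> / 2)\<^sup>2 / (4 * L))) = 2 * b" by (simp add: b_def power_divide)
  \<comment> \<open>Selecting a section needs a strict inequality, bought with an extra
    \<open>b / 2\<close>. Another \<open>b / 2\<close> pays for the approximation by
    \<open>g0\<close>, which explains the total \<open>3 * b\<close>.\<close>
  also have "2 * b < 5 / 2 * b" using b by simp
  finally have "measure GN2 ?A < 5 / 2 * b" .
  moreover have "?A \<in> sets GN2" by measurable
  ultimately have "\<exists>c\<in>space GN. True \<and> measure GN {x \<in> space GN. (x, c) \<in> ?A} < 5 / 2 * b"
    by (intro prob_space_exists_section[OF GN.prob_space_axioms GN.prob_space_axioms]) simp_all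
  then obtain c where c: "measure GN {x. \<bar>g0 x - g0 (mix n x c)\<bar> \<ge> \<epsilon> / 2} < 5 / 2 * b"
    by (auto simp: space_pair_measure)
  define g where "g = (\<lambda>x. g0 (mix n x c))"
  have gc: "g \<in> cyl n w" unfolding g_def by (rule cyl_mix[OF w(1) g0(1)])
  have [measurable]: "g \<in> borel_measurable borel" by (rule cyl_measurable[OF gc])
  have "measure GN {x. \<bar>f x - g x\<bar> > \<epsilon>} \<le>
      measure GN ({x. \<bar>f x - g0 x\<bar> > min (\<epsilon> / 2) (b / 2)} \<union> {x. \<bar>g0 x - g x\<bar> \<ge> \<epsilon> / 2})"
  proof (rule GN.finite_measure_mono)
    show "{x. \<bar>f x - g x\<bar> > \<epsilon>} \<subseteq> {x. \<bar>f x - g0 x\<bar> > min (\<epsilon> / 2) (b / 2)} \<union> {x. \<bar>g0 x - g x\<bar> \<ge> \<epsilon> / 2}"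
    proof
      fix x assume "x \<in> {x. \<bar>f x - g x\<bar> > \<epsilon>}"
      then have "\<bar>f x - g0 x\<bar> > \<epsilon> / 2 \<or> \<bar>g0 x - g x\<bar> \<ge> \<epsilon> / 2" using abs_triangle_ineq[of "f x - g0 x" "g0 x - g x"] by auto
      then show "x \<in> {x. \<bar>f x - g0 x\<bar> > min (\<epsilon> / 2) (b / 2)} \<union> {x. \<bar>g0 x - g x\<bar> \<ge> \<epsilon> / 2}"
        by (auto simp: min_less_iff_disj)
    qed
  qed auto
  also have "\<dots> \<le> measure GN {x. \<bar>f x - g0 x\<bar> > min (\<epsilon> / 2) (b / 2)} + measure GN {x. \<bar>g0 x - g x\<bar> \<ge> \<epsilon> / 2}"
    by (rule measure_Un_le) auto
  finally have "measure GN {x. \<bar>f x - g x\<bar> > \<epsilon>} \<le> 3 * b" using c fg by (simp add: g_def)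
  then show ?thesis using gc unfolding b_def by blast
qed

section \<open>Total boundedness and change of weights\<close>

lemma finite_grid: "finite {p :: nat \<Rightarrow> real. \<exists>q :: nat \<Rightarrow> int. p = (\<lambda>k. \<eta> * real_of_int (q k)) \<and> (\<forall>k. \<bar>q k\<bar> \<le> (J :: int)) \<and> (\<forall>k\<ge>n. q k = (0 :: int))}"
proof -
  have "finite {q :: nat \<Rightarrow> int. \<forall>k. (k \<in> {..<n} \<longrightarrow> q k \<in> {-J..J}) \<and> (k \<notin> {..<n} \<longrightarrow> q k = 0)}"
    by (rule finite_set_of_finite_funs) auto
  then have "finite ((\<lambda>q k. \<eta> * real_of_int (q k)) ` {q :: nat \<Rightarrow> int. \<forall>k. (k \<in> {..<n} \<longrightarrow> q k \<in> {-J..J}) \<and> (k \<notin> {..<n} \<longrightarrow> q k = 0)})"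
    by (rule finite_imageI)
  then show ?thesis
  proof (rule finite_subset[rotated], clarify)
    fix q :: "nat \<Rightarrow> int" assume q: "\<forall>k. \<bar>q k\<bar> \<le> J" "\<forall>k\<ge>n. q k = 0"
    have "- J \<le> q k \<and> q k \<le> J" for k using q(1)[rule_format, of k] by linarith
    with q(2) show "(\<lambda>k. \<eta> * real_of_int (q k)) \<in> (\<lambda>q k. \<eta> * real_of_int (q k)) `
        {q. \<forall>k. (k \<in> {..<n} \<longrightarrow> q k \<in> {-J..J}) \<and> (k \<notin> {..<n} \<longrightarrow> q k = 0)}"
      by (intro image_eqI[of _ _ q]) auto
  qed
qed

lemma GN_box: "\<delta> > 0 \<Longrightarrow> \<exists>R>0. measure GN {x. \<exists>k<n. \<bar>x k\<bar> > R} < \<delta>"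
proof -
  assume d: "\<delta> > 0"
  define f where "f = (\<lambda>x :: nat \<Rightarrow> real. \<Sum>k<n. \<bar>x k\<bar>)"
  have [measurable]: "f \<in> borel_measurable borel" unfolding f_def by measurable
  have "(\<lambda>n. measure GN {x \<in> space GN. \<bar>f x\<bar> > real n}) \<longlonglongrightarrow> 0"
    by (rule measurable_tail_tendsto_0[OF GN.prob_space_axioms]) simp
  then have "\<forall>\<^sub>F n in sequentially. measure GN {x \<in> space GN. \<bar>f x\<bar> > real n} < \<delta>"
    using d by (intro order_tendstoD(2)) auto
  then have "\<forall>\<^sub>F n in sequentially. n \<ge> 1 \<and> measure GN {x \<in> space GN. \<bar>f x\<bar> > real n} < \<delta>"
    using eventually_ge_at_top[of 1] by eventually_elim auto
  then obtain R where R: "R \<ge> 1" "measure GN {x. \<bar>f x\<bar> > real R} < \<delta>"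
    by (auto simp: eventually_sequentially)
  have "measure GN {x. \<exists>k<n. \<bar>x k\<bar> > real R} \<le> measure GN {x. \<bar>f x\<bar> > real R}"
  proof (rule GN.finite_measure_mono)
    show "{x. \<exists>k<n. \<bar>x k\<bar> > real R} \<subseteq> {x. \<bar>f x\<bar> > real R}"
    proof safe
      fix x :: "nat \<Rightarrow> real" and k assume "k < n" "\<bar>x k\<bar> > real R"
      moreover have "\<bar>x k\<bar> \<le> f x" unfolding f_def
        by (rule member_le_sum) (use \<open>k < n\<close> in auto)
      ultimately show "\<bar>f x\<bar> > real R" by linarith
    qed
  qed measurable
  then show ?thesis using R by (intro exI[of _ "real R"]) auto
qed

text \<open>Outside an event of small probability, every point lies within \<delta> of a finite
  grid. The rounded values on the grid, normalised at the origin, determine a function up to a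
  constant and an error of \<open>3 * \<delta>\<close>: one \<delta> for moving each of the two
  functions to the grid and one for the rounding. Stating this as a finite colouring \<Psi> avoids
  the quotient space.\<close>

lemma cyl_totally_bounded:
  assumes w: "\<And>k. 0 \<le> w k" and d: "\<delta> > 0"
  shows "\<exists>\<Psi> :: ((nat \<Rightarrow> real) \<Rightarrow> real) \<Rightarrow> (nat \<Rightarrow> real) \<Rightarrow> int. finite (\<Psi> ` cyl n w) \<and>
    (\<forall>g\<in>cyl n w. \<forall>h\<in>cyl n w. \<Psi> g = \<Psi> h \<longrightarrow> (\<exists>c. measure GN {x. \<bar>g x - h x - c\<bar> > 3 * \<delta>} \<le> \<delta>))"
proof -
  obtain R where R: "R > 0" "measure GN {x. \<exists>k<n. \<bar>x k\<bar> > R} < \<delta>"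
    using GN_box[OF d] by blast
  define W where "W = (\<Sum>k<n. w k)"
  have W: "W \<ge> 0" unfolding W_def by (intro sum_nonneg w)
  \<comment> \<open>The mesh makes \<open>W * \<eta>\<^sup>2 \<le> \<delta>\<^sup>2\<close>; the
    summand 1 prevents a division by zero when there are no coordinates.\<close>
  define \<eta> where "\<eta> = \<delta> / sqrt (W + 1)"
  have \<eta>: "\<eta> > 0" using d W by (simp add: \<eta>_def)
  have \<eta>W: "sqrt (W * \<eta>\<^sup>2) \<le> \<delta>"
  proof (rule real_le_lsqrt)
    have "W * \<eta>\<^sup>2 = \<delta>\<^sup>2 * (W / (W + 1))" using W by (simp add: \<eta>_def power_divide)
    also have "\<dots> \<le> \<delta>\<^sup>2 * 1" using W by (intro mult_left_mono) auto
    finally show "W * \<eta>\<^sup>2 \<le> \<delta>\<^sup>2" by simp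
  qed (use d in auto)
  define J where "J = \<lfloor>R / \<eta>\<rfloor> + 1"
  define F where "F = {p :: nat \<Rightarrow> real. \<exists>q :: nat \<Rightarrow> int. p = (\<lambda>k. \<eta> * real_of_int (q k)) \<and> (\<forall>k. \<bar>q k\<bar> \<le> (J :: int)) \<and> (\<forall>k\<ge>n. q k = (0 :: int))}"
  have F: "finite F" unfolding F_def by (rule finite_grid)
  have near: "\<exists>p\<in>F. wdn w n x p \<le> \<delta>" if x: "\<And>k. k < n \<Longrightarrow> \<bar>x k\<bar> \<le> R" for x
  proof -
    define q where "q = (\<lambda>k. if k < n then \<lfloor>x k / \<eta>\<rfloor> else 0)"
    have "\<bar>q k\<bar> \<le> J" for k
    proof (cases "k < n")
      case True
      have "\<bar>x k / \<eta>\<bar> \<le> R / \<eta>" using x[OF True] \<eta> by (simp add: divide_right_mono)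
      then have "\<bar>\<lfloor>x k / \<eta>\<rfloor>\<bar> \<le> J" unfolding J_def by linarith
      then show ?thesis using True by (simp add: q_def)
    next
      case False
      have "0 \<le> R / \<eta>" using R \<eta> by simp
      then have "0 \<le> J" unfolding J_def by linarith
      then show ?thesis using False by (simp add: q_def)
    qed
    then have pF: "(\<lambda>k. \<eta> * q k) \<in> F" unfolding F_def by (auto simp: q_def)
    have "(x k - \<eta> * q k)\<^sup>2 \<le> \<eta>\<^sup>2" if "k < n" for k
    proof -
      have e: "x k - \<eta> * q k = \<eta> * (x k / \<eta> - \<lfloor>x k / \<eta>\<rfloor>)" using that \<eta> by (simp add: q_def algebra_simps)
      have "0 \<le> x k / \<eta> - \<lfloor>x k / \<eta>\<rfloor>" "x k / \<eta> - \<lfloor>x k / \<eta>\<rfloor> \<le> 1" by linarith+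
      then have "\<bar>\<eta> * (x k / \<eta> - \<lfloor>x k / \<eta>\<rfloor>)\<bar> \<le> \<eta> * 1"
        using \<eta> by (simp only: abs_mult) (intro mult_mono, auto)
      then show ?thesis unfolding e by (metis abs_le_square_iff abs_of_pos \<eta> mult.right_neutral)
    qed
    then have "(\<Sum>k<n. w k * (x k - \<eta> * q k)\<^sup>2) \<le> (\<Sum>k<n. w k * \<eta>\<^sup>2)"
      by (intro sum_mono mult_left_mono w) auto
    then have "wdn w n x (\<lambda>k. \<eta> * q k) \<le> sqrt (W * \<eta>\<^sup>2)"
      unfolding wdn_def W_def by (simp add: sum_distrib_right)
    then show ?thesis using pF \<eta>W by (intro bexI[of _ "\<lambda>k. \<eta> * q k"]) auto
  qed
  define \<Psi> where "\<Psi> = (\<lambda>g :: (nat \<Rightarrow> real) \<Rightarrow> real. \<lambda>p. if p \<in> F then \<lfloor>(g p - g (\<lambda>_. 0)) / \<delta>\<rfloor> else 0)"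
  \<comment> \<open>A bound for the normalised value at all grid points at once, valid for every
    function in the class; it caps the rounded values.\<close>
  define B where "B = (\<Sum>p\<in>F. wdn w n p (\<lambda>_. 0))"
  define N where "N = \<lfloor>B / \<delta>\<rfloor> + 1"
  have "finite {\<psi> :: (nat \<Rightarrow> real) \<Rightarrow> int. \<forall>p. (p \<in> F \<longrightarrow> \<psi> p \<in> {-N..N}) \<and> (p \<notin> F \<longrightarrow> \<psi> p = 0)}"
    by (rule finite_set_of_finite_funs[OF F]) auto
  moreover have "\<Psi> ` cyl n w \<subseteq> {\<psi>. \<forall>p. (p \<in> F \<longrightarrow> \<psi> p \<in> {-N..N}) \<and> (p \<notin> F \<longrightarrow> \<psi> p = 0)}"
  proof (safe, goal_cases)
    case (1 _ g p)
    have "\<bar>g p - g (\<lambda>_. 0)\<bar> \<le> wdn w n p (\<lambda>_. 0)" using 1 by (auto simp: cyl_def)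
    also have "\<dots> \<le> B" unfolding B_def by (rule member_le_sum) (use 1 F w in auto)
    finally have "\<bar>(g p - g (\<lambda>_. 0)) / \<delta>\<bar> \<le> B / \<delta>" using d by (simp add: divide_right_mono)
    then have "\<bar>\<lfloor>(g p - g (\<lambda>_. 0)) / \<delta>\<rfloor>\<bar> \<le> N" unfolding N_def by linarith
    then show ?case using 1 by (auto simp: \<Psi>_def)
  qed (auto simp: \<Psi>_def)
  ultimately have "finite (\<Psi> ` cyl n w)" by (rule finite_subset[rotated])
  moreover have "\<exists>c. measure GN {x. \<bar>g x - h x - c\<bar> > 3 * \<delta>} \<le> \<delta>"
    if g: "g \<in> cyl n w" and h: "h \<in> cyl n w" and eq: "\<Psi> g = \<Psi> h" for g h
  proof (intro exI)
    define c where "c = g (\<lambda>_. 0) - h (\<lambda>_. 0)"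
    have "measure GN {x. \<bar>g x - h x - c\<bar> > 3 * \<delta>} \<le> measure GN {x. \<exists>k<n. \<bar>x k\<bar> > R}"
    proof (rule GN.finite_measure_mono)
      show "{x. \<bar>g x - h x - c\<bar> > 3 * \<delta>} \<subseteq> {x. \<exists>k<n. \<bar>x k\<bar> > R}"
      proof (rule subsetI, rule ccontr)
        fix x assume x: "x \<in> {x. \<bar>g x - h x - c\<bar> > 3 * \<delta>}" and "x \<notin> {x. \<exists>k<n. \<bar>x k\<bar> > R}"
        then have "\<And>k. k < n \<Longrightarrow> \<bar>x k\<bar> \<le> R" by (metis mem_Collect_eq not_less)
        then obtain p where p: "p \<in> F" "wdn w n x p \<le> \<delta>" using near by blast
        have "\<lfloor>(g p - g (\<lambda>_. 0)) / \<delta>\<rfloor> = \<lfloor>(h p - h (\<lambda>_. 0)) / \<delta>\<rfloor>"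
          using fun_cong[OF eq, of p] p by (simp add: \<Psi>_def)
        then have "\<bar>(g p - g (\<lambda>_. 0)) / \<delta> - (h p - h (\<lambda>_. 0)) / \<delta>\<bar> \<le> 1" by linarith
        then have "\<bar>(g p - h p - c) / \<delta>\<bar> \<le> 1" by (simp add: c_def diff_divide_distrib)
        then have 1: "\<bar>g p - h p - c\<bar> \<le> \<delta>" using d by (simp add: abs_divide)
        have 2: "\<bar>g x - g p\<bar> \<le> \<delta>" "\<bar>h x - h p\<bar> \<le> \<delta>"
          using g h p(2) unfolding cyl_def by (blast intro: order_trans)+
        show False using x 1 2 by auto
      qed
    qed measurable
    then show "measure GN {x. \<bar>g x - h x - c\<bar> > 3 * \<delta>} \<le> \<delta>" using R by linarith
  qed
  ultimately show ?thesis by blast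
qed

lemma exp_neg_square_small:
  assumes "e > 0" "\<delta> > 0"
  shows "\<exists>L0>0. \<forall>L. 0 < L \<longrightarrow> L \<le> L0 \<longrightarrow> 3 * exp (- (e\<^sup>2 / (16 * L))) \<le> (\<delta> :: real)"
proof -
  have "((\<lambda>L. 3 * exp (- (e\<^sup>2 / (16 * L)))) \<longlongrightarrow> 0) (at_right 0)"
    using assms(1) by real_asymp
  then have "\<forall>\<^sub>F L in at_right 0. 3 * exp (- (e\<^sup>2 / (16 * L))) < \<delta>"
    using assms by (intro order_tendstoD(2)) auto
  then obtain b where b: "b > 0" "\<And>L. 0 < L \<Longrightarrow> L < b \<Longrightarrow> 3 * exp (- (e\<^sup>2 / (16 * L))) < \<delta>"
    unfolding eventually_at_right_field by auto
  show ?thesis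
    by (rule exI[of _ "b/2"]) (use b in \<open>auto intro!: less_imp_le[OF b(2)]\<close>)
qed

lemma exp_neg_square_large:
  assumes "\<delta> > 0"
  shows "\<exists>R>0. 3 * exp (- (R\<^sup>2 / 16)) \<le> (\<delta> :: real)"
proof -
  have "((\<lambda>R. 3 * exp (- (R\<^sup>2 / 16))) \<longlongrightarrow> (0::real)) at_top"
    by real_asymp
  then have "\<forall>\<^sub>F R in at_top. 3 * exp (- (R\<^sup>2 / 16)) < \<delta>"
    using assms by (intro order_tendstoD(2)) auto
  then have "\<forall>\<^sub>F R in at_top. R > 0 \<and> 3 * exp (- (R\<^sup>2 / 16)) < \<delta>"
    using eventually_gt_at_top[of 0] by eventually_elim auto
  then show ?thesis by (auto simp: eventually_at_top_linorder intro: less_imp_le)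
qed

text \<open>The number \<open>n\<close> of coordinates depends on \<delta> and \<open>w\<close> but
  not on the function, so the finite colouring of \<open>cyl n w\<close> pulls back along the choice
  \<open>G\<close> of approximations.\<close>

lemma lipN_totally_bounded:
  assumes w: "\<And>k. 0 < w k" "decseq w" "w \<longlonglongrightarrow> 0" and d: "\<delta> > 0"
  shows "\<exists>\<Psi> :: ((nat \<Rightarrow> real) \<Rightarrow> real) \<Rightarrow> (nat \<Rightarrow> real) \<Rightarrow> int. finite (\<Psi> ` lipN w) \<and>
    (\<forall>f\<in>lipN w. \<forall>h\<in>lipN w. \<Psi> f = \<Psi> h \<longrightarrow> (\<exists>c. measure GN {x. \<bar>f x - h x - c\<bar> > \<delta>} \<le> \<delta>))"
proof -
  \<comment> \<open>One fifth each for approximating \<open>f\<close> and \<open>h\<close>, and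
    three fifths for comparing their approximations.\<close>
  define e where "e = \<delta> / 5"
  have e: "e > 0" using d by (simp add: e_def)
  have w0: "0 \<le> w k" for k using w(1)[of k] by simp
  obtain L0 where L0: "L0 > 0" "\<And>L. 0 < L \<Longrightarrow> L \<le> L0 \<Longrightarrow> 3 * exp (- (e\<^sup>2 / (16 * L))) \<le> e"
    using exp_neg_square_small[OF e e] by blast
  have "\<forall>\<^sub>F n in sequentially. w n < L0" using w(3) L0 by (intro order_tendstoD(2)) auto
  then obtain n where n: "w n < L0" by (auto simp: eventually_sequentially)
  have dec: "w k \<le> w n" if "n \<le> k" for k using w(2) that by (auto simp: decseq_def)
  have ex: "\<exists>g\<in>cyl n w. measure GN {x. \<bar>f x - g x\<bar> > e} \<le> e" if "f \<in> lipN w" for f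
    using lipN_cyl_approx[where w=w and n=n and L="w n" and \<epsilon>=e, OF w0 dec w(1) e that] L0(2)[OF w(1)[of n]] n
    by (meson less_imp_le order_trans)
  define G where "G = (\<lambda>f. SOME g. g \<in> cyl n w \<and> measure GN {x. \<bar>f x - g x\<bar> > e} \<le> e)"
  have G: "G f \<in> cyl n w" "measure GN {x. \<bar>f x - G f x\<bar> > e} \<le> e" if "f \<in> lipN w" for f
    using someI_ex[of "\<lambda>g. g \<in> cyl n w \<and> measure GN {x. \<bar>f x - g x\<bar> > e} \<le> e"] ex[OF that]
    unfolding G_def by blast+
  obtain \<Psi> :: "((nat \<Rightarrow> real) \<Rightarrow> real) \<Rightarrow> (nat \<Rightarrow> real) \<Rightarrow> int" where fin: "finite (\<Psi> ` cyl n w)"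
    and \<Psi>: "\<And>g h. g \<in> cyl n w \<Longrightarrow> h \<in> cyl n w \<Longrightarrow> \<Psi> g = \<Psi> h \<Longrightarrow> \<exists>c. measure GN {x. \<bar>g x - h x - c\<bar> > 3 * e} \<le> e"
    using cyl_totally_bounded[where w=w and \<delta>=e and n=n, OF w0 e] by blast
  have "finite ((\<lambda>f. \<Psi> (G f)) ` lipN w)"
    by (rule finite_subset[OF _ fin]) (use G in auto)
  moreover have "\<exists>c. measure GN {x. \<bar>f x - h x - c\<bar> > \<delta>} \<le> \<delta>"
    if f: "f \<in> lipN w" and h: "h \<in> lipN w" and eq: "\<Psi> (G f) = \<Psi> (G h)" for f h
  proof -
    obtain c where c: "measure GN {x. \<bar>G f x - G h x - c\<bar> > 3 * e} \<le> e"
      using \<Psi>[OF G(1)[OF f] G(1)[OF h] eq] by blast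
    have [measurable]: "f \<in> borel_measurable borel" "h \<in> borel_measurable borel"
      "G f \<in> borel_measurable borel" "G h \<in> borel_measurable borel"
      using f h G(1)[OF f] G(1)[OF h] by (auto simp: lipN_def cyl_measurable)
    have "measure GN {x. \<bar>f x - h x - c\<bar> > \<delta>} \<le>
      measure GN (({x. \<bar>f x - G f x\<bar> > e} \<union> {x. \<bar>h x - G h x\<bar> > e}) \<union> {x. \<bar>G f x - G h x - c\<bar> > 3 * e})"
    proof (rule GN.finite_measure_mono)
      have "\<bar>f x - h x - c\<bar> \<le> \<bar>f x - G f x\<bar> + \<bar>h x - G h x\<bar> + \<bar>G f x - G h x - c\<bar>" for x
        by linarith
      moreover have "\<delta> = 5 * e" by (simp add: e_def)
      ultimately show "{x. \<bar>f x - h x - c\<bar> > \<delta>} \<subseteq>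
          ({x. \<bar>f x - G f x\<bar> > e} \<union> {x. \<bar>h x - G h x\<bar> > e}) \<union> {x. \<bar>G f x - G h x - c\<bar> > 3 * e}"
        by (intro subsetI, unfold Un_iff mem_Collect_eq) (smt (verit))
    qed auto
    also have "\<dots> \<le> measure GN ({x. \<bar>f x - G f x\<bar> > e} \<union> {x. \<bar>h x - G h x\<bar> > e}) + measure GN {x. \<bar>G f x - G h x - c\<bar> > 3 * e}"
      by (rule measure_Un_le) auto
    also have "measure GN ({x. \<bar>f x - G f x\<bar> > e} \<union> {x. \<bar>h x - G h x\<bar> > e}) \<le>
       measure GN {x. \<bar>f x - G f x\<bar> > e} + measure GN {x. \<bar>h x - G h x\<bar> > e}"
      by (rule measure_Un_le) auto
    finally have "measure GN {x. \<bar>f x - h x - c\<bar> > \<delta>} \<le> \<delta>"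
      using c G(2)[OF f] G(2)[OF h] e unfolding e_def by linarith
    then show ?thesis by blast
  qed
  ultimately show ?thesis by (intro exI[of _ "\<lambda>f. \<Psi> (G f)"]) auto
qed

text \<open>A function of \<open>n\<close> coordinates is made Lipschitz for the smaller weights \<open>wa\<close> by contracting it
  towards the constant \<open>m\<close> around which it concentrates.\<close>

lemma lipN_rescale:
  assumes wb: "\<And>k. 0 < wb k" "decseq wb" and wa: "\<And>k. 0 < wa k"
    and b0: "wb 0 \<le> 1" and e: "0 < e" and bn: "3 * exp (- (e\<^sup>2 / (16 * wb n))) \<le> e"
    and R: "R > 0" "3 * exp (- (R\<^sup>2 / 16)) \<le> e"
    and q: "1 \<le> q" "\<And>k. k < n \<Longrightarrow> wb k \<le> q\<^sup>2 * wa k" "(1 - 1 / q) * R \<le> e"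
    and f: "f \<in> lipN wb"
  shows "\<exists>h\<in>lipN wa. measure GN {x. \<bar>f x - h x\<bar> > 2 * e} \<le> 2 * e"
proof -
  have wb0: "0 \<le> wb k" for k using wb(1)[of k] by simp
  have dec: "wb k \<le> wb n" if "n \<le> k" for k n using wb(2) that by (auto simp: decseq_def)
  obtain g where g: "g \<in> cyl n wb" "measure GN {x. \<bar>f x - g x\<bar> > e} \<le> e"
    using lipN_cyl_approx[where w=wb and n=n and L="wb n" and \<epsilon>=e, OF wb0 dec wb(1) e f] bn by force
  have dec1: "wb k \<le> 1" for k using dec[of 0 k] b0 by simp
  \<comment> \<open>With no coordinates left the approximating function is constant. As all weights
    are at most 1, taking \<open>L = 1\<close> shows that \<open>g\<close> stays within
    \<open>R\<close> of this constant up to probability \<open>e\<close>.\<close>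
  obtain g1 where g1: "g1 \<in> cyl 0 wb" "measure GN {x. \<bar>g x - g1 x\<bar> > R} \<le> e"
    using lipN_cyl_approx[where w=wb and n=0 and L=1 and \<epsilon>=R, OF wb0 dec1 _ R(1) cyl_lipN[OF g(1)]] R(2) by force
  define m where "m = g1 (\<lambda>_. 0)"
  have "g1 x = m" for x
    using g1(1) unfolding cyl_def m_def wdn_def by (auto dest: spec[of _ x])
  then have m: "measure GN {x. \<bar>g x - m\<bar> > R} \<le> e" using g1(2) by simp
  define h where "h = (\<lambda>x. m + (g x - m) / q)"
  have q0: "q > 0" using q by simp
  have hc: "h \<in> cyl n wa"
    unfolding cyl_def
  proof (clarify)
    fix x y
    have "\<bar>h x - h y\<bar> = \<bar>g x - g y\<bar> / q"
      using q0 by (simp add: h_def diff_divide_distrib[symmetric] abs_divide)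
    also have "\<dots> \<le> wdn wb n x y / q"
      using g(1) q0 by (intro divide_right_mono) (auto simp: cyl_def)
    also have "\<dots> \<le> (q * wdn wa n x y) / q"
    proof (rule divide_right_mono)
      have "(\<Sum>k<n. wb k * (x k - y k)\<^sup>2) \<le> (\<Sum>k<n. q\<^sup>2 * wa k * (x k - y k)\<^sup>2)"
        by (intro sum_mono mult_right_mono q(2)) auto
      also have "\<dots> = q\<^sup>2 * (\<Sum>k<n. wa k * (x k - y k)\<^sup>2)" by (simp add: sum_distrib_left mult.assoc)
      finally have "sqrt (\<Sum>k<n. wb k * (x k - y k)\<^sup>2) \<le> sqrt (q\<^sup>2 * (\<Sum>k<n. wa k * (x k - y k)\<^sup>2))"
        by (rule real_sqrt_le_mono)
      then show "wdn wb n x y \<le> q * wdn wa n x y"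
        using q0 unfolding wdn_def by (simp add: real_sqrt_mult)
    qed (use q0 in simp)
    finally show "\<bar>h x - h y\<bar> \<le> wdn wa n x y" using q0 by simp
  qed
  have [measurable]: "f \<in> borel_measurable borel" "g \<in> borel_measurable borel" "h \<in> borel_measurable borel"
    using f cyl_measurable[OF g(1)] cyl_measurable[OF hc] by (auto simp: lipN_def)
  have "measure GN {x. \<bar>f x - h x\<bar> > 2 * e} \<le> measure GN ({x. \<bar>f x - g x\<bar> > e} \<union> {x. \<bar>g x - m\<bar> > R})"
  proof (rule GN.finite_measure_mono)
    show "{x. \<bar>f x - h x\<bar> > 2 * e} \<subseteq> {x. \<bar>f x - g x\<bar> > e} \<union> {x. \<bar>g x - m\<bar> > R}"
    proof (rule subsetI, rule ccontr)
      fix x assume x: "x \<in> {x. \<bar>f x - h x\<bar> > 2 * e}" and n: "x \<notin> {x. \<bar>f x - g x\<bar> > e} \<union> {x. \<bar>g x - m\<bar> > R}"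
      have "g x - h x = (1 - 1 / q) * (g x - m)" using q0 by (simp add: h_def field_simps)
      then have "\<bar>g x - h x\<bar> = (1 - 1 / q) * \<bar>g x - m\<bar>" using q by (simp add: abs_mult)
      also have "\<dots> \<le> (1 - 1 / q) * R" using q n by (intro mult_left_mono) auto
      finally have "\<bar>g x - h x\<bar> \<le> e" using q(3) by linarith
      then show False using x n by auto
    qed
  qed auto
  also have "\<dots> \<le> measure GN {x. \<bar>f x - g x\<bar> > e} + measure GN {x. \<bar>g x - m\<bar> > R}"
    by (rule measure_Un_le) auto
  finally have "measure GN {x. \<bar>f x - h x\<bar> > 2 * e} \<le> 2 * e" using m g(2) by linarith
  then show ?thesis using cyl_lipN[OF hc] by blast
qed

section \<open>Lipschitz classes of an emm-space\<close>

lemma L0_class_self: "f \<in> borel_measurable M \<Longrightarrow> f \<in> L0_class M f"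
  by (simp add: L0_class_def)

lemma L0_class_eqI: "AE x in M. f x = g x \<Longrightarrow> L0_class M f = L0_class M g"
  unfolding L0_class_def by (auto elim: eventually_elim2)

lemma L0_class_eq: "g \<in> L0_class M f \<Longrightarrow> L0_class M g = L0_class M f"
  by (rule L0_class_eqI) (simp add: L0_class_def)

definition lip_functions :: "'a emm \<Rightarrow> ('a \<Rightarrow> real) set" where
  "lip_functions X = {f \<in> borel_measurable (meas X). \<exists>E\<in>sets (meas X). measure (meas X) E = 1 \<and>
     (\<forall>x\<in>E. \<forall>y\<in>E. ennreal \<bar>f x - f y\<bar> \<le> edist X x y)}"

lemma Lip1_eq: "Lip1 X = L0_class (meas X) ` lip_functions X"
proof (rule set_eqI, rule iffI)
  fix u assume "u \<in> Lip1 X"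
  then obtain f f0 where u: "u = L0_class (meas X) f0" and fu: "f \<in> u"
    and f: "\<exists>E\<in>sets (meas X). measure (meas X) E = 1 \<and>
       (\<forall>x\<in>E. \<forall>y\<in>E. ennreal \<bar>f x - f y\<bar> \<le> edist X x y)"
    unfolding Lip1_def L0_def by blast
  have "f \<in> lip_functions X" using f fu by (simp add: lip_functions_def u L0_class_def)
  moreover have "u = L0_class (meas X) f" using L0_class_eq[of f] fu by (simp add: u)
  ultimately show "u \<in> L0_class (meas X) ` lip_functions X" by blast
next
  fix u assume "u \<in> L0_class (meas X) ` lip_functions X"
  then show "u \<in> Lip1 X"
    by (auto simp: Lip1_def L0_def lip_functions_def intro!: bexI[OF _ L0_class_self])
qed

lemma L0_class_add_const:
  "(\<lambda>h x. h x + (c :: real)) ` L0_class M f = L0_class M (\<lambda>x. f x + c)"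
proof (rule set_eqI, rule iffI)
  fix g assume "g \<in> L0_class M (\<lambda>x. f x + c)"
  then have "(\<lambda>x. g x - c) \<in> L0_class M f" by (auto simp: L0_class_def elim: eventually_mono)
  then show "g \<in> (\<lambda>h x. h x + c) ` L0_class M f" by (rule rev_image_eqI) auto
qed (auto simp: L0_class_def elim: eventually_mono)

lemma const_orbit_L0_class: "const_orbit (L0_class M f) = range (\<lambda>c. L0_class M (\<lambda>x. f x + c))"
  by (simp add: const_orbit_def L0_class_add_const)

text \<open>A strict upper bound on the infimum is equivalent to a witness, and changing
  representatives on null sets leaves the measures unchanged. Strict bounds are therefore the form
  in which the distance is used throughout.\<close>

lemma L0_dist_class_less:
  assumes f [measurable]: "f \<in> borel_measurable M" and g [measurable]: "g \<in> borel_measurable M"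
  shows "L0_dist M (L0_class M f) (L0_class M g) < ennreal e \<longleftrightarrow>
    (\<exists>\<epsilon>>0. \<epsilon> < e \<and> measure M {x \<in> space M. \<bar>f x - g x\<bar> > \<epsilon>} \<le> \<epsilon>)" (is "?L \<longleftrightarrow> ?R")
proof
  assume ?L
  then obtain \<epsilon> f' g' where e: "\<epsilon> > 0" "ennreal \<epsilon> < ennreal e" and f': "f' \<in> L0_class M f" and g': "g' \<in> L0_class M g"
    and le: "measure M {x \<in> space M. \<bar>f' x - g' x\<bar> > \<epsilon>} \<le> \<epsilon>"
    unfolding L0_dist_def INF_less_iff by blast
  have [measurable]: "f' \<in> borel_measurable M" "g' \<in> borel_measurable M"
    and AE: "AE x in M. f' x = f x" "AE x in M. g' x = g x"
    using f' g' by (auto simp: L0_class_def)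
  have "measure M {x \<in> space M. \<bar>f' x - g' x\<bar> > \<epsilon>} = measure M {x \<in> space M. \<bar>f x - g x\<bar> > \<epsilon>}"
  proof (rule measure_eq_AE)
    show "AE x in M. (x \<in> {x \<in> space M. \<bar>f' x - g' x\<bar> > \<epsilon>}) = (x \<in> {x \<in> space M. \<bar>f x - g x\<bar> > \<epsilon>})"
      using AE by eventually_elim simp
  qed measurable
  then show ?R using e le by (auto simp: ennreal_less_iff intro!: exI[of _ \<epsilon>])
next
  assume ?R
  then obtain \<epsilon> where e: "\<epsilon> > 0" "\<epsilon> < e" "measure M {x \<in> space M. \<bar>f x - g x\<bar> > \<epsilon>} \<le> \<epsilon>" by blast
  then show ?L
    unfolding L0_dist_def INF_less_iff using L0_class_self[OF f] L0_class_self[OF g]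
    by (intro bexI[of _ \<epsilon>]) (auto simp: ennreal_less_iff)
qed

text \<open>The open ball of the quotient metric in terms of representatives: of the shifts of the
  two functions only the difference matters, hence the single constant \<open>c\<close>.\<close>

definition close_mod_const :: "'a measure \<Rightarrow> real \<Rightarrow> ('a \<Rightarrow> real) \<Rightarrow> ('a \<Rightarrow> real) \<Rightarrow> bool" where
  "close_mod_const M e f g \<longleftrightarrow>
     (\<exists>c. \<exists>\<epsilon>>0. \<epsilon> < e \<and> measure M {x \<in> space M. \<bar>f x - g x - c\<bar> > \<epsilon>} \<le> \<epsilon>)"

lemma quotient_dist_less_iff:
  assumes "prob_space M" and f [measurable]: "f \<in> borel_measurable M" and g [measurable]: "g \<in> borel_measurable M"
  shows "quotient_dist M (const_orbit (L0_class M f)) (const_orbit (L0_class M g)) < e \<longleftrightarrow>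
    close_mod_const M e f g"
proof -
  interpret prob_space M by fact
  define I where "I = (INF u\<in>const_orbit (L0_class M f). INF v\<in>const_orbit (L0_class M g). L0_dist M u v)"
  have I: "I < ennreal e \<longleftrightarrow> close_mod_const M e f g" for e
  proof -
    have "I < ennreal e \<longleftrightarrow>
      (\<exists>a b. L0_dist M (L0_class M (\<lambda>x. f x + a)) (L0_class M (\<lambda>x. g x + b)) < ennreal e)"
      by (auto simp: I_def INF_less_iff const_orbit_L0_class)
    also have "\<dots> \<longleftrightarrow> (\<exists>a b. \<exists>\<epsilon>>0. \<epsilon> < e \<and> measure M {x \<in> space M. \<bar>(f x + a) - (g x + b)\<bar> > \<epsilon>} \<le> \<epsilon>)"
      by (subst L0_dist_class_less) auto
    also have "\<dots> \<longleftrightarrow> close_mod_const M e f g"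
    proof
      assume "\<exists>a b. \<exists>\<epsilon>>0. \<epsilon> < e \<and> measure M {x \<in> space M. \<bar>(f x + a) - (g x + b)\<bar> > \<epsilon>} \<le> \<epsilon>"
      then obtain a b \<epsilon> where "\<epsilon>>0" "\<epsilon> < e" "measure M {x \<in> space M. \<bar>(f x + a) - (g x + b)\<bar> > \<epsilon>} \<le> \<epsilon>" by blast
      then show "close_mod_const M e f g"
        unfolding close_mod_const_def by (intro exI[of _ "b - a"] exI[of _ \<epsilon>]) (simp add: algebra_simps)
    next
      assume "close_mod_const M e f g"
      then obtain c \<epsilon> where "\<epsilon>>0" "\<epsilon> < e" "measure M {x \<in> space M. \<bar>f x - g x - c\<bar> > \<epsilon>} \<le> \<epsilon>"
        unfolding close_mod_const_def by blast
      then show "\<exists>a b. \<exists>\<epsilon>>0. \<epsilon> < e \<and> measure M {x \<in> space M. \<bar>(f x + a) - (g x + b)\<bar> > \<epsilon>} \<le> \<epsilon>"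
        by (intro exI[of _ 0] exI[of _ c] exI[of _ \<epsilon>]) (simp add: diff_diff_eq)
    qed
    finally show ?thesis .
  qed
  \<comment> \<open>Any two functions are at distance less than 2 because probabilities are at most
    1. The infimum is therefore finite, and \<open>enn2real\<close> loses nothing.\<close>
  have "close_mod_const M 2 f g"
    unfolding close_mod_const_def by (intro exI[of _ 0] exI[of _ 1]) auto
  then have "I < \<top>" using I[of 2] less_trans ennreal_less_top by blast
  then have "enn2real I < e \<longleftrightarrow> I < ennreal e"
    by (cases I) (auto simp: ennreal_less_iff)
  then show ?thesis using I by (simp add: quotient_dist_def I_def)
qed

lemma close_mod_const_self: "e > 0 \<Longrightarrow> close_mod_const M e f f"
  unfolding close_mod_const_def by (intro exI[of _ 0] exI[of _ "e/2"]) auto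

lemma close_mod_const_trans:
  assumes "prob_space M" and [measurable]: "f \<in> borel_measurable M" "g \<in> borel_measurable M" "h \<in> borel_measurable M"
    and "close_mod_const M a f g" "close_mod_const M b g h"
  shows "close_mod_const M (a + b) f h"
proof -
  interpret prob_space M by fact
  obtain c \<epsilon> where 1: "\<epsilon> > 0" "\<epsilon> < a" "measure M {x \<in> space M. \<bar>f x - g x - c\<bar> > \<epsilon>} \<le> \<epsilon>"
    using assms unfolding close_mod_const_def by blast
  obtain c' \<epsilon>' where 2: "\<epsilon>' > 0" "\<epsilon>' < b" "measure M {x \<in> space M. \<bar>g x - h x - c'\<bar> > \<epsilon>'} \<le> \<epsilon>'"
    using assms unfolding close_mod_const_def by blast
  have "measure M {x \<in> space M. \<bar>f x - h x - (c + c')\<bar> > \<epsilon> + \<epsilon>'} \<le>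
      measure M ({x \<in> space M. \<bar>f x - g x - c\<bar> > \<epsilon>} \<union> {x \<in> space M. \<bar>g x - h x - c'\<bar> > \<epsilon>'})"
  proof (rule finite_measure_mono)
    show "{x \<in> space M. \<bar>f x - h x - (c + c')\<bar> > \<epsilon> + \<epsilon>'} \<subseteq>
      {x \<in> space M. \<bar>f x - g x - c\<bar> > \<epsilon>} \<union> {x \<in> space M. \<bar>g x - h x - c'\<bar> > \<epsilon>'}"
    proof
      fix x assume x: "x \<in> {x \<in> space M. \<bar>f x - h x - (c + c')\<bar> > \<epsilon> + \<epsilon>'}"
      have "\<bar>f x - h x - (c + c')\<bar> \<le> \<bar>f x - g x - c\<bar> + \<bar>g x - h x - c'\<bar>" by linarith
      with x show "x \<in> {x \<in> space M. \<bar>f x - g x - c\<bar> > \<epsilon>} \<union> {x \<in> space M. \<bar>g x - h x - c'\<bar> > \<epsilon>'}" by auto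
    qed
  qed measurable
  also have "\<dots> \<le> measure M {x \<in> space M. \<bar>f x - g x - c\<bar> > \<epsilon>} + measure M {x \<in> space M. \<bar>g x - h x - c'\<bar> > \<epsilon>'}"
    by (rule measure_Un_le) measurable
  finally have "measure M {x \<in> space M. \<bar>f x - h x - (c + c')\<bar> > \<epsilon> + \<epsilon>'} \<le> \<epsilon> + \<epsilon>'"
    using 1 2 by linarith
  then show ?thesis unfolding close_mod_const_def
    using 1 2 by (intro exI[of _ "c + c'"] exI[of _ "\<epsilon> + \<epsilon>'"]) auto
qed

text \<open>The constant may vary with the precision. Constants \<open>C e\<close> and
  \<open>C d\<close> with \<open>e + d < 1\<close> differ by at most \<open>e + d\<close>, since
  otherwise the two exceptional sets would cover the whole space. Along a null sequence of
  precisions they form a Cauchy sequence, whose limit is the required constant.\<close>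

lemma close_mod_const_zero:
  assumes "prob_space M" and [measurable]: "f \<in> borel_measurable M" "g \<in> borel_measurable M"
    and close: "\<And>e. e > 0 \<Longrightarrow> close_mod_const M e f g"
  shows "\<exists>c. AE x in M. f x = g x + c"
proof -
  interpret prob_space M by fact
  let ?B = "\<lambda>c e. {x \<in> space M. \<bar>f x - g x - c\<bar> > e}"
  have Bm: "?B c e \<in> sets M" for c e by measurable
  have "\<exists>c. measure M (?B c e) \<le> e" if e0: "e > 0" for e
  proof -
    obtain c \<epsilon> where e: "\<epsilon> > 0" "\<epsilon> < e" "measure M (?B c \<epsilon>) \<le> \<epsilon>"
      using close[OF e0] unfolding close_mod_const_def by blast
    have "measure M (?B c e) \<le> measure M (?B c \<epsilon>)"
      by (rule finite_measure_mono) (use e Bm in auto)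
    then show ?thesis using e by (intro exI[of _ c]) linarith
  qed
  then obtain C where C: "\<And>e. e > 0 \<Longrightarrow> measure M (?B (C e) e) \<le> e" by metis
  have CC: "\<bar>C e - C d\<bar> \<le> e + d" if "e > 0" "d > 0" "e + d < 1" for e d
  proof (rule ccontr)
    assume neg: "\<not> ?thesis"
    have "space M \<subseteq> ?B (C e) e \<union> ?B (C d) d"
    proof
      fix x assume "x \<in> space M"
      moreover have "\<bar>f x - g x - C e\<bar> > e \<or> \<bar>f x - g x - C d\<bar> > d" using neg by linarith
      ultimately show "x \<in> ?B (C e) e \<union> ?B (C d) d" by auto
    qed
    then have "measure M (space M) \<le> measure M (?B (C e) e \<union> ?B (C d) d)"
      by (rule finite_measure_mono) (use Bm in auto)
    also have "\<dots> \<le> measure M (?B (C e) e) + measure M (?B (C d) d)"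
      by (rule measure_Un_le) (rule Bm)+
    also have "\<dots> \<le> e + d" using C that by (intro add_mono) auto
    finally show False using that prob_space by simp
  qed
  \<comment> \<open>Starting at 1/4 keeps the sum of any two terms below 1, as \<open>CC\<close>
    requires.\<close>
  define s where "s = (\<lambda>n. inverse (real (n + 4)))"
  have s: "s n > 0" "s n \<le> 1/4" for n unfolding s_def by (auto simp: field_simps)
  have s0: "s \<longlonglongrightarrow> 0" unfolding s_def by (rule LIMSEQ_ignore_initial_segment[OF lim_inverse_n])
  have "Cauchy (\<lambda>n. C (s n))"
  proof (rule metric_CauchyI)
    fix e :: real assume e: "e > 0"
    have "\<forall>\<^sub>F n in sequentially. s n < e / 2" using s0 e by (intro order_tendstoD(2)) auto
    then obtain N where N: "\<And>n. n \<ge> N \<Longrightarrow> s n < e / 2" by (auto simp: eventually_sequentially)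
    have "dist (C (s m)) (C (s n)) < e" if "m \<ge> N" "n \<ge> N" for m n
      using CC[of "s m" "s n"] s[of m] s[of n] N[OF that(1)] N[OF that(2)] by (auto simp: dist_real_def)
    then show "\<exists>N. \<forall>m\<ge>N. \<forall>n\<ge>N. dist (C (s m)) (C (s n)) < e" by blast
  qed
  then obtain c where c: "(\<lambda>n. C (s n)) \<longlonglongrightarrow> c" using Cauchy_convergent convergent_def by blast
  have cC: "\<bar>c - C (s n)\<bar> \<le> 2 * s n" for n
  proof -
    have "(\<lambda>m. \<bar>C (s m) - C (s n)\<bar>) \<longlonglongrightarrow> \<bar>c - C (s n)\<bar>" by (intro tendsto_intros c)
    moreover have "\<forall>\<^sub>F m in sequentially. s m < s n" using s0 s by (intro order_tendstoD(2)) auto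
    then have "\<forall>\<^sub>F m in sequentially. \<bar>C (s m) - C (s n)\<bar> \<le> 2 * s n"
    proof eventually_elim
      case (elim m)
      then show ?case using CC[of "s m" "s n"] s[of m] s[of n] by linarith
    qed
    ultimately show ?thesis by (rule tendsto_upperbound) simp
  qed
  have small: "measure M (?B c (3 * s n)) \<le> s n" for n
  proof -
    have "measure M (?B c (3 * s n)) \<le> measure M (?B (C (s n)) (s n))"
    proof (rule finite_measure_mono)
      show "?B c (3 * s n) \<subseteq> ?B (C (s n)) (s n)"
      proof safe
        fix x assume "\<bar>f x - g x - c\<bar> > 3 * s n"
        then show "\<bar>f x - g x - C (s n)\<bar> > s n" using cC[of n] by linarith
      qed
    qed (rule Bm)
    then show ?thesis using C[OF s(1)[of n]] by linarith
  qed
  have "AE x in M. \<bar>f x - g x - c\<bar> \<le> e" if e: "e > 0" for e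
  proof -
    have "measure M (?B c e) \<le> 0"
    proof (rule tendsto_lowerbound[OF s0])
      have "\<forall>\<^sub>F n in sequentially. s n < e / 3" using s0 e by (intro order_tendstoD(2)) auto
      then show "\<forall>\<^sub>F n in sequentially. measure M (?B c e) \<le> s n"
      proof eventually_elim
        case (elim n)
        have "measure M (?B c e) \<le> measure M (?B c (3 * s n))"
          by (rule finite_measure_mono) (use elim Bm in auto)
        then show ?case using small[of n] by linarith
      qed
    qed simp
    then have "measure M (?B c e) = 0" by (simp add: measure_le_0_iff)
    then have "AE x in M. x \<notin> ?B c e" using Bm by (simp add: prob_eq_0)
    then show ?thesis using AE_space by eventually_elim auto
  qed
  then have "AE x in M. \<forall>n. \<bar>f x - g x - c\<bar> \<le> s n"
    using s by (subst AE_all_countable) auto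
  then have "AE x in M. f x = g x + c"
  proof eventually_elim
    case (elim x)
    have "\<bar>f x - g x - c\<bar> \<le> 0" by (rule tendsto_lowerbound[OF s0]) (use elim in auto)
    then show ?case by simp
  qed
  then show ?thesis by blast
qed

section \<open>The complete metric space of Lipschitz classes modulo constants\<close>

abbreviation lip_orbit :: "'a emm \<Rightarrow> ('a \<Rightarrow> real) \<Rightarrow> ('a \<Rightarrow> real) set set" where
  "lip_orbit X f \<equiv> const_orbit (L0_class (meas X) f)"

lemma Lip1_mod_const_eq: "Lip1_mod_const X = lip_orbit X ` lip_functions X"
  by (simp add: Lip1_mod_const_def Lip1_eq image_image)

lemma lip_orbit_in: "f \<in> lip_functions X \<Longrightarrow> lip_orbit X f \<in> Lip1_mod_const X"
  by (simp add: Lip1_mod_const_eq)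

lemma lip_functions_measurable: "f \<in> lip_functions X \<Longrightarrow> f \<in> borel_measurable (meas X)"
  by (simp add: lip_functions_def)

lemma Metric_space_Lip1_mod_const:
  assumes M: "prob_space (meas X)"
  shows "Metric_space (Lip1_mod_const X) (quotient_dist (meas X))"
proof
  let ?d = "quotient_dist (meas X)"
  note less = quotient_dist_less_iff[OF M lip_functions_measurable lip_functions_measurable]
  show nonneg: "0 \<le> ?d p q" for p q by (simp add: quotient_dist_def)
  show "?d p q = ?d q p" for p q
  proof -
    have "L0_dist (meas X) u v = L0_dist (meas X) v u" for u v
    proof -
      define P where "P = (\<lambda>\<epsilon> f g. measure (meas X) {x \<in> space (meas X). \<bar>f x - g x\<bar> > \<epsilon>} \<le> (\<epsilon> :: real))"
      have "P \<epsilon> f g = P \<epsilon> g f" for \<epsilon> f g unfolding P_def by (simp only: abs_minus_commute)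
      then have "(\<exists>f\<in>u. \<exists>g\<in>v. P \<epsilon> f g) = (\<exists>f\<in>v. \<exists>g\<in>u. P \<epsilon> f g)" for \<epsilon> by blast
      then show ?thesis unfolding L0_dist_def P_def by simp
    qed
    then show ?thesis unfolding quotient_dist_def by (subst INF_commute) simp
  qed
  show "(?d p q = 0) = (p = q)" if "p \<in> Lip1_mod_const X" "q \<in> Lip1_mod_const X" for p q
  proof -
    obtain f g where fg: "p = lip_orbit X f" "q = lip_orbit X g" "f \<in> lip_functions X" "g \<in> lip_functions X"
      using \<open>p \<in> _\<close> \<open>q \<in> _\<close> by (auto simp: Lip1_mod_const_eq)
    show ?thesis
    proof
      assume "?d p q = 0"
      then have "close_mod_const (meas X) e f g" if "e > 0" for e
        using less[OF fg(3,4), of e] that fg by simp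
      then obtain c where c: "AE x in meas X. f x = g x + c"
        using close_mod_const_zero[OF M lip_functions_measurable[OF fg(3)] lip_functions_measurable[OF fg(4)]] by blast
      have "L0_class (meas X) (\<lambda>x. f x + a) = L0_class (meas X) (\<lambda>x. g x + (a + c))" for a
        by (rule L0_class_eqI) (use c in eventually_elim, simp)
      then have "p = range (\<lambda>a. L0_class (meas X) (\<lambda>x. g x + (a + c)))"
        by (simp add: fg const_orbit_L0_class)
      also have "\<dots> = range (\<lambda>a. L0_class (meas X) (\<lambda>x. g x + a))"
      proof (rule antisym; rule image_subsetI)
        show "L0_class (meas X) (\<lambda>x. g x + a) \<in> range (\<lambda>a. L0_class (meas X) (\<lambda>x. g x + (a + c)))" for a
          by (rule range_eqI[of _ _ "a - c"]) simp
      qed blast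
      finally show "p = q" by (simp add: fg const_orbit_L0_class)
    next
      assume pq: "p = q"
      have "?d p q < e" if "e > 0" for e
        using less[OF fg(3,3), of e] close_mod_const_self[OF that] fg pq by simp
      then show "?d p q = 0"
        using nonneg[of p q] by (cases "?d p q > 0") (blast, simp)
    qed
  qed
  show "?d p r \<le> ?d p q + ?d q r" if pqr: "p \<in> Lip1_mod_const X" "q \<in> Lip1_mod_const X" "r \<in> Lip1_mod_const X" for p q r
  proof -
    obtain f g h where fg: "p = lip_orbit X f" "q = lip_orbit X g" "r = lip_orbit X h"
      "f \<in> lip_functions X" "g \<in> lip_functions X" "h \<in> lip_functions X"
      using pqr unfolding Lip1_mod_const_eq by blast
    show ?thesis
    proof (rule field_le_epsilon)
      fix e :: real assume e: "e > 0"
      have "close_mod_const (meas X) (?d p q + e/2) f g" "close_mod_const (meas X) (?d q r + e/2) g h"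
        using less[OF fg(4,5), of "?d p q + e/2"] less[OF fg(5,6), of "?d q r + e/2"] e fg by auto
      then have "close_mod_const (meas X) ((?d p q + e/2) + (?d q r + e/2)) f h"
        by (rule close_mod_const_trans[OF M lip_functions_measurable[OF fg(4)]
              lip_functions_measurable[OF fg(5)] lip_functions_measurable[OF fg(6)]])
      then show "?d p r \<le> ?d p q + ?d q r + e"
        using less[OF fg(4,6), of "(?d p q + e/2) + (?d q r + e/2)"] fg by simp
    qed
  qed
qed


text \<open>The constants \<open>c n\<close> cancel in differences, so the Lipschitz bound passes to
  the limit on the countable intersection of the full-measure sets of the \<open>f n\<close>,
  restricted to the points of convergence.\<close>

lemma lip_functions_lim:
  assumes M: "prob_space (meas X)" and f: "\<And>n. f n \<in> lip_functions X" and [measurable]: "g \<in> borel_measurable (meas X)"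
    and lim: "AE x in meas X. (\<lambda>n. f n x + c n) \<longlonglongrightarrow> g x"
  shows "g \<in> lip_functions X"
proof -
  interpret prob_space "meas X" by fact
  have [measurable]: "f n \<in> borel_measurable (meas X)" for n by (rule lip_functions_measurable[OF f])
  have "\<forall>n. \<exists>E\<in>sets (meas X). measure (meas X) E = 1 \<and> (\<forall>x\<in>E. \<forall>y\<in>E. ennreal \<bar>f n x - f n y\<bar> \<le> edist X x y)"
    using f by (auto simp: lip_functions_def)
  then obtain E where E: "\<And>n. E n \<in> sets (meas X)" "\<And>n. measure (meas X) (E n) = 1"
    "\<And>n x y. x \<in> E n \<Longrightarrow> y \<in> E n \<Longrightarrow> ennreal \<bar>f n x - f n y\<bar> \<le> edist X x y" by metis
  define E' where "E' = {x \<in> space (meas X). (\<forall>n. x \<in> E n) \<and> (\<lambda>n. f n x + c n) \<longlonglongrightarrow> g x}"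
  note [measurable] = E(1)
  have E'm: "E' \<in> sets (meas X)" unfolding E'_def by measurable
  have "AE x in meas X. x \<in> E n" for n using E(1,2)[of n] by (simp add: prob_eq_1)
  then have "AE x in meas X. \<forall>n. x \<in> E n" by (simp add: AE_all_countable)
  with lim have "AE x in meas X. x \<in> E'"
    using AE_space by eventually_elim (auto simp: E'_def)
  then have E'1: "measure (meas X) E' = 1" using E'm by (simp add: prob_eq_1)
  have "ennreal \<bar>g x - g y\<bar> \<le> edist X x y" if "x \<in> E'" "y \<in> E'" for x y
  proof (rule tendsto_upperbound)
    have "(\<lambda>n. \<bar>(f n x + c n) - (f n y + c n)\<bar>) \<longlonglongrightarrow> \<bar>g x - g y\<bar>"
      using that by (intro tendsto_intros) (auto simp: E'_def)
    then show "(\<lambda>n. ennreal \<bar>f n x - f n y\<bar>) \<longlonglongrightarrow> ennreal \<bar>g x - g y\<bar>"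
      by (intro tendsto_ennrealI) simp
    show "\<forall>\<^sub>F n in sequentially. ennreal \<bar>f n x - f n y\<bar> \<le> edist X x y"
      using that E(3) by (auto simp: E'_def)
  qed simp
  then show ?thesis using E'm E'1 assms(3) unfolding lip_functions_def by blast
qed

lemma AE_tendsto_close_mod_const:
  assumes M: "prob_space M" and [measurable]: "\<And>n. f n \<in> borel_measurable M" "g \<in> borel_measurable M"
    and lim: "AE x in M. (\<lambda>n. f n x + c n) \<longlonglongrightarrow> (g x :: real)" and e: "e > 0"
  shows "\<forall>\<^sub>F n in sequentially. close_mod_const M e (f n) g"
proof -
  interpret prob_space M by fact
  have "(\<lambda>n. \<integral>x. indicator {x \<in> space M. \<bar>f n x - g x - (- c n)\<bar> > e / 2} x \<partial>M) \<longlonglongrightarrow> (\<integral>x. 0 \<partial>M :: real)"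
  proof (rule integral_dominated_convergence[where w="\<lambda>_. 1"])
    show "AE x in M. (\<lambda>n. indicator {x \<in> space M. \<bar>f n x - g x - (- c n)\<bar> > e / 2} x :: real) \<longlonglongrightarrow> 0"
      using lim
    proof eventually_elim
      case (elim x)
      have "\<forall>\<^sub>F n in sequentially. dist (f n x + c n) (g x) < e / 2"
        using elim e by (intro tendstoD) auto
      then have "\<forall>\<^sub>F n in sequentially. (indicator {x \<in> space M. \<bar>f n x - g x - (- c n)\<bar> > e / 2} x :: real) = 0"
      proof eventually_elim
        case (elim n)
        have "\<bar>f n x - g x - (- c n)\<bar> = \<bar>(f n x + c n) - g x\<bar>" by linarith
        then show ?case using elim by (simp only: dist_real_def indicator_def) simp
      qed
      then show ?case by (rule tendsto_eventually)
    qed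
  qed auto
  then have "(\<lambda>n. measure M {x \<in> space M. \<bar>f n x - g x - (- c n)\<bar> > e / 2}) \<longlonglongrightarrow> 0"
    by (simp add: Int_absorb2)
  then have "\<forall>\<^sub>F n in sequentially. measure M {x \<in> space M. \<bar>f n x - g x - (- c n)\<bar> > e / 2} < e / 2"
    using e by (intro order_tendstoD(2)) auto
  then show ?thesis
  proof eventually_elim
    case (elim n)
    then show ?case unfolding close_mod_const_def
      using e by (intro exI[of _ "- c n"] exI[of _ "e / 2"]) auto
  qed
qed

text \<open>Convergence modulo constants is lifted to functions: along a fast subsequence, suitably
  chosen additive corrections make the representatives converge almost everywhere by
  Borel--Cantelli, and the limit is again Lipschitz.\<close>

lemma mcomplete_Lip1_mod_const:
  assumes M: "prob_space (meas X)"
  shows "Metric_space.mcomplete (Lip1_mod_const X) (quotient_dist (meas X))"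
proof -
  interpret Metric_space "Lip1_mod_const X" "quotient_dist (meas X)"
    by (rule Metric_space_Lip1_mod_const[OF M])
  interpret P: prob_space "meas X" by fact
  note less = quotient_dist_less_iff[OF M lip_functions_measurable lip_functions_measurable]
  show ?thesis
    unfolding mcomplete_def
  proof (intro allI impI)
    fix \<sigma> assume \<sigma>: "MCauchy \<sigma>"
    then have "range \<sigma> \<subseteq> Lip1_mod_const X" by (simp add: MCauchy_def)
    then have "\<forall>n. \<exists>f\<in>lip_functions X. \<sigma> n = lip_orbit X f"
      unfolding Lip1_mod_const_eq by blast
    then obtain f where f: "\<And>n. f n \<in> lip_functions X" "\<And>n. \<sigma> n = lip_orbit X (f n)" by metis
    have [measurable]: "f n \<in> borel_measurable (meas X)" for n by (rule lip_functions_measurable[OF f(1)])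
    have "\<forall>j. \<exists>N. \<forall>n n'. N \<le> n \<longrightarrow> N \<le> n' \<longrightarrow> quotient_dist (meas X) (\<sigma> n) (\<sigma> n') < (1/2)^j"
      using \<sigma> by (auto simp: MCauchy_def)
    then obtain N where N: "\<And>j n n'. N j \<le> n \<Longrightarrow> N j \<le> n' \<Longrightarrow> quotient_dist (meas X) (\<sigma> n) (\<sigma> n') < (1/2)^j" by metis
    \<comment> \<open>Summing the thresholds makes \<open>r\<close> dominate each
      \<open>N j\<close>; the added \<open>j\<close> makes it strictly increasing.\<close>
    define r where "r = (\<lambda>j. (\<Sum>i\<le>j. N i) + j)"
    have rmono: "strict_mono r" unfolding r_def by (rule strict_monoI_Suc) simp
    have Nr: "N j \<le> r j" for j
    proof -
      have "N j \<le> (\<Sum>i\<le>j. N i)" by (rule member_le_sum) auto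
      then show ?thesis by (simp add: r_def)
    qed
    have close: "close_mod_const (meas X) ((1/2)^j) (f (r (Suc j))) (f (r j))" for j
    proof -
      have "N j \<le> r (Suc j)" using Nr[of j] rmono by (meson le_trans less_imp_le lessI strict_monoD)
      from N[OF this Nr[of j]] show ?thesis
        using less[OF f(1) f(1), of "r (Suc j)" "r j"] by (simp add: f(2))
    qed
    have "\<forall>j. \<exists>c. measure (meas X) {x \<in> space (meas X). \<bar>f (r (Suc j)) x - f (r j) x - c\<bar> > (1/2)^j} \<le> (1/2)^j"
    proof
      fix j
      obtain c \<epsilon> where c: "\<epsilon> > 0" "\<epsilon> < (1/2)^j"
        "measure (meas X) {x \<in> space (meas X). \<bar>f (r (Suc j)) x - f (r j) x - c\<bar> > \<epsilon>} \<le> \<epsilon>"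
        using close[of j] unfolding close_mod_const_def by blast
      have "measure (meas X) {x \<in> space (meas X). \<bar>f (r (Suc j)) x - f (r j) x - c\<bar> > (1/2)^j} \<le>
        measure (meas X) {x \<in> space (meas X). \<bar>f (r (Suc j)) x - f (r j) x - c\<bar> > \<epsilon>}"
        by (rule P.finite_measure_mono) (use c(2) in auto)
      then show "\<exists>c. measure (meas X) {x \<in> space (meas X). \<bar>f (r (Suc j)) x - f (r j) x - c\<bar> > (1/2)^j} \<le> (1/2)^j"
        using c by (intro exI[of _ c]) linarith
    qed
    then obtain c where c: "\<And>j. measure (meas X) {x \<in> space (meas X). \<bar>f (r (Suc j)) x - f (r j) x - c j\<bar> > (1/2)^j} \<le> (1/2)^j"
      by metis
    \<comment> \<open>The accumulated corrections turn closeness of consecutive terms modulo a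
      constant into genuine closeness of the \<open>h j\<close>.\<close>
    define C where "C = (\<lambda>j. - (\<Sum>i<j. c i))"
    define h where "h = (\<lambda>j x. f (r j) x + C j)"
    have hm [measurable]: "h j \<in> borel_measurable (meas X)" for j unfolding h_def by measurable
    let ?A = "\<lambda>j. {x \<in> space (meas X). \<bar>h (Suc j) x - h j x\<bar> > (1/2)^j}"
    have hd: "h (Suc j) x - h j x = f (r (Suc j)) x - f (r j) x - c j" for j x
      by (simp add: h_def C_def)
    have "AE x in meas X. \<forall>\<^sub>F j in sequentially. x \<in> space (meas X) - ?A j"
    proof (rule borel_cantelli_AE1)
      show "summable (\<lambda>j. measure (meas X) (?A j))"
        by (rule summable_comparison_test'[OF summable_geometric[of "1/2 :: real"], where N=0])
           (use c in \<open>auto simp: hd\<close>)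
    qed (auto simp: P.emeasure_eq_measure)
    then have conv: "AE x in meas X. convergent (\<lambda>j. h j x)"
    proof eventually_elim
      case (elim x)
      then have "\<forall>\<^sub>F j in sequentially. norm (h (Suc j) x - h j x) \<le> (1/2)^j"
        by eventually_elim auto
      then have "summable (\<lambda>j. h (Suc j) x - h j x)"
        by (rule summable_comparison_test_ev) (simp add: summable_geometric)
      then have "convergent (\<lambda>n. \<Sum>j<n. (h (Suc j) x - h j x))"
        by (simp add: summable_iff_convergent)
      then have "convergent (\<lambda>n. h n x - h 0 x)" by (simp only: sum_lessThan_telescope[of "\<lambda>j. h j x"])
      then show ?case by (simp add: convergent_diff_const_right_iff)
    qed
    define g where "g = (\<lambda>x. lim (\<lambda>j. h j x))"
    have gm [measurable]: "g \<in> borel_measurable (meas X)" unfolding g_def by measurable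
    have lim: "AE x in meas X. (\<lambda>j. f (r j) x + C j) \<longlonglongrightarrow> g x"
      using conv by eventually_elim (simp add: g_def h_def convergent_LIMSEQ_iff)
    have gl: "g \<in> lip_functions X"
      by (rule lip_functions_lim[OF M f(1) gm lim])
    have "limitin mtopology (\<sigma> \<circ> r) (lip_orbit X g) sequentially"
      unfolding limitin_metric
    proof (intro conjI allI impI)
      show "lip_orbit X g \<in> Lip1_mod_const X" using gl by (rule lip_orbit_in)
      fix e :: real assume "e > 0"
      have "\<forall>\<^sub>F n in sequentially. close_mod_const (meas X) e (f (r n)) g"
        by (rule AE_tendsto_close_mod_const[OF M _ gm lim \<open>e > 0\<close>]) measurable
      then show "\<forall>\<^sub>F n in sequentially. (\<sigma> \<circ> r) n \<in> Lip1_mod_const X \<and>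
          quotient_dist (meas X) ((\<sigma> \<circ> r) n) (lip_orbit X g) < e"
        by eventually_elim (use f(1) gl in \<open>simp add: f(2) less lip_orbit_in\<close>)
    qed
    from MCauchy_convergent_subsequence[OF \<sigma> rmono this]
    show "\<exists>x. limitin mtopology \<sigma> x sequentially" by blast
  qed
qed

text \<open>As completeness is automatic, compactness reduces to total boundedness. One
  representative for each colour yields a finite net; colouring at precision \<open>e / 2\<close>
  gives the strict inequality in the balls of radius \<open>e\<close>.\<close>

lemma concentratedI:
  fixes \<Psi> :: "real \<Rightarrow> ('a \<Rightarrow> real) \<Rightarrow> 'c"
  assumes M: "prob_space (meas X)"
    and fin: "\<And>\<delta>. \<delta> > 0 \<Longrightarrow> finite (\<Psi> \<delta> ` lip_functions X)"
    and \<Psi>: "\<And>\<delta> f g. \<delta> > 0 \<Longrightarrow> f \<in> lip_functions X \<Longrightarrow> g \<in> lip_functions X \<Longrightarrow> \<Psi> \<delta> f = \<Psi> \<delta> g \<Longrightarrow>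
      \<exists>c. measure (meas X) {x \<in> space (meas X). \<bar>f x - g x - c\<bar> > \<delta>} \<le> \<delta>"
  shows "concentrated X"
proof -
  interpret Metric_space "Lip1_mod_const X" "quotient_dist (meas X)"
    by (rule Metric_space_Lip1_mod_const[OF M])
  note less = quotient_dist_less_iff[OF M lip_functions_measurable lip_functions_measurable]
  have "mtotally_bounded (Lip1_mod_const X)"
    unfolding mtotally_bounded_def
  proof (intro allI impI)
    fix e :: real assume e: "e > 0"
    define s where "s = (\<lambda>a. SOME f. f \<in> lip_functions X \<and> \<Psi> (e/2) f = a)"
    have s: "s (\<Psi> (e/2) f) \<in> lip_functions X" "\<Psi> (e/2) (s (\<Psi> (e/2) f)) = \<Psi> (e/2) f" if "f \<in> lip_functions X" for f
      using someI[of "\<lambda>g. g \<in> lip_functions X \<and> \<Psi> (e/2) g = \<Psi> (e/2) f" f] that unfolding s_def by auto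
    define K where "K = (\<lambda>a. lip_orbit X (s a)) ` (\<Psi> (e/2) ` lip_functions X)"
    have "finite K" unfolding K_def using fin[of "e/2"] e by simp
    moreover have "K \<subseteq> Lip1_mod_const X" unfolding K_def using lip_orbit_in[OF s(1)] by blast
    moreover have "Lip1_mod_const X \<subseteq> (\<Union>x\<in>K. mball x e)"
    proof
      fix p assume "p \<in> Lip1_mod_const X"
      then obtain f where f: "f \<in> lip_functions X" "p = lip_orbit X f" unfolding Lip1_mod_const_eq by blast
      let ?g = "s (\<Psi> (e/2) f)"
      obtain c where "measure (meas X) {x \<in> space (meas X). \<bar>?g x - f x - c\<bar> > e/2} \<le> e/2"
        using \<Psi>[of "e/2" ?g f] s[OF f(1)] f(1) e by auto
      then have "close_mod_const (meas X) e ?g f"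
        unfolding close_mod_const_def using e by (intro exI[of _ c] exI[of _ "e/2"]) auto
      then have "p \<in> mball (lip_orbit X ?g) e"
        using f s(1)[OF f(1)] by (simp add: in_mball less lip_orbit_in)
      then show "p \<in> (\<Union>x\<in>K. mball x e)" using f(1) by (auto simp: K_def)
    qed
    ultimately show "\<exists>K. finite K \<and> K \<subseteq> Lip1_mod_const X \<and> Lip1_mod_const X \<subseteq> (\<Union>x\<in>K. mball x e)" by blast
  qed
  then show ?thesis
    unfolding concentrated_def
    by (simp add: compact_space_eq_mcomplete_mtotally_bounded mcomplete_Lip1_mod_const[OF M])
qed

lemma not_concentratedI:
  assumes M: "prob_space (meas X)" and f: "\<And>n. f n \<in> lip_functions X" and d: "\<delta> > 0"
    and sep: "\<And>i j c. i \<noteq> (j :: nat) \<Longrightarrow> measure (meas X) {x \<in> space (meas X). \<bar>f i x - f j x - c\<bar> > \<delta>} > \<delta>"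
  shows "\<not> concentrated X"
proof
  assume "concentrated X"
  interpret Metric_space "Lip1_mod_const X" "quotient_dist (meas X)"
    by (rule Metric_space_Lip1_mod_const[OF M])
  interpret P: prob_space "meas X" by fact
  note less = quotient_dist_less_iff[OF M lip_functions_measurable lip_functions_measurable]
  have fm [measurable]: "f n \<in> borel_measurable (meas X)" for n by (rule lip_functions_measurable[OF f])
  have "mtotally_bounded (Lip1_mod_const X)"
    using \<open>concentrated X\<close> unfolding concentrated_def compact_space_eq_mcomplete_mtotally_bounded by blast
  then have "\<forall>\<epsilon>>0. \<exists>K. finite K \<and> K \<subseteq> Lip1_mod_const X \<and> Lip1_mod_const X \<subseteq> (\<Union>x\<in>K. mball x \<epsilon>)"
    by (simp only: mtotally_bounded_def)
  moreover have "\<delta> / 2 > 0" using d by simp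
  ultimately obtain K where K: "finite K" "K \<subseteq> Lip1_mod_const X" "Lip1_mod_const X \<subseteq> (\<Union>x\<in>K. mball x (\<delta> / 2))"
    by meson
  have "\<forall>n. \<exists>p\<in>K. lip_orbit X (f n) \<in> mball p (\<delta> / 2)"
    using K(3) lip_orbit_in[OF f] by blast
  then obtain p where p: "\<And>n. p n \<in> K" "\<And>n. lip_orbit X (f n) \<in> mball (p n) (\<delta> / 2)" by metis
  have "\<not> inj p"
    using K(1) p(1) by (metis finite_imageD finite_subset image_subsetI infinite_UNIV_nat)
  then obtain i j where ij: "i \<noteq> j" "p i = p j" by (auto simp: inj_def)
  have "quotient_dist (meas X) (lip_orbit X (f i)) (lip_orbit X (f j)) < \<delta>"
  proof -
    have "quotient_dist (meas X) (p i) (lip_orbit X (f i)) < \<delta> / 2"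
      "quotient_dist (meas X) (p i) (lip_orbit X (f j)) < \<delta> / 2"
      using p(2)[of i] p(2)[of j] ij(2) by (simp_all add: in_mball)
    moreover have "p i \<in> Lip1_mod_const X" using p(1) K(2) by blast
    then have "quotient_dist (meas X) (lip_orbit X (f i)) (lip_orbit X (f j)) \<le>
        quotient_dist (meas X) (lip_orbit X (f i)) (p i) + quotient_dist (meas X) (p i) (lip_orbit X (f j))"
      by (intro triangle lip_orbit_in f)
    ultimately show ?thesis using commute[of "p i" "lip_orbit X (f i)"] by linarith
  qed
  then have "close_mod_const (meas X) \<delta> (f i) (f j)" using less[OF f f] by simp
  then obtain c \<epsilon> where c: "\<epsilon> > 0" "\<epsilon> < \<delta>" "measure (meas X) {x \<in> space (meas X). \<bar>f i x - f j x - c\<bar> > \<epsilon>} \<le> \<epsilon>"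
    unfolding close_mod_const_def by blast
  have "measure (meas X) {x \<in> space (meas X). \<bar>f i x - f j x - c\<bar> > \<delta>} \<le>
      measure (meas X) {x \<in> space (meas X). \<bar>f i x - f j x - c\<bar> > \<epsilon>}"
    by (rule P.finite_measure_mono) (use c in auto)
  then show False using sep[OF ij(1), of c] c by linarith
qed

text \<open>Both spaces carry the same topology and measure, so a single parameter \<iota> is
  admissible for both. It preserves measure, hence pulling back does not change distances in
  measure, and the Hausdorff distance is estimated on the space itself.\<close>

lemma d_conc_le:
  assumes XY: "topo X = topo Y" "meas X = meas Y" and M: "prob_space (meas X)"
    and sets: "sets (meas X) = sets (borel_of (topo X))" and ne: "parameters X \<noteq> {}" and e: "e > 0"
    and 1: "\<And>f. f \<in> lip_functions X \<Longrightarrow> \<exists>g\<in>lip_functions Y. measure (meas X) {x \<in> space (meas X). \<bar>f x - g x\<bar> > e} \<le> e"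
    and 2: "\<And>g. g \<in> lip_functions Y \<Longrightarrow> \<exists>f\<in>lip_functions X. measure (meas X) {x \<in> space (meas X). \<bar>f x - g x\<bar> > e} \<le> e"
  shows "d_conc X Y \<le> ennreal e"
proof -
  obtain \<iota> where \<iota>: "\<iota> \<in> parameters X" using ne by blast
  then have \<iota>Y: "\<iota> \<in> parameters Y" using XY by (simp add: parameters_def)
  have \<iota>m: "\<iota> \<in> measurable unit_Leb (meas X)" and \<iota>d: "distr unit_Leb (borel_of (topo X)) \<iota> = meas X"
    using \<iota> sets by (auto simp: parameters_def cong: measurable_cong_sets)
  have \<iota>d': "distr unit_Leb (meas X) \<iota> = meas X"
    using \<iota>d by (metis distr_cong sets)
  have dist: "L0_dist unit_Leb (L0_pullback \<iota> (L0_class (meas X) f)) (L0_pullback \<iota> (L0_class (meas X) g)) \<le> ennreal e"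
    if fm [measurable]: "f \<in> borel_measurable (meas X)" and gm [measurable]: "g \<in> borel_measurable (meas X)"
      and le: "measure (meas X) {x \<in> space (meas X). \<bar>f x - g x\<bar> > e} \<le> e" for f g
  proof -
    note [measurable] = \<iota>m
    have "measure (meas X) {x \<in> space (meas X). \<bar>f x - g x\<bar> > e} =
        measure unit_Leb (\<iota> -` {x \<in> space (meas X). \<bar>f x - g x\<bar> > e} \<inter> space unit_Leb)"
      by (subst \<iota>d'[symmetric], subst measure_distr) auto
    also have "\<iota> -` {x \<in> space (meas X). \<bar>f x - g x\<bar> > e} \<inter> space unit_Leb =
        {t \<in> space unit_Leb. \<bar>(f \<circ> \<iota>) t - (g \<circ> \<iota>) t\<bar> > e}"
      using measurable_space[OF \<iota>m] by auto
    finally have le': "measure unit_Leb {t \<in> space unit_Leb. \<bar>(f \<circ> \<iota>) t - (g \<circ> \<iota>) t\<bar> > e} \<le> e"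
      using le by simp
    have fi: "h \<circ> \<iota> \<in> L0_pullback \<iota> (L0_class (meas X) h)" if "h \<in> borel_measurable (meas X)" for h
      unfolding L0_pullback_def using L0_class_self[OF that] L0_class_self[OF measurable_comp[OF \<iota>m that]] by blast
    show ?thesis
      unfolding L0_dist_def by (rule INF_lower) (use e le' fi[OF fm] fi[OF gm] in blast)
  qed
  have "d_conc X Y \<le> hausdorff_dist (L0_dist unit_Leb) (L0_pullback \<iota> ` Lip1 X) (L0_pullback \<iota> ` Lip1 Y)"
    unfolding d_conc_def by (rule INF_lower2[OF \<iota>], rule INF_lower[OF \<iota>Y])
  also have "\<dots> \<le> ennreal e"
    unfolding hausdorff_dist_def
  proof (rule max.boundedI; rule SUP_least)
    fix a assume "a \<in> L0_pullback \<iota> ` Lip1 X"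
    then obtain f where f: "f \<in> lip_functions X" "a = L0_pullback \<iota> (L0_class (meas X) f)"
      by (auto simp: Lip1_eq)
    obtain g where g: "g \<in> lip_functions Y" "measure (meas X) {x \<in> space (meas X). \<bar>f x - g x\<bar> > e} \<le> e"
      using 1[OF f(1)] by blast
    have "L0_dist unit_Leb a (L0_pullback \<iota> (L0_class (meas X) g)) \<le> ennreal e"
      unfolding f(2) by (rule dist) (use f g XY in \<open>auto simp: lip_functions_def\<close>)
    then show "(INF b\<in>L0_pullback \<iota> ` Lip1 Y. L0_dist unit_Leb a b) \<le> ennreal e"
      by (rule INF_lower2[rotated]) (use g XY in \<open>auto simp: Lip1_eq\<close>)
  next
    fix b assume "b \<in> L0_pullback \<iota> ` Lip1 Y"
    then obtain g where g: "g \<in> lip_functions Y" "b = L0_pullback \<iota> (L0_class (meas X) g)"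
      using XY by (auto simp: Lip1_eq)
    obtain f where f: "f \<in> lip_functions X" "measure (meas X) {x \<in> space (meas X). \<bar>f x - g x\<bar> > e} \<le> e"
      using 2[OF g(1)] by blast
    have "L0_dist unit_Leb (L0_pullback \<iota> (L0_class (meas X) f)) b \<le> ennreal e"
      unfolding g(2) by (rule dist) (use f g XY in \<open>auto simp: lip_functions_def\<close>)
    then show "(INF a\<in>L0_pullback \<iota> ` Lip1 X. L0_dist unit_Leb a b) \<le> ennreal e"
      by (rule INF_lower2[rotated]) (use f in \<open>auto simp: Lip1_eq\<close>)
  qed
  finally show ?thesis .
qed

section \<open>Weighted sequence spaces\<close>

lemma ex_ennreal_between_0:
  assumes "0 < (a :: ennreal)" shows "\<exists>e>0. ennreal e < a"
proof (cases a)
  case (real r)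
  then have "0 < r" using assms by simp
  then show ?thesis using real by (intro exI[of _ "r / 2"]) (simp add: ennreal_less_iff)
next
  case top
  then show ?thesis by (intro exI[of _ 1]) simp
qed

lemma wd_le_iff: "0 \<le> R \<Longrightarrow> wd v x y \<le> ennreal R \<longleftrightarrow> (\<forall>m. wdn v m x y \<le> R)"
  unfolding wd_def by (auto simp: SUP_le_iff ennreal_le_iff)

lemma wd_commute: "wd v x y = wd v y x"
  unfolding wd_def by (simp add: wdn_commute)

lemma wd_same [simp]: "wd v x x = 0"
  by (simp add: wd_def)

lemma wd_triangle:
  assumes "\<And>k. 0 \<le> v k"
  shows "wd v x z \<le> wd v x y + wd v y z"
  unfolding wd_def[of v x z]
proof (rule SUP_least)
  fix m
  have "ennreal (wdn v m x z) \<le> ennreal (wdn v m x y + wdn v m y z)"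
    by (intro ennreal_leI wdn_triangle assms)
  also have "\<dots> = ennreal (wdn v m x y) + ennreal (wdn v m y z)"
    using assms by simp
  also have "\<dots> \<le> wd v x y + wd v y z" by (intro add_mono wdn_le_wd)
  finally show "ennreal (wdn v m x z) \<le> wd v x y + wd v y z" .
qed

lemma wd_mono_weight:
  assumes "\<And>k. v k \<le> v' k"
  shows "wd v x y \<le> wd v' x y"
  unfolding wd_def
  by (intro SUP_mono' ennreal_leI) (auto simp: wdn_def intro!: sum_mono mult_right_mono assms)

lemma coord_le_wdn:
  assumes "\<And>k. 0 \<le> v k" "k < m"
  shows "sqrt (v k) * \<bar>x k - y k\<bar> \<le> wdn v m x y"
proof -
  have "v k * (x k - y k)\<^sup>2 \<le> (\<Sum>k<m. v k * (x k - y k)\<^sup>2)"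
    by (rule member_le_sum) (use assms in auto)
  then have "sqrt (v k * (x k - y k)\<^sup>2) \<le> wdn v m x y" unfolding wdn_def by (rule real_sqrt_le_mono)
  then show ?thesis by (simp add: real_sqrt_mult)
qed

lemma coord_le_wd:
  assumes "\<And>k. 0 \<le> v k"
  shows "ennreal (sqrt (v k) * \<bar>x k - y k\<bar>) \<le> wd v x y"
  by (rule order_trans[OF ennreal_leI wdn_le_wd[of v "Suc k"]]) (rule coord_le_wdn, use assms in auto)

lemma wd_eq_0_iff:
  assumes v: "\<And>k. 0 < v k"
  shows "wd v x y = 0 \<longleftrightarrow> x = y"
proof
  assume "wd v x y = 0"
  have "x k = y k" for k
  proof -
    have "ennreal (sqrt (v k) * \<bar>x k - y k\<bar>) \<le> 0"
      using coord_le_wd[where v=v and k=k and x=x and y=y] v \<open>wd v x y = 0\<close> by (simp add: less_imp_le)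
    then have "sqrt (v k) * \<bar>x k - y k\<bar> \<le> 0" by (simp add: ennreal_eq_0_iff)
    then show ?thesis using v[of k] by (auto simp: mult_le_0_iff)
  qed
  then show "x = y" by blast
qed simp

lemma wd_summable:
  assumes v: "\<And>k. 0 \<le> v k"
  shows "wd v x y < \<top> \<longleftrightarrow> summable (\<lambda>k. v k * (x k - y k)\<^sup>2)"
    and "summable (\<lambda>k. v k * (x k - y k)\<^sup>2) \<Longrightarrow> wd v x y = ennreal (sqrt (\<Sum>k. v k * (x k - y k)\<^sup>2))"
proof -
  let ?a = "\<lambda>k. v k * (x k - y k)\<^sup>2"
  have a: "0 \<le> ?a k" for k using v by simp
  show 2: "wd v x y = ennreal (sqrt (\<Sum>k. ?a k))" if s: "summable ?a"
  proof (rule LIMSEQ_unique)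
    have "(\<lambda>m. ennreal (wdn v m x y)) \<longlonglongrightarrow> (SUP m. ennreal (wdn v m x y))"
      by (rule LIMSEQ_SUP) (auto simp: incseq_def intro!: ennreal_leI wdn_mono v)
    then show "(\<lambda>m. ennreal (wdn v m x y)) \<longlonglongrightarrow> wd v x y" by (simp add: wd_def)
    show "(\<lambda>m. ennreal (wdn v m x y)) \<longlonglongrightarrow> ennreal (sqrt (\<Sum>k. ?a k))"
      unfolding wdn_def by (intro tendsto_ennrealI tendsto_real_sqrt summable_LIMSEQ s)
  qed
  have "summable ?a" if fin: "wd v x y < \<top>"
  proof -
    obtain R where R: "wd v x y = ennreal R" "R \<ge> 0" using fin by (cases "wd v x y") auto
    have "wdn v m x y \<le> R" for m using wd_le_iff[OF R(2), of v x y] R(1) by simp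
    then have "(\<Sum>k<m. ?a k) \<le> R\<^sup>2" for m
      unfolding wdn_def by (rule sqrt_le_D)
    then show ?thesis by (intro summableI_nonneg_bounded a)
  qed
  with 2 show "wd v x y < \<top> \<longleftrightarrow> summable ?a" by auto
qed

lemma H_space_diff_iff:
  assumes "\<And>k. 0 < lam k"
  shows "(\<lambda>k. x k - y k) \<in> H_space lam t \<longleftrightarrow> wd (\<lambda>k. lam k powr t) x y < \<top>"
proof -
  have "(\<lambda>k. x k - y k) \<in> H_space lam t \<longleftrightarrow> summable (\<lambda>k. lam k powr t * (x k - y k)\<^sup>2)"
    unfolding H_space_def mem_Collect_eq
    using summable_on_imp_summable summable_nonneg_imp_summable_on[of "\<lambda>k. lam k powr t * (x k - y k)\<^sup>2"] by auto
  then show ?thesis by (simp add: wd_summable(1))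
qed

text \<open>If the series diverges, both sides are 0 by the conventions for \<^const>\<open>infsum\<close> and \<^const>\<open>enn2real\<close>.\<close>

lemma H_norm_diff:
  assumes "\<And>k. 0 < lam k"
  shows "H_norm lam t (\<lambda>k. x k - y k) = enn2real (wd (\<lambda>k. lam k powr t) x y)"
proof (cases "wd (\<lambda>k. lam k powr t) x y < \<top>")
  case True
  then have s: "summable (\<lambda>k. lam k powr t * (x k - y k)\<^sup>2)" by (simp add: wd_summable(1))
  have "((\<lambda>k. lam k powr t * (x k - y k)\<^sup>2) has_sum (\<Sum>k. lam k powr t * (x k - y k)\<^sup>2)) UNIV"
    by (rule sums_nonneg_imp_has_sum) (use s in \<open>auto intro: summable_sums\<close>)
  then have "(\<Sum>\<^sub>\<infinity>k. lam k powr t * (x k - y k)\<^sup>2) = (\<Sum>k. lam k powr t * (x k - y k)\<^sup>2)"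
    by (rule infsumI)
  then show ?thesis
    using s by (simp add: H_norm_def wd_summable(2) suminf_nonneg)
next
  case False
  then have "\<not> (\<lambda>k. lam k powr t * (x k - y k)\<^sup>2) summable_on UNIV"
    using H_space_diff_iff[where lam=lam and x=x and y=y and t=t, OF assms] by (simp add: H_space_def)
  then have "(\<Sum>\<^sub>\<infinity>k. lam k powr t * (x k - y k)\<^sup>2) = 0" by (rule infsum_not_exists)
  then show ?thesis using False by (simp add: H_norm_def top.not_eq_extremum[symmetric])
qed

lemma H_ext_dist_eq:
  assumes "\<And>k. 0 < lam k"
  shows "H_ext_dist lam t x y = wd (\<lambda>k. lam k powr t) x y"
  unfolding H_ext_dist_def H_space_diff_iff[OF assms] H_norm_diff[OF assms]
  by (auto simp: top.not_eq_extremum[symmetric])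

definition l2 :: "(nat \<Rightarrow> real) \<Rightarrow> (nat \<Rightarrow> real) set" where
  "l2 v = {x. wd v x (\<lambda>_. 0) < \<top>}"

definition l2_topology :: "(nat \<Rightarrow> real) \<Rightarrow> (nat \<Rightarrow> real) topology" where
  "l2_topology v = Metric_space.mtopology (l2 v) (\<lambda>x y. enn2real (wd v x y))"

lemma H_topology_eq:
  assumes "\<And>k. 0 < lam k"
  shows "H_topology lam t = l2_topology (\<lambda>k. lam k powr t)"
proof -
  have "H_space lam t = l2 (\<lambda>k. lam k powr t)"
    using H_space_diff_iff[where lam=lam and y="\<lambda>_. 0" and t=t, OF assms] by (auto simp: l2_def)
  then show ?thesis by (simp add: H_topology_def l2_topology_def H_norm_diff[OF assms])
qed

text \<open>The coordinates converge, and the truncated distances pass to the limit under a bound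
  that does not depend on the truncation. The sequences need only be close to each other, not of
  finite norm, so the lemma serves the extended distance as well as the norm.\<close>

lemma wd_complete:
  assumes v: "\<And>k. 0 < v k"
    and C: "\<And>\<epsilon>. \<epsilon> > 0 \<Longrightarrow> \<exists>N. \<forall>m\<ge>N. \<forall>n\<ge>N. wd v (x m) (x n) < \<epsilon>"
  shows "\<exists>y. (\<lambda>n. wd v (x n) y) \<longlonglongrightarrow> 0"
proof -
  have v0: "0 \<le> v k" for k using v[of k] by simp
  have "Cauchy (\<lambda>n. x n k)" for k
  proof (rule metric_CauchyI)
    fix e :: real assume e: "e > 0"
    then have "ennreal (sqrt (v k) * e) > 0" using v[of k] by simp
    then obtain N where N: "\<And>m n. m \<ge> N \<Longrightarrow> n \<ge> N \<Longrightarrow> wd v (x m) (x n) < ennreal (sqrt (v k) * e)"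
      using C by blast
    have "dist (x m k) (x n k) < e" if "m \<ge> N" "n \<ge> N" for m n
    proof -
      have "ennreal (sqrt (v k) * \<bar>x m k - x n k\<bar>) < ennreal (sqrt (v k) * e)"
        by (rule le_less_trans[OF coord_le_wd[OF v0] N[OF that]])
      then have "sqrt (v k) * \<bar>x m k - x n k\<bar> < sqrt (v k) * e"
        by (subst (asm) ennreal_less_iff) (use v0 in auto)
      then show ?thesis using v[of k] by (simp add: dist_real_def)
    qed
    then show "\<exists>N. \<forall>m\<ge>N. \<forall>n\<ge>N. dist (x m k) (x n k) < e" by blast
  qed
  then have "\<forall>k. \<exists>l. (\<lambda>n. x n k) \<longlonglongrightarrow> l" by (simp add: Cauchy_convergent_iff convergent_def)
  then obtain y where y: "\<And>k. (\<lambda>n. x n k) \<longlonglongrightarrow> y k" by metis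
  have "(\<lambda>n. wd v (x n) y) \<longlonglongrightarrow> 0"
  proof (rule order_tendstoI)
    fix a :: ennreal assume "0 < a"
    then obtain e where e: "0 < e" "ennreal e < a"
      using ex_ennreal_between_0 by blast
    obtain N where N: "\<And>m n. m \<ge> N \<Longrightarrow> n \<ge> N \<Longrightarrow> wd v (x m) (x n) < ennreal e"
      using C[of "ennreal e"] e by auto
    have "wd v (x n) y \<le> ennreal e" if n: "n \<ge> N" for n
    proof -
      have "wdn v p (x n) y \<le> e" for p
      proof (rule tendsto_upperbound)
        show "(\<lambda>m. wdn v p (x n) (x m)) \<longlonglongrightarrow> wdn v p (x n) y"
          unfolding wdn_def by (intro tendsto_intros y)
        have "wdn v p (x n) (x m) \<le> e" if "m \<ge> N" for m
          using N[OF n that] wd_le_iff[of e v "x n" "x m"] e by auto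
        then show "\<forall>\<^sub>F m in sequentially. wdn v p (x n) (x m) \<le> e"
          by (auto simp: eventually_sequentially)
      qed simp
      then show ?thesis using e by (subst wd_le_iff) auto
    qed
    then show "\<forall>\<^sub>F n in sequentially. wd v (x n) y < a"
      using e(2) by (auto simp: eventually_sequentially intro: le_less_trans)
  qed simp
  then show ?thesis by blast
qed

lemma measurable_wd [measurable]: "(\<lambda>x. wd v x c) \<in> borel_measurable borel"
  unfolding wd_def wdn_def by measurable

section \<open>Weighted square-summable sequences as a Polish space and as an emm-space\<close>

locale weighted_l2 =
  fixes v :: "nat \<Rightarrow> real"
  assumes pos: "0 < v k"
begin

lemma nonneg: "0 \<le> v k"
  using pos[of k] by simp

lemma wd_fin: "x \<in> l2 v \<Longrightarrow> y \<in> l2 v \<Longrightarrow> wd v x y < \<top>"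
proof -
  assume "x \<in> l2 v" "y \<in> l2 v"
  then have "wd v x (\<lambda>_. 0) + wd v (\<lambda>_. 0) y < \<top>"
    unfolding l2_def by (simp add: wd_commute[of v "\<lambda>_. 0" y])
  then show ?thesis using wd_triangle[of v x y "\<lambda>_. 0"] nonneg le_less_trans by blast
qed

lemma enn2real_wd: "x \<in> l2 v \<Longrightarrow> y \<in> l2 v \<Longrightarrow> ennreal (enn2real (wd v x y)) = wd v x y"
  using wd_fin by (simp add: top.not_eq_extremum[symmetric])

lemma enn2real_wd_less: "x \<in> l2 v \<Longrightarrow> y \<in> l2 v \<Longrightarrow> enn2real (wd v x y) < r \<longleftrightarrow> wd v x y < ennreal r"
  by (metis enn2real_nonneg ennreal_less_iff enn2real_wd)

lemma l2I: "y \<in> l2 v \<Longrightarrow> wd v x y < \<top> \<Longrightarrow> x \<in> l2 v"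
proof -
  assume y: "y \<in> l2 v" and xy: "wd v x y < \<top>"
  have "wd v x y + wd v y (\<lambda>_. 0) < \<top>" using y xy by (simp add: l2_def)
  then show ?thesis using wd_triangle[of v x "\<lambda>_. 0" y] nonneg le_less_trans unfolding l2_def by blast
qed

sublocale MS: Metric_space "l2 v" "\<lambda>x y. enn2real (wd v x y)"
proof
  show "0 \<le> enn2real (wd v x y)" for x y by simp
  show "enn2real (wd v x y) = enn2real (wd v y x)" for x y by (simp add: wd_commute)
  show "(enn2real (wd v x y) = 0) = (x = y)" if "x \<in> l2 v" "y \<in> l2 v" for x y
    using enn2real_wd[OF that] wd_eq_0_iff[of v x y] pos by (metis ennreal_0 enn2real_0)
  show "enn2real (wd v x z) \<le> enn2real (wd v x y) + enn2real (wd v y z)"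
    if "x \<in> l2 v" "y \<in> l2 v" "z \<in> l2 v" for x y z
  proof -
    have "ennreal (enn2real (wd v x z)) \<le> ennreal (enn2real (wd v x y) + enn2real (wd v y z))"
      using wd_triangle[of v x z y] nonneg that by (simp add: enn2real_wd)
    then show ?thesis by (rule ennreal_le_iff[THEN iffD1, rotated]) simp
  qed
qed

lemma topology_eq: "l2_topology v = MS.mtopology"
  by (simp add: l2_topology_def)

lemma topspace_eq [simp]: "topspace (l2_topology v) = l2 v"
  by (simp add: topology_eq)

lemma limitin_iff:
  "limitin (l2_topology v) x y sequentially \<longleftrightarrow>
    y \<in> l2 v \<and> (\<forall>\<^sub>F n in sequentially. x n \<in> l2 v) \<and> (\<lambda>n. wd v (x n) y) \<longlonglongrightarrow> 0"
proof
  assume L: "limitin (l2_topology v) x y sequentially"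
  then have y: "y \<in> l2 v" and ev: "\<And>e. e > 0 \<Longrightarrow> \<forall>\<^sub>F n in sequentially. x n \<in> l2 v \<and> enn2real (wd v (x n) y) < e"
    unfolding topology_eq MS.limitin_metric by auto
  have "(\<lambda>n. wd v (x n) y) \<longlonglongrightarrow> 0"
  proof (rule order_tendstoI)
    fix a :: ennreal assume a: "0 < a"
    then obtain e where e: "0 < e" "ennreal e < a"
      using ex_ennreal_between_0 by blast
    show "\<forall>\<^sub>F n in sequentially. wd v (x n) y < a"
      using ev[OF e(1)] by eventually_elim (use e y enn2real_wd_less in \<open>blast intro: less_trans\<close>)
  qed simp
  then show "y \<in> l2 v \<and> (\<forall>\<^sub>F n in sequentially. x n \<in> l2 v) \<and> (\<lambda>n. wd v (x n) y) \<longlonglongrightarrow> 0"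
    using y ev[of 1] by (auto elim: eventually_mono)
next
  assume R: "y \<in> l2 v \<and> (\<forall>\<^sub>F n in sequentially. x n \<in> l2 v) \<and> (\<lambda>n. wd v (x n) y) \<longlonglongrightarrow> 0"
  show "limitin (l2_topology v) x y sequentially"
    unfolding topology_eq MS.limitin_metric
  proof (intro conjI allI impI)
    show "y \<in> l2 v" using R by blast
    fix e :: real assume "e > 0"
    then have "\<forall>\<^sub>F n in sequentially. wd v (x n) y < ennreal e"
      using R by (intro order_tendstoD(2)) auto
    moreover have "\<forall>\<^sub>F n in sequentially. x n \<in> l2 v" using R by blast
    ultimately show "\<forall>\<^sub>F n in sequentially. x n \<in> l2 v \<and> enn2real (wd v (x n) y) < e"
      by eventually_elim (use R in \<open>simp add: enn2real_wd_less\<close>)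
  qed
qed

lemma mcomplete: "MS.mcomplete"
  unfolding MS.mcomplete_def
proof (intro allI impI)
  fix \<sigma> assume \<sigma>: "MS.MCauchy \<sigma>"
  then have \<sigma>l: "\<sigma> n \<in> l2 v" for n by (auto simp: MS.MCauchy_def)
  have "\<exists>N. \<forall>m\<ge>N. \<forall>n\<ge>N. wd v (\<sigma> m) (\<sigma> n) < \<epsilon>" if e0: "\<epsilon> > 0" for \<epsilon>
  proof -
    obtain e where e: "0 < e" "ennreal e < \<epsilon>"
      using ex_ennreal_between_0[OF e0] by blast
    obtain N where "\<And>m n. N \<le> m \<Longrightarrow> N \<le> n \<Longrightarrow> enn2real (wd v (\<sigma> m) (\<sigma> n)) < e"
      using \<sigma> e unfolding MS.MCauchy_def by blast
    then show ?thesis using e(2) enn2real_wd_less[OF \<sigma>l \<sigma>l] less_trans by blast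
  qed
  from wd_complete[of v \<sigma>, OF pos this] obtain y where y: "(\<lambda>n. wd v (\<sigma> n) y) \<longlonglongrightarrow> 0" by blast
  then have "\<forall>\<^sub>F n in sequentially. wd v (\<sigma> n) y < 1" by (rule order_tendstoD) simp
  then obtain n where "wd v (\<sigma> n) y < 1" by (auto simp: eventually_sequentially)
  then have "wd v y (\<sigma> n) < \<top>" by (simp add: wd_commute less_trans[OF _ ennreal_one_less_top])
  then have "y \<in> l2 v" by (rule l2I[OF \<sigma>l])
  then show "\<exists>x. limitin MS.mtopology \<sigma> x sequentially"
    using y \<sigma>l limitin_iff[of \<sigma> y] unfolding topology_eq by auto
qed

lemma finite_support_l2: "(\<And>k. m \<le> k \<Longrightarrow> x k = 0) \<Longrightarrow> x \<in> l2 v"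
  unfolding l2_def using wd_finite_support[of v m x "\<lambda>_. 0"] nonneg by simp

lemma truncation_tendsto:
  assumes x: "x \<in> l2 v"
  shows "(\<lambda>m. wd v (mix m x (\<lambda>_. 0)) x) \<longlonglongrightarrow> 0"
proof -
  let ?a = "\<lambda>k. v k * (x k)\<^sup>2"
  have s: "summable ?a" using x wd_summable(1)[of v x "\<lambda>_. 0"] nonneg by (simp add: l2_def)
  have eq: "wd v (mix m x (\<lambda>_. 0)) x = ennreal (sqrt (suminf ?a - (\<Sum>k<m. ?a k)))" for m
  proof -
    have f: "(\<lambda>k. v k * (mix m x (\<lambda>_. 0) k - x k)\<^sup>2) = (\<lambda>k. ?a k - (if k < m then ?a k else 0))"
      by (auto simp: mix_def)
    have s2: "(\<lambda>k. if k < m then ?a k else 0) sums (\<Sum>k<m. ?a k)"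
      using sums_If_finite_set[of "{..<m}" ?a] by simp
    have "(\<lambda>k. v k * (mix m x (\<lambda>_. 0) k - x k)\<^sup>2) sums (suminf ?a - (\<Sum>k<m. ?a k))"
      unfolding f by (rule sums_diff[OF summable_sums[OF s] s2])
    then show ?thesis
      using wd_summable(2)[of v "mix m x (\<lambda>_. 0)" x] nonneg by (simp add: sums_iff)
  qed
  have "(\<lambda>m. ennreal (sqrt (suminf ?a - (\<Sum>k<m. ?a k)))) \<longlonglongrightarrow> ennreal (sqrt (suminf ?a - suminf ?a))"
    by (intro tendsto_intros summable_LIMSEQ s)
  then show ?thesis by (simp add: eq)
qed

definition rational_vectors :: "(nat \<Rightarrow> real) set" where
  "rational_vectors = range (\<lambda>l :: rat list. \<lambda>k. if k < length l then of_rat (l ! k) else 0)"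

lemma countable_rational_vectors: "countable rational_vectors"
  unfolding rational_vectors_def by simp

lemma rational_vectors_l2: "rational_vectors \<subseteq> l2 v"
  unfolding rational_vectors_def
proof (rule image_subsetI)
  show "(\<lambda>k. if k < length l then of_rat (l ! k) else 0) \<in> l2 v" for l :: "rat list"
    by (rule finite_support_l2[of "length l"]) simp
qed

lemma rational_vectors_dense:
  assumes x: "x \<in> l2 v" and r: "r > 0"
  shows "\<exists>c\<in>rational_vectors. wd v x c < ennreal r"
proof -
  have "\<forall>\<^sub>F m in sequentially. wd v (mix m x (\<lambda>_. 0)) x < ennreal (r / 4)"
    by (rule order_tendstoD(2)[OF truncation_tendsto[OF x]]) (use r in simp)
  then obtain m where m: "wd v (mix m x (\<lambda>_. 0)) x < ennreal (r / 4)"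
    by (auto simp: eventually_sequentially)
  define W where "W = (\<Sum>k<m. v k)"
  have W: "W \<ge> 0" unfolding W_def by (intro sum_nonneg nonneg)
  define \<eta> where "\<eta> = r / 2 / sqrt (W + 1)"
  have \<eta>: "\<eta> > 0" using r W by (simp add: \<eta>_def)
  have "\<exists>q :: rat. \<bar>x k - of_rat q\<bar> \<le> \<eta>" for k
  proof -
    obtain q where "x k - \<eta> < of_rat q" "of_rat q < x k + \<eta>"
      using of_rat_dense[of "x k - \<eta>" "x k + \<eta>"] \<eta> by auto
    then show ?thesis by (intro exI[of _ q]) auto
  qed
  then obtain q :: "nat \<Rightarrow> rat" where q: "\<And>k. \<bar>x k - of_rat (q k)\<bar> \<le> \<eta>" by metis
  define c where "c = (\<lambda>k. if k < length (map q [0..<m]) then of_rat (map q [0..<m] ! k) else 0 :: real)"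
  have c: "c \<in> rational_vectors" unfolding c_def rational_vectors_def by blast
  have ck: "c k = (if k < m then of_rat (q k) else 0)" for k by (simp add: c_def)
  have "wd v (mix m x (\<lambda>_. 0)) c = ennreal (wdn v m (mix m x (\<lambda>_. 0)) c)"
    by (rule wd_finite_support[OF nonneg]) (simp add: mix_def ck)
  also have "wdn v m (mix m x (\<lambda>_. 0)) c \<le> r / 2"
  proof -
    have "(\<Sum>k<m. v k * (mix m x (\<lambda>_. 0) k - c k)\<^sup>2) \<le> (\<Sum>k<m. v k * \<eta>\<^sup>2)"
      using q \<eta> by (intro sum_mono mult_left_mono nonneg) (auto simp: mix_def ck abs_le_square_iff[symmetric])
    also have "\<dots> = W * \<eta>\<^sup>2" by (simp add: W_def sum_distrib_right)
    also have "\<dots> = (r / 2)\<^sup>2 * (W / (W + 1))" using W by (simp add: \<eta>_def power_divide)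
    also have "\<dots> \<le> (r / 2)\<^sup>2 * 1" using W by (intro mult_left_mono) auto
    finally show ?thesis unfolding wdn_def using r by (intro real_le_lsqrt) (auto simp: power_divide)
  qed
  finally have 2: "wd v (mix m x (\<lambda>_. 0)) c \<le> ennreal (r / 2)" by (simp add: ennreal_leI)
  have "wd v x c \<le> wd v (mix m x (\<lambda>_. 0)) x + wd v (mix m x (\<lambda>_. 0)) c"
    using wd_triangle[of v x c "mix m x (\<lambda>_. 0)"] nonneg by (simp add: wd_commute)
  also have "\<dots> \<le> ennreal (r / 4) + ennreal (r / 2)"
    by (rule add_mono[OF less_imp_le[OF m] 2])
  also have "\<dots> = ennreal (r / 4 + r / 2)" using r by (simp del: ennreal_plus add: ennreal_plus[symmetric])
  also have "\<dots> < ennreal r" using r by (simp add: ennreal_less_iff)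
  finally show ?thesis using c by blast
qed

lemma separable: "separable_space (l2_topology v)"
  unfolding separable_space_def
proof (intro exI conjI)
  show "countable rational_vectors" by (rule countable_rational_vectors)
  show "rational_vectors \<subseteq> topspace (l2_topology v)" by (simp add: rational_vectors_l2)
  have "\<exists>y\<in>rational_vectors. y \<in> MS.mball x r" if xr: "x \<in> l2 v" "r > 0" for x r
  proof -
    obtain c where "c \<in> rational_vectors" "wd v x c < ennreal r" using rational_vectors_dense[OF xr] by blast
    then show ?thesis using xr rational_vectors_l2 by (intro bexI[of _ c]) (auto simp: enn2real_wd_less subset_iff)
  qed
  then show "l2_topology v closure_of rational_vectors = topspace (l2_topology v)"
    unfolding topology_eq MS.metric_closure_of by auto
qed

lemma polish: "polish_topology (l2_topology v)"
  unfolding polish_topology_def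
  using MS.completely_metrizable_space_mtopology[OF mcomplete] separable by (simp add: topology_eq)

lemma continuous_map_id: "continuous_map (l2_topology v) euclidean (\<lambda>x. x)"
proof -
  have "continuous_map (l2_topology v) euclideanreal (\<lambda>x. x k)" for k
  proof -
    have "continuous_map MS.mtopology Met_TC.mtopology (\<lambda>x. x k)"
      unfolding MS.metric_continuous_map[OF Met_TC.Metric_space_axioms]
    proof (intro conjI ballI allI impI)
      fix a and e :: real assume a: "a \<in> l2 v" and e: "e > 0"
      show "\<exists>\<delta>>0. \<forall>x. x \<in> l2 v \<and> enn2real (wd v a x) < \<delta> \<longrightarrow> dist (a k) (x k) < e"
      proof (intro exI[of _ "sqrt (v k) * e"] conjI allI impI)
        show "0 < sqrt (v k) * e" using pos e by simp
        fix x assume "x \<in> l2 v \<and> enn2real (wd v a x) < sqrt (v k) * e"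
        then have "ennreal (sqrt (v k) * \<bar>a k - x k\<bar>) < ennreal (sqrt (v k) * e)"
          using a coord_le_wd[of v k a x] nonneg enn2real_wd_less le_less_trans by blast
        then have "sqrt (v k) * \<bar>a k - x k\<bar> < sqrt (v k) * e"
          by (subst (asm) ennreal_less_iff) (use nonneg in auto)
        then show "dist (a k) (x k) < e" using pos[of k] by (simp add: dist_real_def)
      qed
    qed simp
    then show ?thesis by (simp add: topology_eq)
  qed
  then show ?thesis
    unfolding euclidean_product_topology[symmetric] continuous_map_componentwise_UNIV by blast
qed

lemma measurable_id: "(\<lambda>x. x) \<in> measurable (borel_of (l2_topology v)) borel"
proof (rule borel_measurableI)
  fix S :: "(nat \<Rightarrow> real) set" assume "open S"
  then have "openin (l2_topology v) {x \<in> topspace (l2_topology v). x \<in> S}"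
    using openin_continuous_map_preimage[OF continuous_map_id, of S] by simp
  moreover have "(\<lambda>x. x) -` S \<inter> space (borel_of (l2_topology v)) = {x \<in> topspace (l2_topology v). x \<in> S}"
    by auto
  ultimately show "(\<lambda>x. x) -` S \<inter> space (borel_of (l2_topology v)) \<in> sets (borel_of (l2_topology v))"
    unfolding sets_borel_of by (auto intro: sigma_sets.Basic)
qed

text \<open>Open sets of the norm topology are countable unions of balls with rational centres and
  radii, and the distance to a fixed centre is Borel already for the product topology. Measurability
  into the normed space thus reduces to measurability as a sequence.\<close>

lemma measurable_into_l2:
  assumes F: "F \<in> borel_measurable M" and l2: "\<And>x. x \<in> space M \<Longrightarrow> F x \<in> l2 v"
  shows "F \<in> measurable M (borel_of (l2_topology v))"
proof (rule measurable_sigma_sets[OF sets_borel_of])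
  show "{U. openin (l2_topology v) U} \<subseteq> Pow (topspace (l2_topology v))"
    using openin_subset by blast
  show "F \<in> space M \<rightarrow> topspace (l2_topology v)" using l2 by simp
  fix U assume "U \<in> {U. openin (l2_topology v) U}"
  then have U: "U \<subseteq> l2 v" "\<And>x. x \<in> U \<Longrightarrow> \<exists>r>0. MS.mball x r \<subseteq> U"
    by (auto simp: topology_eq MS.openin_mtopology)
  define I where "I = {(c, q) \<in> rational_vectors \<times> (UNIV :: rat set). MS.mball c (of_rat q) \<subseteq> U}"
  have "countable I"
    unfolding I_def by (rule countable_subset[of _ "rational_vectors \<times> UNIV"]) (auto intro: countable_SIGMA countable_rational_vectors)
  have "F -` U \<inter> space M = (\<Union>(c, q)\<in>I. {x \<in> space M. wd v (F x) c < ennreal (of_rat q)})"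
  proof (intro equalityI subsetI)
    fix x assume x: "x \<in> F -` U \<inter> space M"
    then obtain r where r: "r > 0" "MS.mball (F x) r \<subseteq> U" using U(2) by auto
    obtain q where q: "r / 4 < of_rat q" "of_rat q < r / 2" using of_rat_dense[of "r/4" "r/2"] r by auto
    obtain c where c: "c \<in> rational_vectors" "wd v (F x) c < ennreal (r / 4)"
      using rational_vectors_dense[of "F x" "r / 4"] l2 x r by auto
    have cl: "c \<in> l2 v" using c rational_vectors_l2 by blast
    have dc: "enn2real (wd v (F x) c) < r / 4" using c(2) enn2real_wd_less[OF l2 cl, of x "r / 4"] x by simp
    have "MS.mball c (of_rat q) \<subseteq> MS.mball (F x) r"
      by (rule MS.mball_subset) (use dc q cl l2 x in \<open>auto simp: MS.commute\<close>)
    then have "(c, q) \<in> I" using r c by (auto simp: I_def)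
    moreover have "wd v (F x) c < ennreal (of_rat q)"
      using c(2) q(1) r by (auto intro: less_trans simp: ennreal_less_iff)
    ultimately show "x \<in> (\<Union>(c, q)\<in>I. {x \<in> space M. wd v (F x) c < ennreal (of_rat q)})" using x by auto
  next
    fix x assume "x \<in> (\<Union>(c, q)\<in>I. {x \<in> space M. wd v (F x) c < ennreal (of_rat q)})"
    then obtain c q where cq: "c \<in> rational_vectors" "MS.mball c (of_rat q) \<subseteq> U" "x \<in> space M"
      "wd v (F x) c < ennreal (of_rat q)" by (auto simp: I_def)
    then have "F x \<in> MS.mball c (of_rat q)"
      using rational_vectors_l2 l2[of x] enn2real_wd_less[of c "F x"] by (auto simp: wd_commute[of v c])
    then show "x \<in> F -` U \<inter> space M" using cq by auto
  qed
  also have "\<dots> \<in> sets M"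
    by (rule sets.countable_UN'') (use \<open>countable I\<close> F in auto)
  finally show "F -` U \<inter> space M \<in> sets M" .
qed

text \<open>A sublevel set of the supremum is the intersection of the sublevel sets of the
  truncations, and these are closed because each truncation is continuous in finitely many
  coordinates.\<close>

lemma lsc:
  assumes v': "\<And>k. 0 \<le> v' k"
  shows "lsc_on_square (l2_topology v) (wd v')"
  unfolding lsc_on_square_def
proof
  fix a :: ennreal
  let ?T = "l2_topology v"
  have cl: "closedin (prod_topology ?T ?T) {p \<in> topspace (prod_topology ?T ?T). ennreal (wdn v' m (fst p) (snd p)) \<le> a}" for m
  proof (cases a)
    case (real A)
    have "continuous_map (prod_topology ?T ?T) (prod_topology euclidean euclidean) (\<lambda>p. (fst p, snd p))"
      by (rule continuous_map_pairedI)
         (use continuous_map_compose[OF continuous_map_fst continuous_map_id]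
              continuous_map_compose[OF continuous_map_snd continuous_map_id] in \<open>simp_all add: o_def\<close>)
    then have "continuous_map (prod_topology ?T ?T) euclidean (\<lambda>p. (fst p, snd p))" by simp
    moreover have "continuous_on UNIV (\<lambda>p. wdn v' m (fst p) (snd p))"
      unfolding wdn_def
      by (intro continuous_intros continuous_on_product_then_coordinatewise)
    then have "continuous_map euclidean euclideanreal (\<lambda>p. wdn v' m (fst p) (snd p))" by simp
    ultimately have "continuous_map (prod_topology ?T ?T) euclideanreal ((\<lambda>p. wdn v' m (fst p) (snd p)) \<circ> (\<lambda>p. (fst p, snd p)))"
      by (rule continuous_map_compose)
    then have "closedin (prod_topology ?T ?T) {p \<in> topspace (prod_topology ?T ?T).
        ((\<lambda>p. wdn v' m (fst p) (snd p)) \<circ> (\<lambda>p. (fst p, snd p))) p \<in> {..A}}"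
      by (rule closedin_continuous_map_preimage) auto
    then show ?thesis using real v' by (simp add: ennreal_le_iff)
  next
    case top
    then show ?thesis using closedin_topspace[of "prod_topology ?T ?T"] by simp
  qed
  have "{(x, y). x \<in> topspace ?T \<and> y \<in> topspace ?T \<and> wd v' x y \<le> a} =
      (\<Inter>m. {p \<in> topspace (prod_topology ?T ?T). ennreal (wdn v' m (fst p) (snd p)) \<le> a})"
    by (auto simp: wd_def SUP_le_iff)
  then show "closedin (prod_topology ?T ?T) {(x, y). x \<in> topspace ?T \<and> y \<in> topspace ?T \<and> wd v' x y \<le> a}"
    using cl by (simp only:) (rule closedin_INT, auto)
qed

text \<open>The comparison \<open>wd v x y \<le> wd v' x y\<close> gives both remaining axioms: the
  topology of the extended distance is finer, and limits of sequences that are Cauchy for it stay in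
  \<open>l2 v\<close>. For the Hilbert scale the hypothesis on the weights is
  \<open>s + r \<ge> 0\<close>.\<close>

lemma emm_space_l2:
  assumes v': "\<And>k. v k \<le> v' k" and bp: "borel_prob (l2_topology v) M"
  shows "emm_space \<lparr>topo = l2_topology v, edist = wd v', meas = M\<rparr>"
proof -
  have v'0: "0 < v' k" for k using pos[of k] v'[of k] by linarith
  have v'1: "0 \<le> v' k" for k using v'0[of k] by simp
  have le: "wd v x y \<le> wd v' x y" for x y by (rule wd_mono_weight[OF v'])
  have "ext_distance_on (l2 v) (wd v')"
    unfolding ext_distance_on_def
    by (intro conjI ballI wd_commute wd_triangle wd_eq_0_iff v'0 v'1)
  moreover have "ext_complete_on (l2 v) (wd v')"
    unfolding ext_complete_on_def
  proof (intro allI impI, elim conjE)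
    fix x :: "nat \<Rightarrow> nat \<Rightarrow> real"
    assume x: "\<forall>n. x n \<in> l2 v" and C: "\<forall>\<epsilon>>0. \<exists>N. \<forall>m\<ge>N. \<forall>n\<ge>N. wd v' (x m) (x n) < \<epsilon>"
    obtain y where y: "(\<lambda>n. wd v' (x n) y) \<longlonglongrightarrow> 0"
      using wd_complete[of v' x, OF v'0] C by blast
    then have "\<forall>\<^sub>F n in sequentially. wd v' (x n) y < 1" by (rule order_tendstoD) simp
    then obtain n where "wd v' (x n) y < 1" by (auto simp: eventually_sequentially)
    then have "wd v' (x n) y < \<top>" by (rule less_trans) simp
    then have "wd v y (x n) < \<top>" using le[of "x n" y] by (simp add: wd_commute[of v y] le_less_trans)
    then have "y \<in> l2 v" by (rule l2I[OF x[rule_format]])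
    then show "\<exists>y\<in>l2 v. (\<lambda>n. wd v' (x n) y) \<longlonglongrightarrow> 0" using y by blast
  qed
  moreover have "ext_open (l2 v) (wd v') U" if oU: "openin (l2_topology v) U" for U
    unfolding ext_open_def
  proof (intro conjI ballI)
    show Ul: "U \<subseteq> l2 v" using openin_subset[OF oU] by simp
    fix x assume x: "x \<in> U"
    then obtain r where r: "r > 0" "MS.mball x r \<subseteq> U"
      using oU unfolding topology_eq MS.openin_mtopology by blast
    have "y \<in> U" if "y \<in> l2 v" "wd v' x y < ennreal r" for y
    proof -
      have "wd v x y < ennreal r" using le that(2) by (rule le_less_trans)
      then have "y \<in> MS.mball x r" using that(1) x Ul by (auto simp: enn2real_wd_less)
      then show ?thesis using r by blast
    qed
    then show "\<exists>\<epsilon>>0. \<forall>y\<in>l2 v. wd v' x y < \<epsilon> \<longrightarrow> y \<in> U"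
      using r by (intro exI[of _ "ennreal r"]) auto
  qed
  ultimately show ?thesis
    unfolding emm_space_def using polish lsc[OF v'1] bp by simp
qed

end

section \<open>Existence of parameters\<close>

text \<open>\<open>r m\<close> is the number whose base 3 digits are \<open>b m\<close>,
  \<open>b (Suc m)\<close> and so on. Without the digit 2 it is at most 1/2, hence bounded away from
  1.\<close>

lemma ternary_tail:
  fixes b :: "nat \<Rightarrow> bool"
  defines "r \<equiv> (\<lambda>m. \<Sum>j. if b (j + m) then (1/3 :: real) ^ Suc j else 0)"
  shows "r m = (if b m then 1/3 else 0) + r (Suc m) / 3" "0 \<le> r m" "r m \<le> 1 / 2"
proof -
  have gs: "(\<lambda>j. (1/3 :: real) ^ Suc j) sums (1/2)"
    using sums_mult[OF geometric_sums[of "1/3 :: real"], of "1/3"] by simp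
  have s: "summable (\<lambda>j. if b (j + m) then (1/3 :: real) ^ Suc j else 0)" for m
    by (rule summable_comparison_test'[OF sums_summable[OF gs], of 0]) auto
  have "r m = (\<Sum>j. if b (Suc j + m) then (1/3 :: real) ^ Suc (Suc j) else 0) + (if b m then 1/3 else 0)"
    unfolding r_def using suminf_split_head[OF s[of m]] by simp
  also have "(\<lambda>j. if b (Suc j + m) then (1/3 :: real) ^ Suc (Suc j) else 0) =
      (\<lambda>j. (if b (j + Suc m) then (1/3 :: real) ^ Suc j else 0) / 3)"
    by auto
  also have "suminf \<dots> = r (Suc m) / 3"
    unfolding r_def by (rule suminf_divide[OF s])
  finally show "r m = (if b m then 1/3 else 0) + r (Suc m) / 3" by simp
  show "0 \<le> r m" unfolding r_def by (rule suminf_nonneg[OF s]) auto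
  have "r m \<le> (\<Sum>j. (1/3 :: real) ^ Suc j)"
    unfolding r_def by (rule suminf_le[OF _ s sums_summable[OF gs]]) auto
  then show "r m \<le> 1 / 2" using gs by (simp add: sums_iff)
qed

text \<open>Multiplication by \<open>3 ^ m\<close> moves the first \<open>m\<close> digits into the
  integer part and leaves \<open>r m\<close> as fractional part. This is at least 1/3 if the leading
  digit is 1 and at most 1/6 otherwise.\<close>

lemma ternary_digit:
  fixes b :: "nat \<Rightarrow> bool"
  shows "frac (3 ^ m * (\<Sum>j. if b j then (1/3 :: real) ^ Suc j else 0)) \<ge> 1/3 \<longleftrightarrow> b m"
proof -
  define r where "r = (\<lambda>m. \<Sum>j. if b (j + m) then (1/3 :: real) ^ Suc j else 0)"
  have r: "r m = (if b m then 1/3 else 0) + r (Suc m) / 3" "0 \<le> r m" "r m \<le> 1 / 2" for m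
    unfolding r_def by (rule ternary_tail)+
  have "\<exists>i :: int. 3 ^ m * r 0 = of_int i + r m"
  proof (induction m)
    case 0
    show ?case by (rule exI[of _ 0]) simp
  next
    case (Suc m)
    then obtain i :: int where i: "3 ^ m * r 0 = of_int i + r m" by blast
    have "3 ^ Suc m * r 0 = 3 * (of_int i + r m)" by (simp add: i[symmetric])
    also have "\<dots> = of_int (3 * i + (if b m then 1 else 0)) + r (Suc m)"
      using r(1)[of m] by simp
    finally show ?case by blast
  qed
  then obtain i :: int where "3 ^ m * r 0 = of_int i + r m" by blast
  then have "frac (3 ^ m * r 0) = r m"
    using r(2,3)[of m] by (intro frac_unique_iff[THEN iffD2]) auto
  moreover have "r m \<ge> 1/3 \<longleftrightarrow> b m" using r(1)[of m] r(2,3)[of "Suc m"] by auto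
  ultimately show ?thesis by (simp add: r_def)
qed

text \<open>A real sequence \<open>x\<close> is determined by the truth values of \<open>x k < q\<close> for rational \<open>q\<close>. They are stored
  as the digits 0 and 1 of a base 3 expansion; as the digit 2 is never used, the digits depend on the
  number in a measurable way without exceptions. This turns a law on sequences into a law on the
  reals, which is the image of Lebesgue measure under its quantile function.\<close>

definition encode_seq :: "(nat \<Rightarrow> real) \<Rightarrow> real" where
  "encode_seq x = (\<Sum>j. if (case from_nat j of (k, q :: rat) \<Rightarrow> x k < of_rat q) then (1/3) ^ Suc j else 0)"

text \<open>For a real that encodes no sequence the infimum may be infinite. Taking it in the
  extended reals keeps the map total and measurable; \<open>real_of_ereal\<close> sends infinite
  values to 0.\<close>

definition decode_seq :: "real \<Rightarrow> nat \<Rightarrow> real" where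
  "decode_seq y = (\<lambda>k. real_of_ereal (INF q :: rat.
     if frac (3 ^ to_nat (k, q) * y) \<ge> 1/3 then ereal (of_rat q) else \<infinity>))"

lemma decode_encode: "decode_seq (encode_seq x) = x"
proof
  fix k
  have "(frac (3 ^ to_nat (k, q) * encode_seq x) \<ge> 1/3) = (x k < of_rat q)" for q :: rat
    unfolding encode_seq_def by (subst ternary_digit) simp
  then have "decode_seq (encode_seq x) k = real_of_ereal (INF q :: rat. if x k < of_rat q then ereal (of_rat q) else \<infinity>)"
    by (simp add: decode_seq_def)
  also have "(INF q :: rat. if x k < of_rat q then ereal (of_rat q) else \<infinity>) = ereal (x k)"
  proof (rule antisym)
    show "(INF q :: rat. if x k < of_rat q then ereal (of_rat q) else \<infinity>) \<le> ereal (x k)"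
    proof (rule ereal_le_epsilon2)
      fix e :: real assume "0 < e"
      then obtain q :: rat where q: "x k < of_rat q" "of_rat q < x k + e"
        using of_rat_dense[of "x k" "x k + e"] by auto
      show "(INF q :: rat. if x k < of_rat q then ereal (of_rat q) else \<infinity>) \<le> ereal (x k) + ereal e"
        by (rule INF_lower2[of q]) (use q in auto)
    qed
  qed (rule INF_greatest, simp)
  finally show "decode_seq (encode_seq x) k = x k" by simp
qed

lemma measurable_encode_seq [measurable]: "encode_seq \<in> borel_measurable borel"
  unfolding encode_seq_def case_prod_beta by measurable

lemma measurable_decode_seq [measurable]: "decode_seq \<in> borel_measurable borel"
proof (rule measurable_coordinatewise_then_product)
  show "(\<lambda>y. decode_seq y k) \<in> borel_measurable borel" for k
    unfolding decode_seq_def frac_def by measurable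
qed

lemma exists_parametrization:
  fixes M :: "(nat \<Rightarrow> real) measure"
  assumes M: "prob_space M" and sM: "sets M = sets borel"
  shows "\<exists>\<iota>. \<iota> \<in> measurable unit_Leb borel \<and> distr unit_Leb borel \<iota> = M"
proof -
  interpret M: prob_space M by fact
  have em [measurable]: "encode_seq \<in> borel_measurable M"
    using measurable_encode_seq sM measurable_cong_sets by blast
  define \<mu> where "\<mu> = distr M borel encode_seq"
  have "prob_space \<mu>" unfolding \<mu>_def by (rule M.prob_space_distr[OF em])
  then have "real_distribution \<mu>"
    by (simp add: real_distribution_def real_distribution_axioms_def \<mu>_def)
  then interpret \<mu>: cdf_distribution \<mu> by (simp add: cdf_distribution_def)
  let ?U = "restrict_space lborel {0<..<1::real}"
  \<comment> \<open>The quantile function is used on the open interval only; the value 0 elsewhere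
    affects only the endpoints of the closed unit interval, which are null sets.\<close>
  define J where "J = (\<lambda>t :: real. if t \<in> {0<..<1} then \<mu>.I t else 0)"
  have Jm [measurable]: "J \<in> borel_measurable borel"
  proof -
    have "{x :: real. 0 < x \<and> x < 1} = {0<..<1}" by auto
    then show ?thesis
      unfolding J_def
      by (subst measurable_If_restrict_space_iff) (use \<mu>.measurable_CI in simp_all)
  qed
  define \<iota> where "\<iota> = (\<lambda>t. decode_seq (J t))"
  have \<iota>m [measurable]: "\<iota> \<in> borel_measurable borel" unfolding \<iota>_def by measurable
  have \<iota>u: "\<iota> \<in> measurable unit_Leb borel"
    unfolding unit_Leb_def by (rule measurable_restrict_space1) simp
  have "distr unit_Leb borel \<iota> = M"
  proof (rule measure_eqI)
    fix A assume "A \<in> sets (distr unit_Leb borel \<iota>)"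
    then have A [measurable]: "A \<in> sets borel" by simp
    have dA: "decode_seq -` A \<in> sets borel" using measurable_sets[OF measurable_decode_seq A] by simp
    have iA: "\<iota> -` A \<in> sets borel" using measurable_sets[OF \<iota>m A] by simp
    have JA: "\<mu>.I -` (decode_seq -` A) \<inter> {0<..<1} = \<iota> -` A \<inter> {0<..<1}"
      by (auto simp: \<iota>_def J_def)
    have "emeasure (distr unit_Leb borel \<iota>) A = emeasure unit_Leb (\<iota> -` A \<inter> space unit_Leb)"
      by (rule emeasure_distr[OF \<iota>u A])
    also have "\<dots> = emeasure lborel (\<iota> -` A \<inter> {0..1})"
      unfolding unit_Leb_def by (subst emeasure_restrict_space) (auto simp: space_restrict_space)
    also have "\<dots> = emeasure lborel (\<iota> -` A \<inter> {0<..<1})"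
    proof (rule emeasure_eq_AE)
      show "AE t in lborel. (t \<in> \<iota> -` A \<inter> {0..1}) = (t \<in> \<iota> -` A \<inter> {0<..<1})"
        using AE_lborel_singleton[of 0] AE_lborel_singleton[of 1] by eventually_elim auto
    qed (use iA in auto)
    also have "\<dots> = emeasure ?U (\<mu>.I -` (decode_seq -` A) \<inter> space ?U)"
      by (subst emeasure_restrict_space) (auto simp: space_restrict_space JA)
    also have "\<dots> = emeasure (distr ?U borel \<mu>.I) (decode_seq -` A)"
      by (rule emeasure_distr[symmetric, OF _ dA])
         (use \<mu>.measurable_CI in \<open>simp cong: measurable_cong_sets add: sets_restrict_space_cong[OF sets_lborel]\<close>)
    also have "\<dots> = emeasure \<mu> (decode_seq -` A)" by (simp add: \<mu>.distr_I_eq_M)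
    also have "\<dots> = emeasure M (encode_seq -` (decode_seq -` A) \<inter> space M)"
      unfolding \<mu>_def by (rule emeasure_distr[OF em dA])
    also have "encode_seq -` (decode_seq -` A) \<inter> space M = A"
      using sM sets.sets_into_space[of A M] A by (auto simp: decode_encode)
    finally show "emeasure (distr unit_Leb borel \<iota>) A = emeasure M A" .
  qed (simp add: sM)
  then show ?thesis using \<iota>u by blast
qed

section \<open>Almost sure summability and divergence\<close>

text \<open>The normal density is at most 1/2, since \<open>2 \<le> sqrt (2 * pi)\<close>, and the
  interval has length \<open>2 * \<delta>\<close>.\<close>

lemma gauss_small_ball:
  assumes "\<delta> \<ge> 0"
  shows "emeasure gauss {t. \<bar>t - b\<bar> \<le> \<delta>} \<le> ennreal \<delta>"
proof -
  have iv: "{t. \<bar>t - b\<bar> \<le> \<delta>} = {b - \<delta>..b + \<delta>}" by auto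
  have le: "std_normal_density t \<le> 1 / 2" for t
  proof -
    have "2 \<le> sqrt (2 * pi)" using pi_gt3 by (intro real_le_rsqrt) auto
    then have "1 / sqrt (2 * pi) \<le> 1 / 2" by (intro divide_left_mono) auto
    moreover have "exp (- t\<^sup>2 / 2) \<le> 1" by simp
    ultimately have "1 / sqrt (2 * pi) * exp (- t\<^sup>2 / 2) \<le> 1 / 2 * 1" by (intro mult_mono) auto
    then show ?thesis by (simp add: std_normal_density_def)
  qed
  have "emeasure gauss {t. \<bar>t - b\<bar> \<le> \<delta>} = (\<integral>\<^sup>+t. ennreal (std_normal_density t) * indicator {b - \<delta>..b + \<delta>} t \<partial>lborel)"
    unfolding iv by (rule emeasure_density) auto
  also have "\<dots> \<le> (\<integral>\<^sup>+t. ennreal (1 / 2) * indicator {b - \<delta>..b + \<delta>} t \<partial>lborel)"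
    by (intro nn_integral_mono mult_right_mono ennreal_leI le) auto
  also have "\<dots> = ennreal (1 / 2) * ennreal (2 * \<delta>)"
    using assms by (subst nn_integral_cmult_indicator) auto
  also have "\<dots> = ennreal (1 / 2 * (2 * \<delta>))"
    by (rule ennreal_mult[symmetric]) (use assms in auto)
  also have "\<dots> = ennreal \<delta>" by simp
  finally show ?thesis .
qed

text \<open>Given the other coordinates, \<open>x i\<close> would have to hit an interval of
  half-width 1/4 centred at \<open>x j + c\<close>, which has probability at most 1/4 wherever it
  lies. The bound is uniform in \<open>c\<close>, as separation modulo constants demands.\<close>

lemma GN_coordinates_separated:
  assumes "i \<noteq> j"
  shows "measure GN {x. \<bar>x i - x j - c\<bar> > 1/4} > 1/4"
proof -
  let ?A = "{x :: nat \<Rightarrow> real. \<bar>x i - x j - c\<bar> \<le> 1/4}"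
  have Am [measurable]: "?A \<in> sets borel" by measurable
  have "emeasure GN ?A = (\<integral>\<^sup>+x. indicator ?A x \<partial>GN)" by simp
  also have "\<dots> = (\<integral>\<^sup>+x. \<integral>\<^sup>+t. indicator ?A (x(i := t)) \<partial>gauss \<partial>GN)"
    by (rule nn_integral_GN_resample) measurable
  also have "\<dots> \<le> (\<integral>\<^sup>+x. ennreal (1/4) \<partial>GN)"
  proof (rule nn_integral_mono)
    fix x
    have "indicator ?A (x(i := t)) = (indicator {t. \<bar>t - (x j + c)\<bar> \<le> 1/4} t :: ennreal)" for t
      using assms by (simp add: indicator_def diff_diff_eq)
    then have "(\<integral>\<^sup>+t. indicator ?A (x(i := t)) \<partial>gauss) = emeasure gauss {t. \<bar>t - (x j + c)\<bar> \<le> 1/4}"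
      by simp
    then show "(\<integral>\<^sup>+t. indicator ?A (x(i := t)) \<partial>gauss) \<le> ennreal (1/4)"
      using gauss_small_ball[of "1/4" "x j + c"] by simp
  qed
  also have "\<dots> = ennreal (1/4)" using GN.emeasure_space_1 by simp
  finally have "measure GN ?A \<le> 1/4" by (simp add: GN.emeasure_eq_measure)
  moreover have "measure GN (space GN - ?A) = 1 - measure GN ?A" by (rule GN.prob_compl) simp
  moreover have "space GN - ?A = {x. \<bar>x i - x j - c\<bar> > 1/4}" by auto
  ultimately show ?thesis by simp
qed

text \<open>With probability at least 1/2 the variable stays 1/2 away from \<open>b\<close>, and
  there the exponent is at least \<open>u = w / 4\<close>. As
  \<open>exp (- u) \<le> 1 - u / 2\<close> on the unit interval, the average is at most
  \<open>1 - u / 4 = 1 - w / 16\<close>, uniformly in \<open>b\<close>.\<close>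

lemma gauss_exp_square:
  assumes w: "0 \<le> w" "w \<le> 1"
  shows "(\<integral>\<^sup>+t. ennreal (exp (- (w * (t - b)\<^sup>2))) \<partial>gauss) \<le> ennreal (exp (- (w / 16)))"
proof -
  let ?A = "{t. \<bar>t - b\<bar> \<le> 1/2}"
  have A [measurable]: "?A \<in> sets gauss" by simp
  define p where "p = measure gauss ?A"
  have "ennreal p \<le> ennreal (1/2)"
    using gauss_small_ball[of "1/2" b] by (simp only: p_def gauss.emeasure_eq_measure)
  then have p: "p \<le> 1/2" "0 \<le> p" by (subst (asm) ennreal_le_iff) (auto simp: p_def)
  define u where "u = w / 4"
  have u: "0 \<le> u" "u \<le> 1" using w by (auto simp: u_def)
  have eu: "exp (- u) \<le> 1 - u / 2"
  proof -
    have "(1 - u / 2) * (1 + u) = 1 + u * (1 - u) / 2" by (simp add: field_simps)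
    then have "1 \<le> (1 - u / 2) * (1 + u)" using u by simp
    also have "\<dots> \<le> (1 - u / 2) * exp u" using u exp_ge_add_one_self[of u] by (intro mult_left_mono) auto
    finally have "1 * exp (- u) \<le> (1 - u / 2) * exp u * exp (- u)" by (intro mult_right_mono) auto
    then show ?thesis by (simp add: mult.assoc exp_minus_inverse)
  qed
  have "(\<integral>\<^sup>+t. ennreal (exp (- (w * (t - b)\<^sup>2))) \<partial>gauss) \<le>
      (\<integral>\<^sup>+t. indicator ?A t + ennreal (exp (- u)) * indicator (space gauss - ?A) t \<partial>gauss)"
  proof (rule nn_integral_mono)
    fix t
    show "ennreal (exp (- (w * (t - b)\<^sup>2))) \<le> indicator ?A t + ennreal (exp (- u)) * indicator (space gauss - ?A) t"
    proof (cases "t \<in> ?A")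
      case True
      have "ennreal (exp (- (w * (t - b)\<^sup>2))) \<le> 1" using w by simp
      then show ?thesis using True by simp
    next
      case False
      then have "(1/2)\<^sup>2 \<le> (t - b)\<^sup>2" by (intro abs_le_square_iff[THEN iffD1]) auto
      then have "w * (1/4) \<le> w * (t - b)\<^sup>2" using w by (intro mult_left_mono) (auto simp: power2_eq_square)
      then show ?thesis using False by (simp add: u_def ennreal_leI)
    qed
  qed
  also have "\<dots> = emeasure gauss ?A + ennreal (exp (- u)) * emeasure gauss (space gauss - ?A)"
    by (subst nn_integral_add) (auto simp: nn_integral_cmult_indicator)
  also have "\<dots> = ennreal (p + exp (- u) * (1 - p))"
    using p gauss.prob_compl[OF A]
    by (simp add: gauss.emeasure_eq_measure p_def ennreal_mult[symmetric] flip: ennreal_plus)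
  also have "\<dots> \<le> ennreal (exp (- (w / 16)))"
  proof (rule ennreal_leI)
    have "p + exp (- u) * (1 - p) = exp (- u) + p * (1 - exp (- u))" by (simp add: algebra_simps)
    also have "\<dots> \<le> exp (- u) + 1/2 * (1 - exp (- u))"
      using p u by (intro add_left_mono mult_right_mono) auto
    also have "\<dots> \<le> 1 - w / 16"
    proof -
      have "E + 1/2 * (1 - E) \<le> 1 - u / 4" if "E \<le> 1 - u / 2" for E :: real
        using that by (simp add: field_simps)
      from this[OF eu] show ?thesis by (simp add: u_def)
    qed
    also have "\<dots> \<le> exp (- (w / 16))" using exp_ge_add_one_self[of "- (w / 16)"] by simp
    finally show "p + exp (- u) * (1 - p) \<le> exp (- (w / 16))" .
  qed
  finally show ?thesis .
qed

lemma GN_exp_square: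
  assumes w: "\<And>k. 0 \<le> w k" "\<And>k. w k \<le> 1"
  shows "(\<integral>\<^sup>+x. ennreal (exp (- (\<Sum>k<m. w k * (x k - b k)\<^sup>2))) \<partial>GN) \<le> ennreal (exp (- ((\<Sum>k<m. w k) / 16)))"
proof (induction m)
  case 0
  show ?case using GN.emeasure_space_1 by simp
next
  case (Suc m)
  let ?f = "\<lambda>m x. ennreal (exp (- (\<Sum>k<m. w k * (x k - b k)\<^sup>2)))"
  have fm [measurable]: "?f m \<in> borel_measurable borel" for m by measurable
  have "(\<integral>\<^sup>+x. ?f (Suc m) x \<partial>GN) = (\<integral>\<^sup>+x. \<integral>\<^sup>+t. ?f (Suc m) (x(m := t)) \<partial>gauss \<partial>GN)"
    by (rule nn_integral_GN_resample) (rule fm)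
  also have "\<dots> = (\<integral>\<^sup>+x. ?f m x * (\<integral>\<^sup>+t. ennreal (exp (- (w m * (t - b m)\<^sup>2))) \<partial>gauss) \<partial>GN)"
  proof (rule nn_integral_cong)
    fix x
    have "?f (Suc m) (x(m := t)) = ?f m x * ennreal (exp (- (w m * (t - b m)\<^sup>2)))" for t
      by (simp add: ennreal_mult[symmetric] exp_add[symmetric])
    then show "(\<integral>\<^sup>+t. ?f (Suc m) (x(m := t)) \<partial>gauss) = ?f m x * (\<integral>\<^sup>+t. ennreal (exp (- (w m * (t - b m)\<^sup>2))) \<partial>gauss)"
      by (simp add: nn_integral_cmult)
  qed
  also have "\<dots> \<le> (\<integral>\<^sup>+x. ?f m x * ennreal (exp (- (w m / 16))) \<partial>GN)"
    by (intro nn_integral_mono mult_left_mono gauss_exp_square w) auto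
  also have "\<dots> = (\<integral>\<^sup>+x. ?f m x \<partial>GN) * ennreal (exp (- (w m / 16)))"
    by (rule nn_integral_multc) simp
  also have "\<dots> \<le> ennreal (exp (- ((\<Sum>k<m. w k) / 16))) * ennreal (exp (- (w m / 16)))"
    by (intro mult_right_mono Suc.IH) auto
  also have "\<dots> = ennreal (exp (- ((\<Sum>k<Suc m. w k) / 16)))"
    by (simp add: ennreal_mult[symmetric] exp_add[symmetric] add_divide_distrib)
  finally show ?case .
qed

text \<open>Where the distance is at most \<open>n\<close>, the exponential of minus its truncated
  square is at least \<open>exp (- n\<^sup>2)\<close>; but the expectation of this exponential tends
  to 0 because the weights have infinite sum. Each such set is null, for an arbitrary centre
  \<open>b\<close>.\<close>

lemma GN_wd_infinite:
  assumes w: "\<And>k. 0 \<le> w k" "\<And>k. w k \<le> 1" and ns: "\<not> summable w"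
  shows "AE x in GN. wd w x b = \<top>"
proof -
  have inf: "filterlim (\<lambda>m. \<Sum>k<m. w k) at_top sequentially"
  proof -
    have inc: "(\<Sum>k<m. w k) \<le> (\<Sum>k<n. w k)" if "m \<le> n" for m n
      by (rule sum_mono2) (use that w in auto)
    have ex: "\<exists>m. Z \<le> (\<Sum>k<m. w k)" for Z
    proof (rule ccontr)
      assume "\<not> ?thesis"
      then have "(\<Sum>k<m. w k) \<le> Z" for m by (simp add: not_le less_imp_le)
      then show False using ns summableI_nonneg_bounded[of w Z] w(1) by blast
    qed
    show ?thesis
      unfolding filterlim_at_top eventually_sequentially using ex inc order_trans by meson
  qed
  have null: "emeasure GN {x. wd w x b \<le> ennreal (real n)} = 0" for n
  proof -
    let ?B = "{x. wd w x b \<le> ennreal (real n)}"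
    have Bm [measurable]: "?B \<in> sets borel" by measurable
    have le: "ennreal (exp (- (real n)\<^sup>2)) * emeasure GN ?B \<le> ennreal (exp (- ((\<Sum>k<m. w k) / 16)))" for m
    proof -
      have "ennreal (exp (- (real n)\<^sup>2)) * emeasure GN ?B = (\<integral>\<^sup>+x. ennreal (exp (- (real n)\<^sup>2)) * indicator ?B x \<partial>GN)"
        by (rule nn_integral_cmult_indicator[symmetric]) simp
      also have "\<dots> \<le> (\<integral>\<^sup>+x. ennreal (exp (- (\<Sum>k<m. w k * (x k - b k)\<^sup>2))) \<partial>GN)"
      proof (rule nn_integral_mono)
        fix x
        have "(\<Sum>k<m. w k * (x k - b k)\<^sup>2) \<le> (real n)\<^sup>2" if "x \<in> ?B"
        proof -
          have "wdn w m x b \<le> real n" using that wd_le_iff[of "real n" w x b] by simp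
          then show ?thesis unfolding wdn_def by (rule sqrt_le_D)
        qed
        then show "ennreal (exp (- (real n)\<^sup>2)) * indicator ?B x \<le> ennreal (exp (- (\<Sum>k<m. w k * (x k - b k)\<^sup>2)))"
          by (cases "x \<in> ?B") (auto intro!: ennreal_leI)
      qed
      also have "\<dots> \<le> ennreal (exp (- ((\<Sum>k<m. w k) / 16)))" by (rule GN_exp_square[OF w])
      finally show ?thesis .
    qed
    have "filterlim (\<lambda>m. - ((\<Sum>k<m. w k) / 16)) at_bot sequentially"
      unfolding filterlim_uminus_at_bot by simp
         (rule filterlim_at_top_mult_tendsto_pos[OF tendsto_const _ inf, of "1/16", simplified])
    then have "(\<lambda>m. exp (- ((\<Sum>k<m. w k) / 16))) \<longlonglongrightarrow> 0"
      by (rule filterlim_compose[OF exp_at_bot])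
    then have "(\<lambda>m. ennreal (exp (- ((\<Sum>k<m. w k) / 16)))) \<longlonglongrightarrow> ennreal 0"
      by (rule tendsto_ennrealI)
    then have "ennreal (exp (- (real n)\<^sup>2)) * emeasure GN ?B \<le> ennreal 0"
      by (rule tendsto_lowerbound) (use le in auto)
    then show ?thesis by (simp add: ennreal_eq_0_iff)
  qed
  have "AE x in GN. \<not> wd w x b \<le> ennreal (real n)" for n
    by (rule AE_I[OF _ null[of n]]) auto
  then have "AE x in GN. \<forall>n. \<not> wd w x b \<le> ennreal (real n)" by (simp add: AE_all_countable)
  then show ?thesis
  proof eventually_elim
    case (elim x)
    show ?case
    proof (cases "wd w x b")
      case (real c)
      then obtain n where "c \<le> real n" using real_arch_simple by blast
      then show ?thesis using elim real by (auto simp: ennreal_leI)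
    qed
  qed
qed

text \<open>The expected value of the sum is the second moment \<open>M2\<close> times the sum of
  \<open>c\<close>, hence finite, and a nonnegative function with finite integral is finite almost
  everywhere.\<close>

lemma GN_summable_squares:
  assumes c: "\<And>k. 0 \<le> c k" "summable c"
  shows "AE x in GN. summable (\<lambda>k. c k * (x k)\<^sup>2)"
proof -
  define M2 where "M2 = (\<integral>\<^sup>+t. ennreal (t\<^sup>2) \<partial>gauss)"
  have "integrable lborel (\<lambda>x. std_normal_density x * x ^ 2)" by (rule integrable_std_normal_moment)
  then have "(\<integral>\<^sup>+t. ennreal (std_normal_density t * t\<^sup>2) \<partial>lborel) < \<top>"
    using nn_integral_eq_integral[of lborel "\<lambda>x. std_normal_density x * x ^ 2"] by simp
  moreover have "M2 = (\<integral>\<^sup>+t. ennreal (std_normal_density t * t\<^sup>2) \<partial>lborel)"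
    unfolding M2_def by (subst nn_integral_density) (auto simp: ennreal_mult)
  ultimately have M2: "M2 < \<top>" by simp
  have coord: "(\<integral>\<^sup>+x. ennreal (c k * (x k)\<^sup>2) \<partial>GN) = ennreal (c k) * M2" for k
  proof -
    have "(\<integral>\<^sup>+x. ennreal (c k * (x k)\<^sup>2) \<partial>GN) = (\<integral>\<^sup>+x. \<integral>\<^sup>+t. ennreal (c k * ((x(k := t)) k)\<^sup>2) \<partial>gauss \<partial>GN)"
      by (rule nn_integral_GN_resample) measurable
    also have "\<dots> = ennreal (c k) * M2"
      using c(1)[of k] GN.emeasure_space_1 by (simp add: ennreal_mult nn_integral_cmult M2_def)
    finally show ?thesis .
  qed
  have "(\<integral>\<^sup>+x. (\<Sum>k. ennreal (c k * (x k)\<^sup>2)) \<partial>GN) = (\<Sum>k. \<integral>\<^sup>+x. ennreal (c k * (x k)\<^sup>2) \<partial>GN)"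
    by (rule nn_integral_suminf) measurable
  also have "\<dots> = (\<Sum>k. ennreal (c k)) * M2" by (simp add: coord)
  also have "\<dots> = ennreal (suminf c) * M2" using c by (simp add: suminf_ennreal2)
  also have "\<dots> < \<top>" using M2 by (simp add: ennreal_mult_less_top)
  finally have "(\<integral>\<^sup>+x. (\<Sum>k. ennreal (c k * (x k)\<^sup>2)) \<partial>GN) \<noteq> \<infinity>" by simp
  then have "AE x in GN. (\<Sum>k. ennreal (c k * (x k)\<^sup>2)) \<noteq> \<infinity>"
    by (rule nn_integral_PInf_AE[rotated]) measurable
  then show ?thesis
    by eventually_elim (rule summable_suminf_not_top, use c in auto)
qed

section \<open>The Gaussian field in the Hilbert scale\<close>

locale gaussian_scale =
  fixes d r \<alpha> :: real and lam :: "nat \<Rightarrow> real" and c C :: real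
  assumes d: "d > 0" and lam0: "1 \<le> lam 0" and inc: "incseq lam" and lim: "filterlim lam at_top sequentially"
    and c: "0 < c" and lower: "\<And>k. c * real (k + 1) powr (2 / d) \<le> lam k"
    and upper: "\<And>k. lam k \<le> C * real (k + 1) powr (2 / d)"
    and ar: "\<alpha> + r > d / 2"
begin

lemma lam_ge_1: "1 \<le> lam k"
  using lam0 inc by (metis incseqD le0 order_trans)

lemma lam_pos: "0 < lam k"
  using lam_ge_1[of k] by simp

lemma C_pos: "0 < C"
  using upper[of 0] lam_ge_1[of 0] by simp

text \<open>For negative \<open>t\<close> the lower bound on \<open>lam\<close> allows comparison
  with the series of \<open>k powr (2 / d * t)\<close>, which converges for
  \<open>2 / d * t < - 1\<close>. With \<open>t = s - \<alpha>\<close> this is the origin of the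
  threshold \<open>\<alpha> - d / 2\<close>.\<close>

lemma summable_lam_powr:
  assumes t: "t < - d / 2"
  shows "summable (\<lambda>k. lam k powr t)"
proof (rule summable_comparison_test')
  have "2 / d * t < - 1" using t d by (simp add: field_simps)
  then have "summable (\<lambda>n. real n powr (2 / d * t))" by (simp add: summable_real_powr_iff)
  then have "summable (\<lambda>n. real (Suc n) powr (2 / d * t))" by (subst summable_Suc_iff)
  then show "summable (\<lambda>k. c powr t * real (Suc k) powr (2 / d * t))" by (rule summable_mult)
  fix k :: nat
  have "lam k powr t \<le> (c * real (k + 1) powr (2 / d)) powr t"
    by (rule powr_mono2') (use t d c lower in \<open>auto intro: order_trans[of _ "- d / 2"]\<close>)
  also have "\<dots> = c powr t * real (Suc k) powr (2 / d * t)"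
    using c by (simp add: powr_mult powr_powr)
  finally show "norm (lam k powr t) \<le> c powr t * real (Suc k) powr (2 / d * t)" by simp
qed

lemma not_summable_lam_powr:
  assumes t: "- d / 2 \<le> t" "t \<le> 0"
  shows "\<not> summable (\<lambda>k. lam k powr t)"
proof
  assume s: "summable (\<lambda>k. lam k powr t)"
  have "summable (\<lambda>k. C powr t * real (Suc k) powr (2 / d * t))"
  proof (rule summable_comparison_test'[OF s])
    fix k :: nat
    have "C powr t * real (Suc k) powr (2 / d * t) = (C * real (k + 1) powr (2 / d)) powr t"
      using C_pos by (simp add: powr_mult powr_powr)
    also have "\<dots> \<le> lam k powr t"
      by (rule powr_mono2') (use t lam_pos upper in auto)
    finally show "norm (C powr t * real (Suc k) powr (2 / d * t)) \<le> lam k powr t" using C_pos by simp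
  qed
  then have "summable (\<lambda>k. real (Suc k) powr (2 / d * t))" using C_pos by (simp add: summable_cmult_iff)
  then have "summable (\<lambda>k. real k powr (2 / d * t))" by (subst (asm) summable_Suc_iff)
  then have "2 / d * t < - 1" by (simp add: summable_real_powr_iff)
  then show False using t d by (simp add: field_simps)
qed

section \<open>Standard Gaussian coordinates of the field\<close>

definition scale :: "(nat \<Rightarrow> real) \<Rightarrow> nat \<Rightarrow> real" where
  "scale x = (\<lambda>k. lam k powr (- \<alpha> / 2) * x k)"

definition unscale :: "(nat \<Rightarrow> real) \<Rightarrow> nat \<Rightarrow> real" where
  "unscale y = (\<lambda>k. lam k powr (\<alpha> / 2) * y k)"

abbreviation pw :: "real \<Rightarrow> nat \<Rightarrow> real" where
  "pw t \<equiv> (\<lambda>k. lam k powr t)"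

lemma pw_pos: "0 < pw t k"
  using lam_pos[of k] by simp

lemma unscale_scale [simp]: "unscale (scale x) = x"
proof
  fix k
  have "lam k powr (\<alpha> / 2) * lam k powr (- \<alpha> / 2) = 1"
    using lam_pos[of k] by (simp flip: powr_add)
  then show "unscale (scale x) k = x k"
    by (simp add: unscale_def scale_def mult.assoc[symmetric])
qed

lemma scale_unscale [simp]: "scale (unscale x) = x"
proof
  fix k
  have "lam k powr (- \<alpha> / 2) * lam k powr (\<alpha> / 2) = 1"
    using lam_pos[of k] by (simp flip: powr_add)
  then show "scale (unscale x) k = x k"
    by (simp add: unscale_def scale_def mult.assoc[symmetric])
qed

lemma wd_scale: "wd (pw s) (scale x) (scale y) = wd (pw (s - \<alpha>)) x y"
proof -
  have "pw s k * (scale x k - scale y k)\<^sup>2 = pw (s - \<alpha>) k * (x k - y k)\<^sup>2" for k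
  proof -
    have "scale x k - scale y k = lam k powr (- \<alpha> / 2) * (x k - y k)" by (simp add: scale_def algebra_simps)
    then have "pw s k * (scale x k - scale y k)\<^sup>2 =
        (lam k powr s * (lam k powr (- \<alpha> / 2) * lam k powr (- \<alpha> / 2))) * (x k - y k)\<^sup>2"
      by (simp add: power2_eq_square)
    also have "lam k powr s * (lam k powr (- \<alpha> / 2) * lam k powr (- \<alpha> / 2)) = lam k powr (s - \<alpha>)"
      by (simp flip: powr_add)
    finally show ?thesis .
  qed
  then show ?thesis by (simp add: wd_def wdn_def)
qed

lemma wd_unscale: "wd (pw (s - \<alpha>)) (unscale x) (unscale y) = wd (pw s) x y"
  using wd_scale[of s "unscale x" "unscale y"] by simp

lemma measurable_scale [measurable]: "scale \<in> borel_measurable borel" "unscale \<in> borel_measurable borel"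
  unfolding scale_def unscale_def by (rule measurable_coordinatewise_then_product, measurable)+

lemma scale_zero [simp]: "scale (\<lambda>_. 0) = (\<lambda>_. 0)"
  by (simp add: scale_def)

lemma AE_scale_in_l2:
  assumes "t < \<alpha> - d / 2"
  shows "AE x in GN. scale x \<in> l2 (pw t)"
proof -
  have "AE x in GN. summable (\<lambda>k. pw (t - \<alpha>) k * (x k)\<^sup>2)"
    by (rule GN_summable_squares) (use summable_lam_powr[of "t - \<alpha>"] assms in auto)
  then show ?thesis
  proof eventually_elim
    case (elim x)
    then have "wd (pw (t - \<alpha>)) x (\<lambda>_. 0) < \<top>" by (simp add: wd_summable(1))
    then show ?case using wd_scale[of t x "\<lambda>_. 0"] by (simp add: l2_def)
  qed
qed

abbreviation V :: "nat \<Rightarrow> real" where "V \<equiv> pw (- r)"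

sublocale HV: weighted_l2 V
  by standard (rule pw_pos)

abbreviation T :: "(nat \<Rightarrow> real) topology" where "T \<equiv> l2_topology V"

text \<open>The field as a total map into the space of exponent \<open>t\<close>. The value 0 off
  the domain matches the convention of \<open>gaussian_field\<close> when \<open>t = - r\<close>;
  other exponents provide the law of the isomorphic mm-space.\<close>

definition field_at :: "real \<Rightarrow> (nat \<Rightarrow> real) \<Rightarrow> nat \<Rightarrow> real" where
  "field_at t x = (if scale x \<in> l2 (pw t) then scale x else (\<lambda>_. 0))"

lemma weighted_pw: "weighted_l2 (pw t)"
  by standard (rule pw_pos)

lemma zero_in_l2 [simp]: "(\<lambda>_. 0) \<in> l2 v"
  by (simp add: l2_def)

lemma l2_measurable [measurable]: "l2 v \<in> sets borel"
proof -
  have "l2 v = {x \<in> space borel. wd v x (\<lambda>_. 0) < \<top>}" by (simp add: l2_def)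
  also have "\<dots> \<in> sets borel" by measurable
  finally show ?thesis .
qed

lemma field_at_borel [measurable]: "field_at t \<in> borel_measurable borel"
proof -
  have "field_at t = (\<lambda>x. if scale x \<in> l2 (pw t) then scale x else (\<lambda>_. 0))" by (auto simp: field_at_def)
  also have "\<dots> \<in> borel_measurable borel" by measurable
  finally show ?thesis .
qed

lemma field_at_l2: "field_at t x \<in> l2 (pw t)"
  by (simp add: field_at_def)

lemma field_at_measurable: "field_at t \<in> measurable GN (borel_of (l2_topology (pw t)))"
  by (rule weighted_l2.measurable_into_l2[OF weighted_pw]) (auto simp: field_at_l2)

definition law :: "real \<Rightarrow> (nat \<Rightarrow> real) measure" where
  "law t = distr GN (borel_of (l2_topology (pw t))) (field_at t)"

lemma space_law [simp]: "space (law t) = l2 (pw t)"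
  by (simp add: law_def weighted_l2.topspace_eq[OF weighted_pw])

lemma sets_law: "sets (law t) = sets (borel_of (l2_topology (pw t)))"
  by (simp add: law_def)

lemma prob_space_law: "prob_space (law t)"
  unfolding law_def by (rule GN.prob_space_distr[OF field_at_measurable])

lemma borel_prob_law: "borel_prob (l2_topology (pw t)) (law t)"
  using prob_space_law by (simp add: borel_prob_def sets_law weighted_l2.topspace_eq[OF weighted_pw])

lemma measurable_law_borel: "f \<in> measurable borel N \<Longrightarrow> f \<in> measurable (law t) N"
proof -
  assume f: "f \<in> measurable borel N"
  have "(\<lambda>x. x) \<in> measurable (law t) borel"
    using weighted_l2.measurable_id[OF weighted_pw] unfolding law_def by simp
  from measurable_compose[OF this f] show ?thesis by simp
qed

lemma sets_law_Collect: "A \<in> sets borel \<Longrightarrow> {y \<in> space (law t). y \<in> A} \<in> sets (law t)"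
proof -
  assume A: "A \<in> sets borel"
  have "(\<lambda>x. x) \<in> measurable (law t) borel" by (rule measurable_law_borel) simp
  from measurable_sets[OF this A] show ?thesis by (simp add: vimage_def Int_def conj_commute)
qed

lemma measure_law:
  assumes "A \<in> sets (law t)"
  shows "measure (law t) A = measure GN (field_at t -` A)"
  using measure_distr[OF field_at_measurable, of A t] assms by (simp add: law_def)

lemma AE_law_iff:
  assumes "{y \<in> space (law t). Q y} \<in> sets (law t)"
  shows "(AE y in law t. Q y) \<longleftrightarrow> (AE x in GN. Q (field_at t x))"
  unfolding law_def by (rule AE_distr_iff[OF field_at_measurable]) (use assms in \<open>simp add: law_def weighted_l2.topspace_eq[OF weighted_pw]\<close>)

section \<open>The spaces of the theorem and their Lipschitz functions in Gaussian
  coordinates\<close>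

definition X :: "real \<Rightarrow> (nat \<Rightarrow> real) emm" where
  "X s = \<lparr>topo = T, edist = wd (pw s), meas = law (- r)\<rparr>"

lemma meas_X [simp]: "meas (X s) = law (- r)" and topo_X [simp]: "topo (X s) = T"
  and edist_X [simp]: "edist (X s) = wd (pw s)"
  by (simp_all add: X_def)

lemma AE_field: "AE x in GN. field_at (- r) x = scale x"
proof -
  have "AE x in GN. scale x \<in> l2 V" by (rule AE_scale_in_l2) (use ar in simp)
  then show ?thesis by eventually_elim (simp add: field_at_def)
qed

text \<open>\<open>scale\<close> is an isometry from the weights \<open>pw (s - \<alpha>)\<close> to
  the weights \<open>pw s\<close>. The full-measure set is intersected with the points where the
  field is given by \<open>scale\<close> rather than by its default value.\<close>

lemma lip_functions_pull:
  assumes f: "f \<in> lip_functions (X s)"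
  shows "(\<lambda>x. f (field_at (- r) x)) \<in> lipN (pw (s - \<alpha>))"
proof -
  interpret L: prob_space "law (- r)" by (rule prob_space_law)
  obtain E where E: "E \<in> sets (law (- r))" "measure (law (- r)) E = 1"
    and lip: "\<And>x y. x \<in> E \<Longrightarrow> y \<in> E \<Longrightarrow> ennreal \<bar>f x - f y\<bar> \<le> wd (pw s) x y"
    and fm: "f \<in> borel_measurable (law (- r))"
    using f by (auto simp: lip_functions_def)
  have gm: "field_at (- r) \<in> measurable borel (law (- r))"
    using field_at_measurable[of "- r"] by (simp add: law_def)
  let ?E = "{x. scale x \<in> l2 V} \<inter> field_at (- r) -` E"
  have "{x. scale x \<in> l2 V} \<in> sets borel"
    using measurable_sets[OF measurable_scale(1) l2_measurable] by (simp add: vimage_def)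
  moreover have "field_at (- r) -` E \<in> sets borel" using measurable_sets[OF gm E(1)] by simp
  ultimately have Em: "?E \<in> sets borel" by (rule sets.Int)
  have "AE y in law (- r). y \<in> E" using E L.prob_eq_1 by simp
  moreover have "{y \<in> space (law (- r)). y \<in> E} = E" using sets.sets_into_space[OF E(1)] by auto
  ultimately have "AE x in GN. field_at (- r) x \<in> E"
    using AE_law_iff[of "- r" "\<lambda>y. y \<in> E"] E(1) by simp
  then have AE: "AE x in GN. x \<in> ?E"
    using AE_scale_in_l2[of "- r"] ar by (auto elim: eventually_elim2)
  have "ennreal \<bar>f (field_at (- r) x) - f (field_at (- r) y)\<bar> \<le> wd (pw (s - \<alpha>)) x y"
    if "x \<in> ?E" "y \<in> ?E" for x y
  proof -
    have "field_at (- r) x = scale x" "field_at (- r) y = scale y" using that by (auto simp: field_at_def)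
    then show ?thesis using lip[of "scale x" "scale y"] that by (simp add: wd_scale)
  qed
  moreover have "(\<lambda>x. f (field_at (- r) x)) \<in> borel_measurable borel"
    by (rule measurable_compose[OF gm fm])
  ultimately show ?thesis using Em AE unfolding lipN_def by blast
qed

lemma lip_functions_push:
  assumes g: "g \<in> lipN (pw (s - \<alpha>))"
  shows "(\<lambda>y. g (unscale y)) \<in> lip_functions (X s)"
proof -
  interpret L: prob_space "law (- r)" by (rule prob_space_law)
  obtain E where E: "E \<in> sets borel" "AE x in GN. x \<in> E"
    and lip: "\<And>x y. x \<in> E \<Longrightarrow> y \<in> E \<Longrightarrow> ennreal \<bar>g x - g y\<bar> \<le> wd (pw (s - \<alpha>)) x y"
    and gm: "g \<in> borel_measurable borel"
    using g by (auto simp: lipN_def)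
  let ?E = "{y \<in> space (law (- r)). unscale y \<in> E}"
  have Em: "?E \<in> sets (law (- r))"
    using measurable_sets[OF measurable_law_borel[OF measurable_scale(2)] E(1), of "- r"]
    by (simp add: vimage_def Int_def conj_commute)
  have "AE x in GN. unscale (field_at (- r) x) \<in> E"
    using AE_field E(2) by eventually_elim simp
  then have "AE y in law (- r). unscale y \<in> E" by (subst AE_law_iff) (rule Em)
  then have "AE y in law (- r). y \<in> ?E" using AE_space by eventually_elim simp
  then have "measure (law (- r)) ?E = 1" using Em L.prob_eq_1 by blast
  moreover have "(\<lambda>y. g (unscale y)) \<in> borel_measurable (law (- r))"
    by (rule measurable_law_borel) (rule measurable_compose[OF measurable_scale(2) gm])
  moreover have "ennreal \<bar>g (unscale x) - g (unscale y)\<bar> \<le> wd (pw s) x y" if "x \<in> ?E" "y \<in> ?E" for x y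
    using lip[of "unscale x" "unscale y"] that by (simp add: wd_unscale)
  ultimately show ?thesis unfolding lip_functions_def using Em by auto
qed

lemma measure_law_GN:
  assumes fm: "f \<in> borel_measurable (law (- r))" and gm: "g \<in> borel_measurable (law (- r))"
  shows "measure (law (- r)) {y \<in> space (law (- r)). \<bar>f y - g y - b\<bar> > e} =
    measure GN {x. \<bar>f (field_at (- r) x) - g (field_at (- r) x) - b\<bar> > (e :: real)}"
proof -
  have "{y \<in> space (law (- r)). \<bar>f y - g y - b\<bar> > e} \<in> sets (law (- r))"
    using fm gm by measurable
  from measure_law[OF this] show ?thesis
    by (simp add: vimage_def field_at_l2)
qed

lemma pw_decseq: "t \<le> 0 \<Longrightarrow> decseq (pw t)"
  unfolding decseq_def using inc lam_pos by (auto intro!: powr_mono2' simp: incseq_def)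

lemma pw_le_1: "t \<le> 0 \<Longrightarrow> pw t k \<le> 1"
  using powr_mono2'[of t 1 "lam k"] lam_ge_1[of k] by simp

lemma pw_tendsto_0: "t < 0 \<Longrightarrow> pw t \<longlonglongrightarrow> 0"
  by (rule tendsto_neg_powr[OF _ lim])

lemma pw_mono: "s \<le> t \<Longrightarrow> pw s k \<le> pw t k"
  using lam_ge_1[of k] by (simp add: powr_mono)

lemma concentrated_X:
  assumes s: "s < \<alpha>"
  shows "concentrated (X s)"
proof -
  let ?w = "pw (s - \<alpha>)"
  have "\<forall>\<delta>\<in>{0<..}. \<exists>\<Psi> :: ((nat \<Rightarrow> real) \<Rightarrow> real) \<Rightarrow> (nat \<Rightarrow> real) \<Rightarrow> int. finite (\<Psi> ` lipN ?w) \<and>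
    (\<forall>f\<in>lipN ?w. \<forall>h\<in>lipN ?w. \<Psi> f = \<Psi> h \<longrightarrow> (\<exists>c. measure GN {x. \<bar>f x - h x - c\<bar> > \<delta>} \<le> \<delta>))"
    by (intro ballI lipN_totally_bounded pw_pos pw_decseq pw_tendsto_0) (use s in auto)
  from bchoice[OF this] obtain \<Psi> :: "real \<Rightarrow> ((nat \<Rightarrow> real) \<Rightarrow> real) \<Rightarrow> (nat \<Rightarrow> real) \<Rightarrow> int"
    where *: "\<forall>\<delta>\<in>{0<..}. finite (\<Psi> \<delta> ` lipN ?w) \<and>
      (\<forall>f\<in>lipN ?w. \<forall>h\<in>lipN ?w. \<Psi> \<delta> f = \<Psi> \<delta> h \<longrightarrow> (\<exists>c. measure GN {x. \<bar>f x - h x - c\<bar> > \<delta>} \<le> \<delta>))" ..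
  have fin: "finite (\<Psi> \<delta> ` lipN ?w)" if "\<delta> > 0" for \<delta>
    using * that by blast
  have \<Psi>: "\<exists>c. measure GN {x. \<bar>f x - h x - c\<bar> > \<delta>} \<le> \<delta>"
    if "\<delta> > 0" "f \<in> lipN ?w" "h \<in> lipN ?w" "\<Psi> \<delta> f = \<Psi> \<delta> h" for \<delta> f h
    using * that by blast
  show ?thesis
  proof (rule concentratedI[where \<Psi>="\<lambda>\<delta> f. \<Psi> \<delta> (\<lambda>x. f (field_at (- r) x))"])
    show "prob_space (meas (X s))" by (simp add: prob_space_law)
    show "finite ((\<lambda>f. \<Psi> \<delta> (\<lambda>x. f (field_at (- r) x))) ` lip_functions (X s))" if "\<delta> > 0" for \<delta>
      by (rule finite_subset[OF _ fin[OF that]]) (use lip_functions_pull in blast)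
    fix \<delta> :: real and f g
    assume "\<delta> > 0" and f: "f \<in> lip_functions (X s)" and g: "g \<in> lip_functions (X s)"
      and eq: "\<Psi> \<delta> (\<lambda>x. f (field_at (- r) x)) = \<Psi> \<delta> (\<lambda>x. g (field_at (- r) x))"
    from \<Psi>[OF \<open>\<delta> > 0\<close> lip_functions_pull[OF f] lip_functions_pull[OF g] eq]
    show "\<exists>c. measure (meas (X s)) {x \<in> space (meas (X s)). \<bar>f x - g x - c\<bar> > \<delta>} \<le> \<delta>"
      using measure_law_GN[of f g] lip_functions_measurable[OF f] lip_functions_measurable[OF g] by simp
  qed
qed

lemma not_concentrated_X:
  assumes s: "\<alpha> \<le> s"
  shows "\<not> concentrated (X s)"
proof (rule not_concentratedI[where f="\<lambda>k y. unscale y k" and \<delta>="1/4"])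
  show "prob_space (meas (X s))" by (simp add: prob_space_law)
  show lf: "(\<lambda>y. unscale y k) \<in> lip_functions (X s)" for k
  proof (rule lip_functions_push[of "\<lambda>x. x k"])
    have "ennreal \<bar>x k - y k\<bar> \<le> wd (pw (s - \<alpha>)) x y" for x y
    proof -
      have "1 * \<bar>x k - y k\<bar> \<le> sqrt (pw (s - \<alpha>) k) * \<bar>x k - y k\<bar>"
        using lam_ge_1[of k] s by (intro mult_right_mono) (auto intro!: ge_one_powr_ge_zero)
      then show ?thesis
        using coord_le_wd[of "pw (s - \<alpha>)" k x y] by (auto intro: order_trans[OF ennreal_leI])
    qed
    then show "(\<lambda>x. x k) \<in> lipN (pw (s - \<alpha>))"
      unfolding lipN_def by (auto intro!: bexI[of _ UNIV])
  qed
  fix i j :: nat and b assume ij: "i \<noteq> j"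
  have "measure (law (- r)) {y \<in> space (law (- r)). \<bar>unscale y i - unscale y j - b\<bar> > 1/4} =
    measure GN {x. \<bar>unscale (field_at (- r) x) i - unscale (field_at (- r) x) j - b\<bar> > 1/4}"
    by (rule measure_law_GN) (use lf lip_functions_measurable in fastforce)+
  also have "\<dots> = measure GN {x. \<bar>x i - x j - b\<bar> > 1/4}"
  proof (rule measure_eq_AE)
    show "AE x in GN. (x \<in> {x. \<bar>unscale (field_at (- r) x) i - unscale (field_at (- r) x) j - b\<bar> > 1/4}) =
        (x \<in> {x. \<bar>x i - x j - b\<bar> > 1/4})"
      using AE_field by eventually_elim simp
    have [measurable]: "(\<lambda>x. unscale (field_at (- r) x)) \<in> borel_measurable borel" by measurable
    show "{x. \<bar>unscale (field_at (- r) x) i - unscale (field_at (- r) x) j - b\<bar> > 1/4} \<in> sets GN"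
      by measurable
  qed measurable
  finally show "1/4 < measure (meas (X s)) {y \<in> space (meas (X s)). \<bar>unscale y i - unscale y j - b\<bar> > 1/4}"
    using GN_coordinates_separated[OF ij, of b] by simp
qed simp

section \<open>Comparison with mm-spaces\<close>

lemma emm_space_X:
  assumes "s + r \<ge> 0"
  shows "emm_space (X s)"
  unfolding X_def by (rule HV.emm_space_l2) (use assms borel_prob_law in \<open>auto intro!: pw_mono\<close>)

lemma l2_mono: "s \<le> t \<Longrightarrow> l2 (pw t) \<subseteq> l2 (pw s)"
  unfolding l2_def using wd_mono_weight[of "pw s" "pw t"] pw_mono by (auto intro: le_less_trans)

lemma X_iso_mm_space:
  assumes sr: "s + r \<ge> 0" and s: "s < \<alpha> - d / 2"
  shows "\<exists>Y :: (nat \<Rightarrow> real) emm. mm_space Y \<and> emm_iso (X s) Y"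
proof -
  interpret W: weighted_l2 "pw s" by (rule weighted_pw)
  interpret L: prob_space "law (- r)" by (rule prob_space_law)
  define Y where "Y = \<lparr>topo = l2_topology (pw s), edist = wd (pw s), meas = law s\<rparr>"
  have "mm_space Y"
    unfolding mm_space_def
  proof (intro exI conjI)
    show "Metric_space (l2 (pw s)) (\<lambda>x y. enn2real (wd (pw s) x y))" by (rule W.MS.Metric_space_axioms)
    show "W.MS.mcomplete" by (rule W.mcomplete)
    show "topo Y = W.MS.mtopology" by (simp add: Y_def W.topology_eq)
    show "separable_space (topo Y)" by (simp add: Y_def W.separable)
    show "\<forall>x\<in>l2 (pw s). \<forall>y\<in>l2 (pw s). edist Y x y = ennreal (enn2real (wd (pw s) x y))"
      by (simp add: Y_def W.enn2real_wd)
    show "borel_prob (topo Y) (meas Y)" by (simp add: Y_def borel_prob_law)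
  qed
  moreover have "emm_iso (X s) Y"
  proof -
    define F where "F = (\<lambda>y :: nat \<Rightarrow> real. if y \<in> l2 (pw s) then y else (\<lambda>_. 0))"
    have Fb [measurable]: "F \<in> borel_measurable borel" unfolding F_def by measurable
    have Fm: "F \<in> measurable (law (- r)) (law s)"
      using W.measurable_into_l2[OF measurable_law_borel[OF Fb]] by (simp add: law_def F_def)
    \<comment> \<open>The default values agree because \<open>l2 (pw s)\<close> is contained in
      \<open>l2 V\<close>: a sample outside the larger space is also outside the smaller one, and
      both sides send it to 0.\<close>
    have comp: "F \<circ> field_at (- r) = field_at s"
      using l2_mono[of "- r" s] sr by (auto simp: fun_eq_iff F_def field_at_def)
    have "distr (law (- r)) (law s) F = distr GN (law s) (F \<circ> field_at (- r))"
      unfolding law_def[of "- r"]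
      by (rule distr_distr) (use Fm field_at_measurable in \<open>simp_all add: law_def\<close>)
    also have "\<dots> = law s" unfolding comp by (simp add: law_def cong: distr_cong)
    finally have dF: "distr (law (- r)) (law s) F = law s" .
    have "l2 (pw s) = {y \<in> space (law (- r)). y \<in> l2 (pw s)}"
      using l2_mono[of "- r" s] sr by auto
    also have "\<dots> \<in> sets (law (- r))"
      by (rule sets_law_Collect) simp
    finally have A: "l2 (pw s) \<in> sets (law (- r))" .
    have "AE x in GN. field_at (- r) x \<in> l2 (pw s)"
      using AE_field AE_scale_in_l2[OF s] by eventually_elim simp
    then have "AE y in law (- r). y \<in> l2 (pw s)"
      using AE_law_iff[of "- r" "\<lambda>y. y \<in> l2 (pw s)"] sets_law_Collect[of "l2 (pw s)" "- r"] by simp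
    then have A1: "measure (law (- r)) (l2 (pw s)) = 1" using A L.prob_eq_1 by blast
    show ?thesis
      unfolding emm_iso_def
    proof (intro exI conjI)
      show "F \<in> measurable (completion (meas (X s))) (meas Y)"
        using Fm by (simp add: Y_def measurable_completion)
      show "distr (completion (meas (X s))) (meas Y) F = meas Y"
        using distr_completion[OF Fm] dF by (simp add: Y_def)
      show "l2 (pw s) \<in> sets (completion (meas (X s)))" using A by simp
      show "emeasure (completion (meas (X s))) (l2 (pw s)) = 1"
        using A A1 by (simp add: L.emeasure_eq_measure)
      show "\<forall>x\<in>l2 (pw s). \<forall>y\<in>l2 (pw s). edist Y (F x) (F y) = edist (X s) x y"
        by (simp add: Y_def F_def)
    qed
  qed
  ultimately show ?thesis by blast
qed

lemma X_not_iso_mm_space: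
  fixes Y :: "'b emm"
  assumes s: "\<alpha> - d / 2 \<le> s" "s \<le> \<alpha>" and Y: "mm_space Y" and iso: "emm_iso (X s) Y"
  shows False
proof -
  interpret L: prob_space "law (- r)" by (rule prob_space_law)
  interpret CL: prob_space "completion (law (- r))" by (rule L.prob_space_completion)
  obtain S \<rho> where ed: "\<And>x y. x \<in> S \<Longrightarrow> y \<in> S \<Longrightarrow> edist Y x y = ennreal (\<rho> x y)"
    and ms: "Metric_space S \<rho>" and top: "topo Y = Metric_space.mtopology S \<rho>" and bp: "borel_prob (topo Y) (meas Y)"
    using Y unfolding mm_space_def by blast
  have spY: "space (meas Y) = S"
    using bp Metric_space.topspace_mtopology[OF ms] by (simp add: borel_prob_def top)
  obtain F A where F: "F \<in> measurable (completion (law (- r))) (meas Y)"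
    and A: "A \<in> sets (completion (law (- r)))" "emeasure (completion (law (- r))) A = 1"
    and isom: "\<And>x y. x \<in> A \<Longrightarrow> y \<in> A \<Longrightarrow> edist Y (F x) (F y) = wd (pw s) x y"
    using iso unfolding emm_iso_def meas_X edist_X by blast
  have FS: "F x \<in> S" if "x \<in> A" for x
    using measurable_space[OF F] sets.sets_into_space[OF A(1)] that spY by auto
  have fin: "wd (pw s) x y < \<top>" if "x \<in> A" "y \<in> A" for x y
  proof -
    have "wd (pw s) x y = ennreal (\<rho> (F x) (F y))"
      unfolding isom[OF that, symmetric] by (rule ed[OF FS[OF that(1)] FS[OF that(2)]])
    then show ?thesis by simp
  qed
  have "A \<noteq> {}" using A(2) by auto
  then obtain x0 where x0: "x0 \<in> A" by blast
  have "measure (completion (law (- r))) A = 1" using A(2) by (simp add: measure_def)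
  then have "AE y in completion (law (- r)). y \<in> A" using A(1) CL.prob_eq_1 by blast
  then have "AE y in completion (law (- r)). wd (pw s) y x0 < \<top>"
    by eventually_elim (rule fin[OF _ x0])
  then have AEl: "AE y in law (- r). wd (pw s) y x0 < \<top>" by (simp add: AE_completion_iff)
  have "(\<lambda>y. wd (pw s) y x0) \<in> borel_measurable (law (- r))" by (rule measurable_law_borel) measurable
  then have "{y \<in> space (law (- r)). wd (pw s) y x0 < \<top>} \<in> sets (law (- r))" by measurable
  then have "AE x in GN. wd (pw s) (field_at (- r) x) x0 < \<top>"
    using AEl by (simp add: AE_law_iff)
  then have "AE x in GN. wd (pw (s - \<alpha>)) x (unscale x0) < \<top>"
    using AE_field by eventually_elim (metis wd_unscale unscale_scale)
  \<comment> \<open>The two bounds on \<open>s\<close> place the exponent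
    \<open>s - \<alpha>\<close> between \<open>- d / 2\<close> and 0, where the weights are at most
    1 and have divergent sum.\<close>
  moreover have "AE x in GN. wd (pw (s - \<alpha>)) x (unscale x0) = \<top>"
    by (rule GN_wd_infinite)
       (use s not_summable_lam_powr[of "s - \<alpha>"] pw_le_1[of "s - \<alpha>"] in auto)
  ultimately have "AE x in GN. False" by eventually_elim simp
  then show False by simp
qed

text \<open>Over an empty set of parameters the infimum in \<open>d_conc\<close> would be infinite.
  A parameter of the Gaussian sequence is composed with the field, which gives a parameter for every
  \<open>s\<close> at once.\<close>

lemma parameters_X: "parameters (X s) \<noteq> {}"
proof -
  obtain \<iota> where \<iota>: "\<iota> \<in> measurable unit_Leb borel" "distr unit_Leb borel \<iota> = GN"
    using exists_parametrization[OF GN.prob_space_axioms sets_GN] by blast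
  have fm: "field_at (- r) \<in> measurable borel (borel_of T)"
    using field_at_measurable[of "- r"] by simp
  have "distr unit_Leb (borel_of T) (field_at (- r) \<circ> \<iota>) = distr (distr unit_Leb borel \<iota>) (borel_of T) (field_at (- r))"
    by (rule distr_distr[symmetric]) (use fm \<iota> in auto)
  also have "\<dots> = law (- r)" by (simp add: \<iota> law_def)
  finally have "field_at (- r) \<circ> \<iota> \<in> parameters (X s)"
    using measurable_comp[OF \<iota>(1) fm] by (simp add: parameters_def)
  then show ?thesis by blast
qed

section \<open>Continuity in the exponent\<close>

lemma lip_functions_close:
  assumes f: "f \<in> lip_functions (X s)" and h: "h \<in> lipN (pw (t - \<alpha>))"
    and le: "measure GN {x. \<bar>f (field_at (- r) x) - h x\<bar> > e} \<le> e"
  shows "\<exists>g\<in>lip_functions (X t). measure (law (- r)) {y \<in> space (law (- r)). \<bar>f y - g y\<bar> > e} \<le> e"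
proof (rule bexI[OF _ lip_functions_push[OF h]])
  have fm: "f \<in> borel_measurable (law (- r))" using lip_functions_measurable[OF f] by simp
  have hm: "(\<lambda>y. h (unscale y)) \<in> borel_measurable (law (- r))"
    using lip_functions_measurable[OF lip_functions_push[OF h]] by simp
  have [measurable]: "h \<in> borel_measurable borel" using h by (simp add: lipN_def)
  have [measurable]: "(\<lambda>x. f (field_at (- r) x)) \<in> borel_measurable borel"
    using lip_functions_pull[OF f] by (simp add: lipN_def)
  have "measure (law (- r)) {y \<in> space (law (- r)). \<bar>f y - h (unscale y)\<bar> > e} =
      measure GN {x. \<bar>f (field_at (- r) x) - h (unscale (field_at (- r) x))\<bar> > e}"
    using measure_law_GN[OF fm hm, where b=0 and e=e] by simp
  also have "\<dots> = measure GN {x. \<bar>f (field_at (- r) x) - h x\<bar> > e}"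
  proof (rule measure_eq_AE)
    show "AE x in GN. (x \<in> {x. \<bar>f (field_at (- r) x) - h (unscale (field_at (- r) x))\<bar> > e}) =
        (x \<in> {x. \<bar>f (field_at (- r) x) - h x\<bar> > e})"
      using AE_field by eventually_elim simp
  qed measurable
  finally show "measure (law (- r)) {y \<in> space (law (- r)). \<bar>f y - h (unscale y)\<bar> > e} \<le> e" using le by simp
qed

text \<open>All choices are uniform in the exponents near \<open>s\<close>. The intermediate
  exponent \<beta> has weights that dominate those of every nearby \<open>b\<close> and still tend
  to 0, so one \<open>n\<close> serves all of them; \<open>R\<close> depends on \<open>e\<close>
  only, and \<eta> is fixed last.\<close>

lemma lipN_change_exponent:
  assumes s: "s < \<alpha>" and e: "e > 0"
  shows "\<exists>\<eta>>0. \<forall>a b. \<bar>a - s\<bar> < \<eta> \<longrightarrow> \<bar>b - s\<bar> < \<eta> \<longrightarrow>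
    (\<forall>f\<in>lipN (pw (b - \<alpha>)). \<exists>h\<in>lipN (pw (a - \<alpha>)). measure GN {x. \<bar>f x - h x\<bar> > 2 * e} \<le> 2 * e)"
proof -
  define \<beta> where "\<beta> = (s + \<alpha>) / 2"
  have \<beta>: "s < \<beta>" "\<beta> < \<alpha>" using s by (auto simp: \<beta>_def)
  obtain L0 where L0: "L0 > 0" "\<And>L. 0 < L \<Longrightarrow> L \<le> L0 \<Longrightarrow> 3 * exp (- (e\<^sup>2 / (16 * L))) \<le> e"
    using exp_neg_square_small[OF e e] by blast
  obtain R where R: "R > 0" "3 * exp (- (R\<^sup>2 / 16)) \<le> e" using exp_neg_square_large[OF e] by blast
  have "\<forall>\<^sub>F n in sequentially. pw (\<beta> - \<alpha>) n < L0"
    using \<beta> L0 by (intro order_tendstoD(2)[OF pw_tendsto_0]) auto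
  then obtain n where n: "pw (\<beta> - \<alpha>) n < L0" by (auto simp: eventually_sequentially)
  \<comment> \<open>For fixed \<open>n\<close> the contraction factor tends to 1 as the gap
    \<open>u\<close> between the exponents vanishes, so moving values within \<open>R\<close> of the
    centre eventually costs less than \<open>e\<close>.\<close>
  have "((\<lambda>u. (1 - 1 / lam n powr (u / 2)) * R) \<longlongrightarrow> (1 - 1 / lam n powr (0 / 2)) * R) (at_right 0)"
    using lam_pos[of n] by (intro tendsto_intros) auto
  then have "\<forall>\<^sub>F u in at_right 0. (1 - 1 / lam n powr (u / 2)) * R < e"
    using lam_pos[of n] e by (intro order_tendstoD(2)) auto
  then obtain \<eta>0 where \<eta>0: "\<eta>0 > 0" "\<And>u. 0 < u \<Longrightarrow> u < \<eta>0 \<Longrightarrow> (1 - 1 / lam n powr (u / 2)) * R < e"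
    unfolding eventually_at_right_field by auto
  define \<eta> where "\<eta> = min (\<eta>0 / 2) (\<beta> - s)"
  have "\<exists>h\<in>lipN (pw (a - \<alpha>)). measure GN {x. \<bar>f x - h x\<bar> > 2 * e} \<le> 2 * e"
    if ab: "\<bar>a - s\<bar> < \<eta>" "\<bar>b - s\<bar> < \<eta>" and f: "f \<in> lipN (pw (b - \<alpha>))" for a b f
  proof (cases "b \<le> a")
    case True
    \<comment> \<open>Raising the exponent increases the distance, so in this direction the function
      itself can be kept.\<close>
    have "f \<in> lipN (pw (a - \<alpha>))"
      using f wd_mono_weight[of "pw (b - \<alpha>)" "pw (a - \<alpha>)"] pw_mono[of "b - \<alpha>" "a - \<alpha>"] True
      unfolding lipN_def by (auto intro: order_trans) (meson order_trans)
    then show ?thesis using e by (intro bexI[of _ f]) auto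
  next
    case False
    have "\<bar>a - s\<bar> < \<eta>0 / 2" "\<bar>b - s\<bar> < \<eta>0 / 2" "\<bar>b - s\<bar> < \<beta> - s" using ab by (auto simp: \<eta>_def)
    then have b\<beta>: "b < \<beta>" "b - a < \<eta>0" by linarith+
    have bneg: "b - \<alpha> \<le> 0" using b\<beta> \<beta> by simp
    define q where "q = lam n powr ((b - a) / 2)"
    show ?thesis
    proof (rule lipN_rescale[where R=R and n=n and q=q])
      show "0 < pw (b - \<alpha>) k" "0 < pw (a - \<alpha>) k" for k by (rule pw_pos)+
      show "decseq (pw (b - \<alpha>))" by (rule pw_decseq[OF bneg])
      show "pw (b - \<alpha>) 0 \<le> 1" by (rule pw_le_1[OF bneg])
      have "pw (b - \<alpha>) n \<le> L0" using pw_mono[of "b - \<alpha>" "\<beta> - \<alpha>" n] b\<beta> n by simp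
      then show "3 * exp (- (e\<^sup>2 / (16 * pw (b - \<alpha>) n))) \<le> e" by (intro L0 pw_pos)
      show "1 \<le> q" unfolding q_def using lam_ge_1[of n] False by (intro ge_one_powr_ge_zero) auto
      show "(1 - 1 / q) * R \<le> e" unfolding q_def using \<eta>0(2)[of "b - a"] False b\<beta> by simp
      fix k assume k: "k < n"
      have "pw (b - \<alpha>) k = lam k powr (b - a) * pw (a - \<alpha>) k" by (simp flip: powr_add)
      also have "\<dots> \<le> lam n powr (b - a) * pw (a - \<alpha>) k"
        using False inc k lam_pos[of k] by (intro mult_right_mono powr_mono2) (auto simp: incseq_def)
      also have "lam n powr (b - a) = q\<^sup>2" unfolding q_def power2_eq_square by (simp flip: powr_add)
      finally show "pw (b - \<alpha>) k \<le> q\<^sup>2 * pw (a - \<alpha>) k" .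
    qed (use e R f in auto)
  qed
  moreover have "\<eta> > 0" using \<eta>0 \<beta> by (simp add: \<eta>_def)
  ultimately show ?thesis by blast
qed

lemma d_conc_X_tendsto:
  assumes \<sigma>: "\<sigma> \<longlonglongrightarrow> s" and s: "s < \<alpha>"
  shows "(\<lambda>n :: nat. d_conc (X (\<sigma> n)) (X s)) \<longlonglongrightarrow> 0"
proof (rule order_tendstoI)
  fix a :: ennreal assume "0 < a"
  then obtain e where e: "e > 0" "ennreal e < a" using ex_ennreal_between_0 by blast
  define e' where "e' = e / 2"
  have e': "e' > 0" "e = 2 * e'" using e by (auto simp: e'_def)
  obtain \<eta> where \<eta>: "\<eta> > 0" and H: "\<And>a b f. \<bar>a - s\<bar> < \<eta> \<Longrightarrow> \<bar>b - s\<bar> < \<eta> \<Longrightarrow>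
    f \<in> lipN (pw (b - \<alpha>)) \<Longrightarrow> \<exists>h\<in>lipN (pw (a - \<alpha>)). measure GN {x. \<bar>f x - h x\<bar> > e} \<le> e"
    using lipN_change_exponent[OF s e'(1)] unfolding e'(2) by blast
  have tr: "\<exists>g\<in>lip_functions (X a). measure (law (- r)) {y \<in> space (law (- r)). \<bar>f y - g y\<bar> > e} \<le> e"
    if "\<bar>a - s\<bar> < \<eta>" "\<bar>b - s\<bar> < \<eta>" "f \<in> lip_functions (X b)" for a b f
    using H[OF that(1,2) lip_functions_pull[OF that(3)]] lip_functions_close[OF that(3)] by blast
  have "\<forall>\<^sub>F n in sequentially. dist (\<sigma> n) s < \<eta>" by (rule tendstoD[OF \<sigma> \<eta>])
  then show "\<forall>\<^sub>F n in sequentially. d_conc (X (\<sigma> n)) (X s) < a"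
  proof eventually_elim
    case (elim n)
    then have close: "\<bar>\<sigma> n - s\<bar> < \<eta>" "\<bar>s - s\<bar> < \<eta>" using \<eta> by (auto simp: dist_real_def)
    have "d_conc (X (\<sigma> n)) (X s) \<le> ennreal e"
    proof (rule d_conc_le[OF _ _ _ _ parameters_X e(1)])
      show "\<exists>g\<in>lip_functions (X s). measure (meas (X (\<sigma> n))) {x \<in> space (meas (X (\<sigma> n))). \<bar>f x - g x\<bar> > e} \<le> e"
        if "f \<in> lip_functions (X (\<sigma> n))" for f
        using tr[OF close(2,1) that] by simp
      show "\<exists>f\<in>lip_functions (X (\<sigma> n)). measure (meas (X (\<sigma> n))) {x \<in> space (meas (X (\<sigma> n))). \<bar>f x - g x\<bar> > e} \<le> e"
        if "g \<in> lip_functions (X s)" for g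
        using tr[OF close that] by (simp add: abs_minus_commute)
    qed (simp_all add: prob_space_law sets_law)
    then show ?case using e(2) by (rule le_less_trans)
  qed
qed simp


text \<open>Coordinates are continuous for the norm, so \<open>z\<close> is the only possible limit
  of its truncations; they converge to it as soon as its norm is finite.\<close>

lemma limitin_truncations:
  "limitin T (\<lambda>n. mix n z (\<lambda>_. 0)) x sequentially \<longleftrightarrow> x = z \<and> z \<in> l2 V"
proof
  assume L: "limitin T (\<lambda>n. mix n z (\<lambda>_. 0)) x sequentially"
  then have x: "x \<in> l2 V" and lim: "(\<lambda>n. wd V (mix n z (\<lambda>_. 0)) x) \<longlonglongrightarrow> 0"
    unfolding HV.limitin_iff by auto
  have "z k = x k" for k
  proof -
    have "ennreal (sqrt (V k) * \<bar>z k - x k\<bar>) \<le> 0"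
    proof (rule tendsto_lowerbound[OF lim])
      have "ennreal (sqrt (V k) * \<bar>z k - x k\<bar>) \<le> wd V (mix n z (\<lambda>_. 0)) x" if "k < n" for n
        using coord_le_wd[of V k "mix n z (\<lambda>_. 0)" x] HV.nonneg that by (simp add: mix_def)
      then show "\<forall>\<^sub>F n in sequentially. ennreal (sqrt (V k) * \<bar>z k - x k\<bar>) \<le> wd V (mix n z (\<lambda>_. 0)) x"
        using eventually_gt_at_top[of k] by (rule eventually_mono[rotated])
    qed simp
    then have "sqrt (V k) * \<bar>z k - x k\<bar> \<le> 0" by (simp add: ennreal_eq_0_iff)
    moreover have "0 < sqrt (V k)" using lam_pos[of k] by simp
    ultimately show ?thesis by (auto simp: mult_le_0_iff)
  qed
  then have "x = z" by auto
  then show "x = z \<and> z \<in> l2 V" using x by simp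
next
  assume xz: "x = z \<and> z \<in> l2 V"
  have "mix n z (\<lambda>_. 0) \<in> l2 V" for n
    by (rule HV.finite_support_l2[of n]) (simp add: mix_def)
  with xz show "limitin T (\<lambda>n. mix n z (\<lambda>_. 0)) x sequentially"
    unfolding HV.limitin_iff using HV.truncation_tendsto[of z]
    by auto
qed

text \<open>The partial sums are the truncations of the scaled sequence, so the series converges
  exactly where the sequence lies in \<open>l2 V\<close>. The identity holds for every \<omega>,
  including those where the default value is taken.\<close>

lemma gaussian_field_eq: "gaussian_field lam r \<alpha> \<xi> \<omega> = field_at (- r) (\<lambda>k. \<xi> k \<omega>)"
proof -
  let ?z = "scale (\<lambda>k. \<xi> k \<omega>)"
  have "field_partial_sum lam \<alpha> \<xi> \<omega> n = mix n ?z (\<lambda>_. 0)" for n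
  proof
    fix i
    have "(\<Sum>k<n. lam k powr (- \<alpha> / 2) * \<xi> k \<omega> * basis_vec k i) = (\<Sum>k<n. if i = k then ?z k else 0)"
      by (rule sum.cong) (auto simp: basis_vec_def scale_def)
    then show "field_partial_sum lam \<alpha> \<xi> \<omega> n i = mix n ?z (\<lambda>_. 0) i"
      by (simp add: field_partial_sum_def mix_def)
  qed
  then have "field_partial_sum lam \<alpha> \<xi> \<omega> = (\<lambda>n. mix n ?z (\<lambda>_. 0))" by blast
  moreover have "H_topology lam (- r) = T" by (rule H_topology_eq) (rule lam_pos)
  ultimately have "limitin (H_topology lam (- r)) (field_partial_sum lam \<alpha> \<xi> \<omega>) x sequentially \<longleftrightarrow> x = ?z \<and> ?z \<in> l2 V" for x
    by (simp only: limitin_truncations)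
  then show ?thesis by (simp add: gaussian_field_def field_at_def)
qed

end

section \<open>From the given random variables to the product Gaussian measure\<close>

lemma distr_iid_gauss:
  fixes P :: "'w measure" and \<xi> :: "nat \<Rightarrow> 'w \<Rightarrow> real"
  assumes "prob_space P" and ind: "prob_space.indep_vars P (\<lambda>_. borel) \<xi> UNIV"
    and dis: "\<And>k. distributed P lborel (\<xi> k) std_normal_density"
  shows "(\<lambda>\<omega> k. \<xi> k \<omega>) \<in> borel_measurable P" "distr P GN (\<lambda>\<omega> k. \<xi> k \<omega>) = GN"
proof -
  interpret P: prob_space P by fact
  have rv [measurable]: "\<xi> k \<in> borel_measurable P" for k
    using distributed_measurable[OF dis[of k]] by simp
  show m: "(\<lambda>\<omega> k. \<xi> k \<omega>) \<in> borel_measurable P"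
    by (rule measurable_coordinatewise_then_product) (rule rv)
  have g: "distr P borel (\<xi> k) = gauss" for k
  proof -
    have "distr P borel (\<xi> k) = distr P lborel (\<xi> k)" by (rule distr_cong) auto
    then show ?thesis by (simp add: distributed_distr_eq_density[OF dis[of k]])
  qed
  have "distr P (PiM UNIV (\<lambda>_. borel)) (\<lambda>\<omega>. \<lambda>k\<in>UNIV. \<xi> k \<omega>) = PiM UNIV (\<lambda>k. distr P borel (\<xi> k))"
    using P.indep_vars_iff_distr_eq_PiM[of UNIV \<xi> "\<lambda>_. borel"] ind rv by simp
  also have "\<dots> = GN" by (simp add: g GN_def)
  finally have "distr P (PiM UNIV (\<lambda>_. borel)) (\<lambda>\<omega> k. \<xi> k \<omega>) = GN" by (simp add: restrict_UNIV)
  moreover have "distr P (PiM UNIV (\<lambda>_. borel)) (\<lambda>\<omega> k. \<xi> k \<omega>) = distr P GN (\<lambda>\<omega> k. \<xi> k \<omega>)"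
    by (rule distr_cong) (simp_all add: sets_PiM_equal_borel)
  ultimately show "distr P GN (\<lambda>\<omega> k. \<xi> k \<omega>) = GN" by simp
qed

lemma (in gaussian_scale) gaussian_emm_eq:
  assumes "prob_space P" and "prob_space.indep_vars P (\<lambda>_. borel) \<xi> UNIV"
    and "\<And>k. distributed P lborel (\<xi> k) std_normal_density"
  shows "gaussian_emm lam r \<alpha> P \<xi> s = X s"
proof -
  note iid = distr_iid_gauss[OF assms]
  have T: "H_topology lam (- r) = T" by (rule H_topology_eq) (rule lam_pos)
  have "H_ext_dist lam s = wd (pw s)"
    by (intro ext H_ext_dist_eq) (rule lam_pos)
  moreover have "distr P (borel_of T) (gaussian_field lam r \<alpha> \<xi>) = law (- r)"
  proof -
    have "gaussian_field lam r \<alpha> \<xi> = field_at (- r) \<circ> (\<lambda>\<omega> k. \<xi> k \<omega>)"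
      by (simp add: fun_eq_iff gaussian_field_eq)
    then have "distr P (borel_of T) (gaussian_field lam r \<alpha> \<xi>) =
        distr (distr P GN (\<lambda>\<omega> k. \<xi> k \<omega>)) (borel_of T) (field_at (- r))"
      using distr_distr[OF field_at_measurable, of "\<lambda>\<omega> k. \<xi> k \<omega>" P "- r"] iid(1)
      by (simp cong: measurable_cong_sets)
    then show ?thesis by (simp add: iid(2) law_def)
  qed
  ultimately show ?thesis by (simp add: gaussian_emm_def X_def T)
qed

theorem corollary1p13:
  fixes d r \<alpha> :: real and lam :: "nat \<Rightarrow> real"
    and P :: "'w measure" and \<xi> :: "nat \<Rightarrow> 'w \<Rightarrow> real"
  assumes "d > 0"
    and "1 \<le> lam 0" and "incseq lam" and "filterlim lam at_top sequentially"
    and "\<exists>c C. 0 < c \<and> c \<le> C \<and>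
           (\<forall>k. c * real (k + 1) powr (2 / d) \<le> lam k \<and> lam k \<le> C * real (k + 1) powr (2 / d))"
    and "\<alpha> + r > d / 2"
    and "prob_space P" and "prob_space.indep_vars P (\<lambda>_. borel) \<xi> UNIV"
    and "\<And>k. distributed P lborel (\<xi> k) std_normal_density"
  shows "(\<forall>s. s + r \<ge> 0 \<longrightarrow>
            (gaussian_emm lam r \<alpha> P \<xi> s \<in> X_conc \<longleftrightarrow> s < \<alpha>)) \<and>
         (\<forall>s. s + r \<ge> 0 \<longrightarrow>
            (gaussian_emm lam r \<alpha> P \<xi> s \<in> boundary_X_conc \<longleftrightarrow> \<alpha> - d / 2 \<le> s \<and> s < \<alpha>)) \<and>
         (\<forall>(\<sigma> :: nat \<Rightarrow> real) s. \<sigma> \<longlonglongrightarrow> s \<and> s < \<alpha> \<and> (\<forall>\<^sub>F n in sequentially. \<sigma> n + r \<ge> 0) \<longrightarrow>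
            (\<lambda>n. d_conc (gaussian_emm lam r \<alpha> P \<xi> (\<sigma> n)) (gaussian_emm lam r \<alpha> P \<xi> s))
              \<longlonglongrightarrow> 0)"
proof -
  obtain c C where "0 < c" "\<And>k. c * real (k + 1) powr (2 / d) \<le> lam k"
    "\<And>k. lam k \<le> C * real (k + 1) powr (2 / d)"
    using assms(5) by blast
  then interpret gaussian_scale d r \<alpha> lam c C
    using assms(1-4,6) by unfold_locales
  note eq = gaussian_emm_eq[OF assms(7-9)]
  have conc: "X s \<in> X_conc \<longleftrightarrow> s < \<alpha>" if "s + r \<ge> 0" for s
    unfolding X_conc_def
    using emm_space_X[OF that] concentrated_X[of s] not_concentrated_X[of s] by (cases "s < \<alpha>") auto
  have bdry: "X s \<in> boundary_X_conc \<longleftrightarrow> \<alpha> - d / 2 \<le> s \<and> s < \<alpha>" if sr: "s + r \<ge> 0" for s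
  proof (cases "s < \<alpha> - d / 2")
    case True
    then show ?thesis
      using X_iso_mm_space[OF sr True] by (auto simp: boundary_X_conc_def)
  next
    case False
    have "\<not> (\<exists>Y :: (nat \<Rightarrow> real) emm. mm_space Y \<and> emm_iso (X s) Y)" if "s < \<alpha>"
      using X_not_iso_mm_space[of s] False that by force
    then show ?thesis
      using conc[OF sr] False by (auto simp: boundary_X_conc_def)
  qed
  show ?thesis
    unfolding eq using conc bdry d_conc_X_tendsto by blast
qed

end
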